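(* Let $(M,g)$ be a closed and orientable Riemannian manifold. If $X_t$ is a solution of the Navier-Stokes equations (without pressure) $$\partial_t X_t+\nabla_{X_t}X_t=\operatorname{div}(S_t),\qquad \operatorname{div}(X_t)=0,$$ where $S_t$ is the stress tensor with components $(S_t)_{ij}=\nabla_i(X_t)_j+\nabla_j(X_t)_i$, then $$\frac{d}{dt}\left(\int_M|X_t|^2\,dV\right)=-2\,\mathcal{E}(X_t)\le 0.$$ In particular, $$\int_M|X_t|^2\,dV\le\int_M|X_0|^2\,dV .$$
   Context: Closed means compact without boundary; all manifolds and vector fields are smooth. $\nabla$ is the Levi-Civita connection of $g$, $dV$ the volume form, $\operatorname{div}(X)=\nabla_iX^i$, and for a symmetric 2-tensor $S$, $\operatorname{div}(S)$ is the vector field $\operatorname{div}(S)^i=\nabla_jS^{ij}$; thus the first equation reads $\partial_t(X_t)^i+(\nabla_{X_t}X_t)^i=\Delta(X_t)^i+\nabla^i\operatorname{div}(X_t)+R^i{}_j(X_t)^j$, with $\Delta=g^{k\ell}\nabla_k\nabla_\ell$ and $R_{ij}$ the Ricci curvature. For a vector field $X$, $$\mathcal{E}(X):=\int_M\left[|\nabla X|^2+|\operatorname{div}(X)|^2-\operatorname{Ric}(X,X)\right]dV .$$ Norms are the pointwise tensor norms induced by $g$ ($|\nabla X|^2=\nabla_iX_j\nabla^iX^j$). *)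

theory Defs
  imports "HOL-Analysis.Analysis"
begin

section \<open>Smooth maps between Euclidean spaces\<close>

text \<open>Iterated directional derivatives, taken within \<open>S\<close>. On an open set these are the ordinary
  ones; on \<open>I \<times> V\<close> with \<open>V\<close> open and \<open>I\<close> a nondegenerate interval (where the derivative within the
  set is still unique) the time derivatives at the endpoints of \<open>I\<close> are one-sided.\<close>

primrec iter_deriv ::
  "'a::euclidean_space set \<Rightarrow> 'a list \<Rightarrow> ('a \<Rightarrow> 'b::real_normed_vector) \<Rightarrow> 'a \<Rightarrow> 'b" where
  "iter_deriv S [] f = f"
| "iter_deriv S (b # bs) f = iter_deriv S bs (\<lambda>x. frechet_derivative f (at x within S) b)"

text \<open>All iterated partial derivatives are differentiable, hence also continuous: this is
  \<open>C\<^sup>\<infinity>\<close> for the sets described above.\<close>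

definition smooth_on :: "'a::euclidean_space set \<Rightarrow> ('a \<Rightarrow> 'b::real_normed_vector) \<Rightarrow> bool" where
  "smooth_on S f \<longleftrightarrow> (\<forall>bs. set bs \<subseteq> Basis \<longrightarrow> iter_deriv S bs f differentiable_on S)"


section \<open>Smooth manifolds\<close>

text \<open>A chart is a domain together with a coordinate map; the values of the map outside the domain
  are irrelevant.\<close>

type_synonym ('m, 'n) chart = "'m set \<times> ('m \<Rightarrow> real ^ 'n)"

definition chart_dom :: "('m, 'n) chart \<Rightarrow> 'm set" where
  "chart_dom c = fst c"

definition chart_map :: "('m, 'n) chart \<Rightarrow> 'm \<Rightarrow> real ^ 'n" where
  "chart_map c = snd c"

definition chart_img :: "('m, 'n) chart \<Rightarrow> (real ^ 'n) set" where
  "chart_img c = chart_map c ` chart_dom c"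

definition chart_inv :: "('m, 'n) chart \<Rightarrow> real ^ 'n \<Rightarrow> 'm" where
  "chart_inv c = inv_into (chart_dom c) (chart_map c)"

definition is_chart :: "'m topology \<Rightarrow> ('m, 'n::finite) chart \<Rightarrow> bool" where
  "is_chart T c \<longleftrightarrow> openin T (chart_dom c) \<and> open (chart_img c) \<and>
     homeomorphic_map (subtopology T (chart_dom c)) (top_of_set (chart_img c)) (chart_map c)"

definition overlap :: "('m, 'n) chart \<Rightarrow> ('m, 'n) chart \<Rightarrow> (real ^ 'n) set" where
  "overlap c d = chart_map c ` (chart_dom c \<inter> chart_dom d)"

definition transition :: "('m, 'n) chart \<Rightarrow> ('m, 'n) chart \<Rightarrow> real ^ 'n \<Rightarrow> real ^ 'n" where
  "transition c d = (\<lambda>x. chart_map d (chart_inv c x))"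

definition smooth_atlas :: "'m topology \<Rightarrow> ('m, 'n::finite) chart set \<Rightarrow> bool" where
  "smooth_atlas T A \<longleftrightarrow>
     (\<forall>c\<in>A. is_chart T c) \<and> (\<Union>c\<in>A. chart_dom c) = topspace T \<and>
     (\<forall>c\<in>A. \<forall>d\<in>A. smooth_on (overlap c d) (transition c d))"

text \<open>The smooth structure is given by an arbitrary smooth atlas, not necessarily a maximal one.
  There is no boundary, as charts map onto open subsets of Euclidean space.\<close>

definition smooth_manifold :: "'m topology \<Rightarrow> ('m, 'n::finite) chart set \<Rightarrow> bool" where
  "smooth_manifold T A \<longleftrightarrow>
     Hausdorff_space T \<and>
     (\<exists>\<B>. countable \<B> \<and> (\<forall>V\<in>\<B>. openin T V) \<and>
        (\<forall>U p. openin T U \<and> p \<in> U \<longrightarrow> (\<exists>V\<in>\<B>. p \<in> V \<and> V \<subseteq> U))) \<and>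
     smooth_atlas T A"

text \<open>As \<open>A\<close> need not be maximal, the oriented atlas is sought among all atlases compatible
  with \<open>A\<close>.\<close>

definition orientable :: "'m topology \<Rightarrow> ('m, 'n::finite) chart set \<Rightarrow> bool" where
  "orientable T A \<longleftrightarrow>
     (\<exists>B. smooth_atlas T B \<and> smooth_atlas T (A \<union> B) \<and>
        (\<forall>c\<in>B. \<forall>d\<in>B. \<forall>x\<in>overlap c d. det (jacobian (transition c d) (at x)) > 0))"


section \<open>Tensor fields in components\<close>

text \<open>A tensor field assigns to every chart its components as functions of the coordinates, subject
  to the tensor transformation law. A scalar field has type \<^typ>\<open>('m, 'n) chart \<Rightarrow> real ^ 'n \<Rightarrow> real\<close>.\<close>

type_synonym ('m, 'n) vfield = "('m, 'n) chart \<Rightarrow> real ^ 'n \<Rightarrow> real ^ 'n"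
type_synonym ('m, 'n) tensor2 = "('m, 'n) chart \<Rightarrow> real ^ 'n \<Rightarrow> real ^ 'n ^ 'n"

definition vector_field :: "('m, 'n::finite) chart set \<Rightarrow> ('m, 'n) vfield \<Rightarrow> bool" where
  "vector_field A X \<longleftrightarrow>
     (\<forall>c\<in>A. smooth_on (chart_img c) (X c)) \<and>
     (\<forall>c\<in>A. \<forall>d\<in>A. \<forall>x\<in>overlap c d.
        X d (transition c d x) = jacobian (transition c d) (at x) *v X c x)"

definition time_dependent_vector_field ::
  "('m, 'n::finite) chart set \<Rightarrow> real set \<Rightarrow> (real \<Rightarrow> ('m, 'n) vfield) \<Rightarrow> bool" where
  "time_dependent_vector_field A I X \<longleftrightarrow>
     (\<forall>t\<in>I. vector_field A (X t)) \<and>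
     (\<forall>c\<in>A. smooth_on (I \<times> chart_img c) (\<lambda>(t, x). X t c x))"

definition riemannian_metric :: "('m, 'n::finite) chart set \<Rightarrow> ('m, 'n) tensor2 \<Rightarrow> bool" where
  "riemannian_metric A g \<longleftrightarrow>
     (\<forall>c\<in>A. smooth_on (chart_img c) (g c)) \<and>
     (\<forall>c\<in>A. \<forall>x\<in>chart_img c. transpose (g c x) = g c x \<and>
        (\<forall>v. v \<noteq> 0 \<longrightarrow> v \<bullet> (g c x *v v) > 0)) \<and>
     (\<forall>c\<in>A. \<forall>d\<in>A. \<forall>x\<in>overlap c d.
        g c x = transpose (jacobian (transition c d) (at x)) ** g d (transition c d x)
                ** jacobian (transition c d) (at x))"


section \<open>Tensor calculus in a chart\<close>

text \<open>Below, \<open>G\<close> and \<open>Y\<close> are the components \<open>G\<^sub>i\<^sub>j\<close> of the metric and \<open>Y\<^sup>i\<close> of a vector field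
  in a fixed chart, and \<open>x\<close> is a point in its image.\<close>

definition pd :: "'n::finite \<Rightarrow> (real ^ 'n \<Rightarrow> real) \<Rightarrow> real ^ 'n \<Rightarrow> real" where
  "pd i f x = frechet_derivative f (at x) (axis i 1)"

text \<open>\<open>christoffel G x k i j\<close> is \<open>\<Gamma>\<^sup>k\<^sub>i\<^sub>j\<close>.\<close>

definition christoffel ::
  "(real ^ 'n \<Rightarrow> real ^ 'n ^ 'n) \<Rightarrow> real ^ 'n \<Rightarrow> 'n::finite \<Rightarrow> 'n \<Rightarrow> 'n \<Rightarrow> real" where
  "christoffel G x k i j =
     (1 / 2) * (\<Sum>l\<in>UNIV. matrix_inv (G x) $ k $ l *
        (pd i (\<lambda>y. G y $ j $ l) x + pd j (\<lambda>y. G y $ i $ l) x - pd l (\<lambda>y. G y $ i $ j) x))"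

text \<open>\<open>cov_vec G Y x i j\<close> is \<open>\<nabla>\<^sub>i Y\<^sup>j\<close>.\<close>

definition cov_vec ::
  "(real ^ 'n \<Rightarrow> real ^ 'n ^ 'n) \<Rightarrow> (real ^ 'n \<Rightarrow> real ^ 'n) \<Rightarrow> real ^ 'n \<Rightarrow> 'n::finite \<Rightarrow> 'n \<Rightarrow> real" where
  "cov_vec G Y x i j = pd i (\<lambda>y. Y y $ j) x + (\<Sum>k\<in>UNIV. christoffel G x j i k * Y x $ k)"

text \<open>\<open>cov_covec G w x i j\<close> is \<open>\<nabla>\<^sub>i w\<^sub>j\<close>.\<close>

definition cov_covec ::
  "(real ^ 'n \<Rightarrow> real ^ 'n ^ 'n) \<Rightarrow> (real ^ 'n \<Rightarrow> real ^ 'n) \<Rightarrow> real ^ 'n \<Rightarrow> 'n::finite \<Rightarrow> 'n \<Rightarrow> real" where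
  "cov_covec G w x i j = pd i (\<lambda>y. w y $ j) x - (\<Sum>k\<in>UNIV. christoffel G x k i j * w x $ k)"

text \<open>\<open>lower G Y x $ j\<close> is \<open>Y\<^sub>j\<close>.\<close>

definition lower ::
  "(real ^ 'n \<Rightarrow> real ^ 'n ^ 'n) \<Rightarrow> (real ^ 'n \<Rightarrow> real ^ 'n) \<Rightarrow> real ^ 'n \<Rightarrow> real ^ 'n::finite" where
  "lower G Y x = G x *v Y x"

text \<open>\<open>raise2 G S x i j\<close> is \<open>S\<^sup>i\<^sup>j\<close>, for a covariant 2-tensor with components \<open>S x i j = S\<^sub>i\<^sub>j\<close>.\<close>

definition raise2 ::
  "(real ^ 'n \<Rightarrow> real ^ 'n ^ 'n) \<Rightarrow> (real ^ 'n \<Rightarrow> 'n \<Rightarrow> 'n \<Rightarrow> real) \<Rightarrow>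
   real ^ 'n \<Rightarrow> 'n::finite \<Rightarrow> 'n \<Rightarrow> real" where
  "raise2 G S x i j =
     (\<Sum>a\<in>UNIV. \<Sum>b\<in>UNIV. matrix_inv (G x) $ i $ a * matrix_inv (G x) $ j $ b * S x a b)"

text \<open>\<open>div_tensor G S x $ i\<close> is \<open>\<nabla>\<^sub>j S\<^sup>i\<^sup>j\<close>, for a covariant 2-tensor \<open>S\<close>.\<close>

definition div_tensor ::
  "(real ^ 'n \<Rightarrow> real ^ 'n ^ 'n) \<Rightarrow> (real ^ 'n \<Rightarrow> 'n \<Rightarrow> 'n \<Rightarrow> real) \<Rightarrow> real ^ 'n \<Rightarrow> real ^ 'n::finite" where
  "div_tensor G S x = (\<chi> i. \<Sum>j\<in>UNIV.
     pd j (\<lambda>y. raise2 G S y i j) x +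
     (\<Sum>k\<in>UNIV. christoffel G x i j k * raise2 G S x k j + christoffel G x j j k * raise2 G S x i k))"

definition div_vec ::
  "(real ^ 'n \<Rightarrow> real ^ 'n ^ 'n) \<Rightarrow> (real ^ 'n \<Rightarrow> real ^ 'n) \<Rightarrow> real ^ 'n::finite \<Rightarrow> real" where
  "div_vec G Y x = (\<Sum>i\<in>UNIV. cov_vec G Y x i i)"

text \<open>\<open>cov_along G Y Z\<close> is \<open>\<nabla>\<^sub>Y Z\<close>.\<close>

definition cov_along ::
  "(real ^ 'n \<Rightarrow> real ^ 'n ^ 'n) \<Rightarrow> (real ^ 'n \<Rightarrow> real ^ 'n) \<Rightarrow> (real ^ 'n \<Rightarrow> real ^ 'n) \<Rightarrow>
   real ^ 'n \<Rightarrow> real ^ 'n::finite" where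
  "cov_along G Y Z x = (\<chi> j. \<Sum>i\<in>UNIV. Y x $ i * cov_vec G Z x i j)"

definition stress ::
  "(real ^ 'n \<Rightarrow> real ^ 'n ^ 'n) \<Rightarrow> (real ^ 'n \<Rightarrow> real ^ 'n) \<Rightarrow> real ^ 'n \<Rightarrow> 'n::finite \<Rightarrow> 'n \<Rightarrow> real" where
  "stress G Y x i j = cov_covec G (lower G Y) x i j + cov_covec G (lower G Y) x j i"

definition norm2_vec ::
  "(real ^ 'n \<Rightarrow> real ^ 'n ^ 'n) \<Rightarrow> (real ^ 'n \<Rightarrow> real ^ 'n) \<Rightarrow> real ^ 'n::finite \<Rightarrow> real" where
  "norm2_vec G Y x = Y x \<bullet> (G x *v Y x)"

text \<open>\<open>norm2_cov G Y x\<close> is \<open>|\<nabla>Y|\<^sup>2 = \<nabla>\<^sub>i Y\<^sub>j \<nabla>\<^sup>i Y\<^sup>j\<close>.\<close>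

definition norm2_cov ::
  "(real ^ 'n \<Rightarrow> real ^ 'n ^ 'n) \<Rightarrow> (real ^ 'n \<Rightarrow> real ^ 'n) \<Rightarrow> real ^ 'n::finite \<Rightarrow> real" where
  "norm2_cov G Y x = (\<Sum>i\<in>UNIV. \<Sum>j\<in>UNIV.
     cov_covec G (lower G Y) x i j * raise2 G (cov_covec G (lower G Y)) x i j)"

text \<open>\<open>R\<^sub>j\<^sub>k = \<partial>\<^sub>i \<Gamma>\<^sup>i\<^sub>j\<^sub>k - \<partial>\<^sub>j \<Gamma>\<^sup>i\<^sub>i\<^sub>k + \<Gamma>\<^sup>i\<^sub>i\<^sub>p \<Gamma>\<^sup>p\<^sub>j\<^sub>k - \<Gamma>\<^sup>i\<^sub>j\<^sub>p \<Gamma>\<^sup>p\<^sub>i\<^sub>k\<close>, the trace of the curvature tensor, with the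
  sign for which round spheres have positive Ricci curvature.\<close>

definition ricci ::
  "(real ^ 'n \<Rightarrow> real ^ 'n ^ 'n) \<Rightarrow> real ^ 'n \<Rightarrow> 'n::finite \<Rightarrow> 'n \<Rightarrow> real" where
  "ricci G x j k = (\<Sum>i\<in>UNIV.
     pd i (\<lambda>y. christoffel G y i j k) x - pd j (\<lambda>y. christoffel G y i i k) x +
     (\<Sum>p\<in>UNIV. christoffel G x i i p * christoffel G x p j k
              - christoffel G x i j p * christoffel G x p i k))"

definition ricci_quad ::
  "(real ^ 'n \<Rightarrow> real ^ 'n ^ 'n) \<Rightarrow> (real ^ 'n \<Rightarrow> real ^ 'n) \<Rightarrow> real ^ 'n::finite \<Rightarrow> real" where
  "ricci_quad G Y x = (\<Sum>i\<in>UNIV. \<Sum>j\<in>UNIV. ricci G x i j * Y x $ i * Y x $ j)"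

text \<open>The connection given by \<^const>\<open>christoffel\<close> is the Levi-Civita connection: it is torsion-free
  and metric, \<open>\<nabla>\<^sub>k G\<^sub>i\<^sub>j = 0\<close>.\<close>

context
  fixes G :: "real ^ 'n::finite \<Rightarrow> real ^ 'n ^ 'n" and V :: "(real ^ 'n) set" and x :: "real ^ 'n"
  assumes V: "open V" "x \<in> V" and diff: "G differentiable (at x)"
    and sym: "\<And>y. y \<in> V \<Longrightarrow> transpose (G y) = G y"
begin

lemma pd_metric_sym: "pd i (\<lambda>y. G y $ j $ k) x = pd i (\<lambda>y. G y $ k $ j) x"
proof -
  have nth: "bounded_linear (\<lambda>A::real^'n^'n. A $ a $ b)" for a b
    by (intro bounded_linear_intros bounded_linear_compose[OF bounded_linear_vec_nth])
  have "(\<lambda>y. G y $ j $ k) differentiable (at x)"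
    using diff bounded_linear.has_derivative[OF nth] unfolding differentiable_def by blast
  moreover have "G y $ j $ k = G y $ k $ j" if "y \<in> V" for y
    using sym[OF that] by (metis transpose_def vec_lambda_beta)
  ultimately have "frechet_derivative (\<lambda>y. G y $ j $ k) (at x) = frechet_derivative (\<lambda>y. G y $ k $ j) (at x)"
    using V by (intro frechet_derivative_transform_within_open) auto
  then show ?thesis by (simp add: pd_def)
qed

lemma christoffel_torsion_free: "christoffel G x k i j = christoffel G x k j i"
  unfolding christoffel_def by (simp add: pd_metric_sym[of _ i j] add.commute)

lemma christoffel_metric:
  assumes inv: "invertible (G x)"
  shows "pd k (\<lambda>y. G y $ i $ j) x =
    (\<Sum>l\<in>UNIV. christoffel G x l k i * G x $ l $ j + christoffel G x l k j * G x $ i $ l)"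
proof -
  define C where "C m a b = pd a (\<lambda>y. G y $ b $ m) x + pd b (\<lambda>y. G y $ a $ m) x
    - pd m (\<lambda>y. G y $ a $ b) x" for m a b
  have Gs: "G x $ a $ b = G x $ b $ a" for a b
    using sym[OF V(2)] by (metis transpose_def vec_lambda_beta)
  have id: "(\<Sum>l\<in>UNIV. G x $ a $ l * matrix_inv (G x) $ l $ m) = (if a = m then 1 else 0)" for a m
  proof -
    have "(G x ** matrix_inv (G x)) $ a $ m = mat 1 $ a $ m"
      using inv by (metis (mono_tags, lifting) invertible_def matrix_inv_def someI_ex)
    then show ?thesis by (simp add: matrix_matrix_mult_def mat_def)
  qed
  have low: "(\<Sum>l\<in>UNIV. christoffel G x l a b * G x $ r $ l) = C r a b / 2" for a b r
  proof -
    have "(\<Sum>l\<in>UNIV. christoffel G x l a b * G x $ r $ l)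
        = (\<Sum>l\<in>UNIV. \<Sum>m\<in>UNIV. G x $ r $ l * matrix_inv (G x) $ l $ m * C m a b / 2)"
      unfolding christoffel_def C_def[symmetric]
      by (simp add: sum_distrib_left sum_distrib_right sum_divide_distrib mult_ac)
    also have "\<dots> = (\<Sum>m\<in>UNIV. (\<Sum>l\<in>UNIV. G x $ r $ l * matrix_inv (G x) $ l $ m) * C m a b / 2)"
      by (subst sum.swap) (simp add: sum_distrib_right sum_divide_distrib)
    also have "\<dots> = (\<Sum>m\<in>UNIV. if r = m then C m a b / 2 else 0)"
      unfolding id by (intro sum.cong) auto
    finally show ?thesis by simp
  qed
  have "(\<Sum>l\<in>UNIV. christoffel G x l k i * G x $ l $ j + christoffel G x l k j * G x $ i $ l)
      = C j k i / 2 + C i k j / 2"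
    unfolding sum.distrib Gs[of _ j] low ..
  also have "\<dots> = pd k (\<lambda>y. G y $ i $ j) x"
    unfolding C_def using pd_metric_sym[of k i j] pd_metric_sym[of i k j] pd_metric_sym[of j k i]
    by (simp add: field_simps)
  finally show ?thesis ..
qed

end


section \<open>Integration\<close>

definition partition_of_unity ::
  "'m topology \<Rightarrow> ('m, 'n::finite) chart set \<Rightarrow> ('m, 'n) chart set \<Rightarrow>
   (('m, 'n) chart \<Rightarrow> 'm \<Rightarrow> real) \<Rightarrow> bool" where
  "partition_of_unity T A C \<rho> \<longleftrightarrow>
     finite C \<and> C \<subseteq> A \<and>
     (\<forall>c\<in>C. (\<forall>d\<in>A. smooth_on (chart_img d) (\<lambda>x. \<rho> c (chart_inv d x))) \<and>
            (\<forall>p\<in>topspace T. \<rho> c p \<ge> 0) \<and>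
            T closure_of {p \<in> topspace T. \<rho> c p \<noteq> 0} \<subseteq> chart_dom c) \<and>
     (\<forall>p\<in>topspace T. (\<Sum>c\<in>C. \<rho> c p) = 1)"

text \<open>\<open>\<integral> f dV\<close> for a scalar field \<open>f\<close> on a closed manifold. A finite smooth partition of unity
  subordinate to the atlas exists by compactness, and the value does not depend on its choice.
  In oriented charts the component of the volume form is \<open>sqrt (det g)\<close>; this expression gives the
  same integral in charts of either orientation, so no oriented atlas has to be chosen.\<close>

definition manifold_integral ::
  "'m topology \<Rightarrow> ('m, 'n::finite) chart set \<Rightarrow> ('m, 'n) tensor2 \<Rightarrow>
   (('m, 'n) chart \<Rightarrow> real ^ 'n \<Rightarrow> real) \<Rightarrow> real" where
  "manifold_integral T A g f =
     (let (C, \<rho>) = (SOME (C, \<rho>). partition_of_unity T A C \<rho>) in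
      \<Sum>c\<in>C. LINT x:chart_img c|lborel. \<rho> c (chart_inv c x) * f c x * sqrt (det (g c x)))"

definition energy ::
  "'m topology \<Rightarrow> ('m, 'n::finite) chart set \<Rightarrow> ('m, 'n) tensor2 \<Rightarrow> ('m, 'n) vfield \<Rightarrow> real" where
  "energy T A g X = manifold_integral T A g
     (\<lambda>c x. norm2_cov (g c) (X c) x + \<bar>div_vec (g c) (X c) x\<bar>\<^sup>2 - ricci_quad (g c) (X c) x)"


section \<open>The Navier-Stokes equations without pressure\<close>

definition navier_stokes_solution ::
  "('m, 'n::finite) chart set \<Rightarrow> ('m, 'n) tensor2 \<Rightarrow> real set \<Rightarrow> (real \<Rightarrow> ('m, 'n) vfield) \<Rightarrow> bool" where
  "navier_stokes_solution A g I X \<longleftrightarrow>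
     time_dependent_vector_field A I X \<and>
     (\<forall>t\<in>I. \<forall>c\<in>A. \<forall>x\<in>chart_img c.
        vector_derivative (\<lambda>s. X s c x) (at t within I) + cov_along (g c) (X t c) (X t c) x
          = div_tensor (g c) (stress (g c) (X t c)) x \<and>
        div_vec (g c) (X t c) x = 0)"

end

theory Submission
  imports Defs
begin

text \<open>Write \<open>S = L\<^sub>X g\<close> for the stress tensor, \<open>W = S(X, \<cdot>)\<^sup>\<sharp>\<close> and suppose \<open>div X = 0\<close>. Pointwise,
  \<open>\<langle>X, div S\<rangle> = div W - |S|\<^sup>2/2\<close>, \<open>\<langle>X, \<nabla>\<^sub>X X\<rangle> = div(|X|\<^sup>2 X)/2\<close>, and commuting covariant derivatives gives
  \<open>|\<nabla>X|\<^sup>2 + (div X)\<^sup>2 - Ric(X, X) = |S|\<^sup>2/2 - div(\<nabla>\<^sub>X X)\<close>. Since divergences of global vector fields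
  integrate to zero, both the derivative of \<open>\<integral> |X|\<^sup>2\<close> and \<open>- 2 E(X)\<close> are equal to \<open>- \<integral> |S|\<^sup>2\<close>.\<close>

section \<open>Smooth maps on open sets\<close>

text \<open>The Ricci term hides the sign of \<open>energy\<close>, so the energy is never estimated
  directly: up to one divergence it is a square. No second covariant derivative and no curvature
  tensor is formed for this; the partial derivatives
  \<open>\<partial>\<^sub>i \<partial>\<^sub>j X\<^sup>i\<close> are exchanged in a chart, and the
  Christoffel terms left over regroup into the coordinate formula for Ricci. All integrals use the
  one partition of unity picked inside \<open>manifold_integral\<close>, so they are compared term
  by term and independence of the partition never enters. What must be proved globally is that the
  three fields whose divergences occur, namely \<open>\<nabla>\<^sub>X X\<close>, \<open>W\<close>
  and \<open>|X|\<^sup>2 X\<close>, obey the vector transformation law. For the first two,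
  Christoffel symbols would bring in second derivatives of the transition maps. Both fields are
  therefore written as raised one-forms built from the differential of \<open>|X|\<^sup>2\<close>
  and the exterior derivative of the lowered field, where those second derivatives cancel by
  symmetry. The interval may contain endpoints, so every time derivative is taken within
  \<open>I\<close>.\<close>

primrec Ck_on :: "nat \<Rightarrow> 'a::euclidean_space set \<Rightarrow> ('a \<Rightarrow> 'b::real_normed_vector) \<Rightarrow> bool" where
  "Ck_on 0 S f = (\<forall>x\<in>S. f differentiable (at x))"
| "Ck_on (Suc k) S f = ((\<forall>x\<in>S. f differentiable (at x)) \<and>
     (\<forall>b\<in>Basis. Ck_on k S (\<lambda>x. frechet_derivative f (at x) b)))"

lemma Ck_on_imp_differentiable: "Ck_on k S f \<Longrightarrow> x \<in> S \<Longrightarrow> f differentiable (at x)"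
  by (cases k) auto

text \<open>The sets \<open>U\<close> need not be open: \<open>Ck_on\<close> uses full derivatives
  of a total function, so it is a condition imposed separately at each point.\<close>

lemma Ck_on_local:
  "(\<And>x. x \<in> S \<Longrightarrow> \<exists>U. x \<in> U \<and> Ck_on k U f) \<Longrightarrow> Ck_on k S f"
proof (induction k arbitrary: f)
  case 0
  then show ?case by fastforce
next
  case (Suc k)
  show ?case
    unfolding Ck_on.simps
  proof (intro conjI ballI)
    fix x assume "x \<in> S"
    then show "f differentiable (at x)" using Suc.prems by fastforce
  next
    fix b :: 'a assume b: "b \<in> Basis"
    show "Ck_on k S (\<lambda>x. frechet_derivative f (at x) b)"
      using Suc.prems b by (intro Suc.IH) (metis Ck_on.simps(2))
  qed
qed

lemma Ck_on_cong:
  assumes "open S" "Ck_on k S f" "\<And>x. x \<in> S \<Longrightarrow> f x = g x"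
  shows "Ck_on k S g"
  using assms(2,3)
proof (induction k arbitrary: f g)
  case 0
  then show ?case
    unfolding Ck_on.simps differentiable_def by (metis assms(1) has_derivative_transform_within_open)
next
  case (Suc k)
  have d: "f differentiable (at x)" if "x \<in> S" for x using Suc.prems that by auto
  have d': "g differentiable (at x)" if "x \<in> S" for x
    using d[OF that] Suc.prems(2) assms(1) that
    unfolding differentiable_def by (metis has_derivative_transform_within_open)
  have "frechet_derivative f (at x) = frechet_derivative g (at x)" if "x \<in> S" for x
    by (rule frechet_derivative_transform_within_open[OF d[OF that] assms(1) that Suc.prems(2)])
  then have "Ck_on k S (\<lambda>x. frechet_derivative g (at x) b)" if "b \<in> Basis" for b
    using Suc.prems(1) that by (auto intro: Suc.IH[of "\<lambda>x. frechet_derivative f (at x) b"])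
  then show ?case using d' by auto
qed

text \<open>Lets a closure proof use whichever formula for the derivative is at hand; openness of
  \<open>S\<close> carries the regularity over to \<open>frechet_derivative\<close>.\<close>

lemma Ck_on_SucI:
  assumes "open S" "\<And>x. x \<in> S \<Longrightarrow> (f has_derivative f' x) (at x)"
    "\<And>b. b \<in> Basis \<Longrightarrow> Ck_on k S (\<lambda>x. f' x b)"
  shows "Ck_on (Suc k) S f"
proof -
  have "f' x = frechet_derivative f (at x)" if "x \<in> S" for x
    using assms(2)[OF that] by (rule frechet_derivative_at)
  then show ?thesis
    using assms by (auto simp: differentiable_def intro: Ck_on_cong[OF assms(1) assms(3)])
qed

lemma Ck_on_SucD: "Ck_on (Suc k) S f \<Longrightarrow> Ck_on k S f"
  by (induction k arbitrary: f) auto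

lemma has_derivative_frechet:
  "f differentiable (at x) \<Longrightarrow> (f has_derivative frechet_derivative f (at x)) (at x)"
  by (simp add: frechet_derivative_works)

lemma Ck_on_const: "open S \<Longrightarrow> Ck_on k S (\<lambda>x. c)"
proof (induction k arbitrary: c)
  case (Suc k)
  show ?case by (rule Ck_on_SucI[where f' = "\<lambda>x h. 0"]) (use Suc in auto)
qed auto

lemma Ck_on_ident: "open S \<Longrightarrow> Ck_on k S (\<lambda>x. x)"
proof (induction k)
  case (Suc k)
  show ?case by (rule Ck_on_SucI[where f' = "\<lambda>x h. h"]) (use Suc in \<open>auto intro: Ck_on_const\<close>)
qed auto

lemma Ck_on_bounded_linear:
  assumes "open S" "bounded_linear L"
  shows "Ck_on k S f \<Longrightarrow> Ck_on k S (\<lambda>x. L (f x))"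
proof (induction k arbitrary: f)
  case 0
  then show ?case
    using bounded_linear.has_derivative[OF assms(2)] by (fastforce simp: differentiable_def)
next
  case (Suc k)
  show ?case
    using Suc.prems
    by (intro Ck_on_SucI[OF assms(1), where f' = "\<lambda>x h. L (frechet_derivative f (at x) h)"] Suc.IH
        bounded_linear.has_derivative[OF assms(2)] has_derivative_frechet) auto
qed

lemma Ck_on_add:
  assumes "open S"
  shows "Ck_on k S f \<Longrightarrow> Ck_on k S g \<Longrightarrow> Ck_on k S (\<lambda>x. f x + g x)"
proof (induction k arbitrary: f g)
  case (Suc k)
  show ?case
    using Suc.prems
    by (intro Ck_on_SucI[OF assms, where f' = "\<lambda>x h. frechet_derivative f (at x) h + frechet_derivative g (at x) h"]
        Suc.IH has_derivative_add has_derivative_frechet) auto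
qed auto

lemma Ck_on_sum:
  assumes "open S" "\<And>i. i \<in> A \<Longrightarrow> Ck_on k S (f i)"
  shows "Ck_on k S (\<lambda>x. \<Sum>i\<in>A. f i x)"
  using assms(2)
  by (induction A rule: infinite_finite_induct) (auto intro: Ck_on_const Ck_on_add assms(1))

text \<open>The product rule leaves one factor undifferentiated at order \<open>Suc k\<close>;
  \<open>Ck_on_SucD\<close> lowers it to the order of the induction hypothesis.\<close>

lemma Ck_on_bilinear:
  assumes "open S" "bounded_bilinear P"
  shows "Ck_on k S f \<Longrightarrow> Ck_on k S g \<Longrightarrow> Ck_on k S (\<lambda>x. P (f x) (g x))"
proof (induction k arbitrary: f g)
  case 0
  then show ?case
    using bounded_bilinear.FDERIV[OF assms(2)] by (fastforce simp: differentiable_def)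
next
  case (Suc k)
  show ?case
    using Suc.prems Ck_on_SucD[OF Suc.prems(1)] Ck_on_SucD[OF Suc.prems(2)]
    by (intro Ck_on_SucI[OF assms(1), where f' = "\<lambda>x h. P (f x) (frechet_derivative g (at x) h) + P (frechet_derivative f (at x) h) (g x)"]
        Suc.IH Ck_on_add assms(1) bounded_bilinear.FDERIV[OF assms(2)] has_derivative_frechet) auto
qed

lemma linear_Basis_sum:
  fixes f :: "'a::euclidean_space \<Rightarrow> 'b::real_normed_vector"
  assumes "linear f" shows "f v = (\<Sum>e\<in>Basis. (v \<bullet> e) *\<^sub>R f e)"
proof -
  have "f (\<Sum>e\<in>Basis. (v \<bullet> e) *\<^sub>R e) = (\<Sum>e\<in>Basis. (v \<bullet> e) *\<^sub>R f e)"
    by (simp add: linear_sum[OF assms] linear_scale[OF assms])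
  then show ?thesis by (simp add: euclidean_representation)
qed

text \<open>Expanding the chain rule in a basis makes the derivative a finite sum of products of a
  component of the derivative of \<open>h\<close> and a composite of a derivative of
  \<open>f\<close> with the same \<open>h\<close>. The induction hypothesis, general in
  \<open>f\<close>, covers the latter.\<close>

lemma Ck_on_compose:
  fixes f :: "'b::euclidean_space \<Rightarrow> 'c::real_normed_vector" and h :: "'a::euclidean_space \<Rightarrow> 'b"
  assumes S: "open S" and U: "open U" "\<And>x. x \<in> S \<Longrightarrow> h x \<in> U"
  shows "Ck_on k S h \<Longrightarrow> Ck_on k U f \<Longrightarrow> Ck_on k S (\<lambda>x. f (h x))"
proof (induction k arbitrary: f)
  case 0
  then show ?case
    using U differentiable_chain_at[of h _ f] by (auto simp: o_def)
next
  case (Suc k)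
  have h: "h differentiable (at x)" if "x \<in> S" for x using Suc.prems that by auto
  have f: "f differentiable (at y)" if "y \<in> U" for y using Suc.prems that by auto
  show ?case
  proof (rule Ck_on_SucI[OF S])
    show "((\<lambda>x. f (h x)) has_derivative
       (\<lambda>v. \<Sum>e\<in>Basis. (frechet_derivative h (at x) v \<bullet> e) *\<^sub>R frechet_derivative f (at (h x)) e)) (at x)"
      if "x \<in> S" for x
      using has_derivative_compose[OF has_derivative_frechet[OF h[OF that]] has_derivative_frechet[OF f[OF U(2)[OF that]]]]
        linear_Basis_sum[OF linear_frechet_derivative[OF f[OF U(2)[OF that]]], symmetric] by simp
    fix b :: 'a assume b: "b \<in> Basis"
    show "Ck_on k S (\<lambda>x. \<Sum>e\<in>Basis. (frechet_derivative h (at x) b \<bullet> e) *\<^sub>R frechet_derivative f (at (h x)) e)"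
    proof (intro Ck_on_sum S Ck_on_bilinear[OF S bounded_bilinear_scaleR])
      fix e :: 'b assume e: "e \<in> Basis"
      show "Ck_on k S (\<lambda>x. frechet_derivative h (at x) b \<bullet> e)"
        using Suc.prems(1) b
        by (intro Ck_on_bounded_linear[OF S bounded_linear_inner_left]) auto
      show "Ck_on k S (\<lambda>x. frechet_derivative f (at (h x)) e)"
        using Suc.prems e by (auto intro: Suc.IH[OF Ck_on_SucD[OF Suc.prems(1)], of "\<lambda>y. frechet_derivative f (at y) e"])
    qed
  qed
qed

text \<open>The derivative is a product of copies of \<open>inverse\<close> itself, so each order
  feeds the next. The square root below works alike, its derivative being half the inverse of
  itself.\<close>

lemma Ck_on_inverse_real: "Ck_on k (- {0::real}) inverse"
proof (induction k)
  case 0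
  show ?case by (auto intro!: derivative_intros)
next
  case (Suc k)
  have "open (- {0::real})" by auto
  then show ?case
    using Suc
    by (intro Ck_on_SucI[where f' = "\<lambda>x h. - (inverse x * h * inverse x)"] has_derivative_inverse'
         Ck_on_bounded_linear[OF _ bounded_linear_minus[OF bounded_linear_ident]] Ck_on_bilinear[OF _ bounded_bilinear_mult]
         Ck_on_const) auto
qed

lemma Ck_on_sqrt_real: "Ck_on k {0<..} sqrt"
proof (induction k)
  case 0
  show ?case
    using DERIV_real_sqrt by (auto simp: differentiable_def has_field_derivative_def)
next
  case (Suc k)
  have opn: "open ({0<..} :: real set)" "open (- {0::real})" by auto
  show ?case
  proof (rule Ck_on_SucI[OF opn(1), where f' = "\<lambda>x. (*) (inverse (sqrt x) / 2)"])
    show "(sqrt has_derivative (*) (inverse (sqrt x) / 2)) (at x)" if "x \<in> {0<..}" for x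
      using DERIV_real_sqrt[of x] that by (simp add: has_field_derivative_def)
    show "Ck_on k {0<..} (\<lambda>x. inverse (sqrt x) / 2 * b)" for b
      by (intro Ck_on_bilinear[OF opn(1) bounded_bilinear_mult] Ck_on_const opn
          Ck_on_bounded_linear[OF opn(1) bounded_linear_divide]
          Ck_on_compose[OF opn(1) opn(2) _ Suc Ck_on_inverse_real]) auto
  qed
qed

section \<open>Smoothness by iterated derivatives within a set, compared with
  \<open>Ck_on\<close>\<close>

lemma iter_deriv_cong:
  "(\<And>x. x \<in> S \<Longrightarrow> f x = g x) \<Longrightarrow> x \<in> S \<Longrightarrow> iter_deriv S bs f x = iter_deriv S bs g x"
proof (induction bs arbitrary: f g x)
  case (Cons b bs)
  have "(f has_derivative D) (at x within S) \<longleftrightarrow> (g has_derivative D) (at x within S)" if "x \<in> S" for D x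
    using Cons.prems(1) that by (metis has_derivative_transform)
  then have "frechet_derivative f (at x within S) = frechet_derivative g (at x within S)" if "x \<in> S" for x
    using that by (simp add: frechet_derivative_def)
  then show ?case
    using Cons.prems by (auto intro!: Cons.IH)
qed auto

lemma differentiable_on_cong:
  assumes "\<And>x. x \<in> S \<Longrightarrow> f x = g x"
  shows "f differentiable_on S \<longleftrightarrow> g differentiable_on S"
proof -
  have "(\<exists>D. (f has_derivative D) (at x within S)) \<longleftrightarrow> (\<exists>D. (g has_derivative D) (at x within S))"
    if "x \<in> S" for x
    using has_derivative_transform[OF that, of f g] has_derivative_transform[OF that, of g f] assms by metis
  then show ?thesis
    unfolding differentiable_on_def differentiable_def by auto
qed

text \<open>On an open set derivatives within \<open>S\<close> are full derivatives. The passage to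
  an order \<open>k\<close> matters because a fixed list of directions does not reproduce itself
  under the product and chain rules, whereas the order does.\<close>

lemma smooth_on_iff_Ck_on:
  assumes "open S"
  shows "smooth_on S f \<longleftrightarrow> (\<forall>k. Ck_on k S f)"
proof -
  have "Ck_on k S f \<longleftrightarrow> (\<forall>bs. set bs \<subseteq> Basis \<and> length bs \<le> k \<longrightarrow> iter_deriv S bs f differentiable_on S)" for k
  proof (induction k arbitrary: f)
    case 0
    then show ?case
      using assms by (auto simp: differentiable_on_eq_differentiable_at)
  next
    case (Suc k)
    have *: "iter_deriv S bs (\<lambda>x. frechet_derivative f (at x) b) differentiable_on S \<longleftrightarrow>
       iter_deriv S bs (\<lambda>x. frechet_derivative f (at x within S) b) differentiable_on S" for b bs
    proof (rule differentiable_on_cong)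
      fix x assume "x \<in> S"
      then show "iter_deriv S bs (\<lambda>x. frechet_derivative f (at x) b) x =
        iter_deriv S bs (\<lambda>x. frechet_derivative f (at x within S) b) x"
        by (rule iter_deriv_cong[rotated]) (simp add: at_within_open[OF _ assms])
    qed
    have "(\<forall>bs. set bs \<subseteq> Basis \<and> length bs \<le> Suc k \<longrightarrow> iter_deriv S bs f differentiable_on S) \<longleftrightarrow>
      f differentiable_on S \<and>
      (\<forall>b\<in>Basis. \<forall>bs. set bs \<subseteq> Basis \<and> length bs \<le> k \<longrightarrow> iter_deriv S (b # bs) f differentiable_on S)"
      (is "?L \<longleftrightarrow> ?R")
    proof
      assume L: ?L
      show ?R
      proof (intro conjI ballI allI impI)
        show "f differentiable_on S" using L[rule_format, of "[]"] by simp
        show "iter_deriv S (b # bs) f differentiable_on S"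
          if "b \<in> Basis" "set bs \<subseteq> Basis \<and> length bs \<le> k" for b bs
          using L[rule_format, of "b # bs"] that by simp
      qed
    next
      assume R: ?R
      show ?L
      proof (intro allI impI)
        fix bs :: "'a list" assume "set bs \<subseteq> Basis \<and> length bs \<le> Suc k"
        then show "iter_deriv S bs f differentiable_on S"
          using R by (cases bs) auto
      qed
    qed
    also have "\<dots> \<longleftrightarrow> Ck_on (Suc k) S f"
      by (simp add: Suc.IH * assms differentiable_on_eq_differentiable_at)
    finally show ?case ..
  qed
  then show ?thesis
    unfolding smooth_on_def by auto
qed

lemma smooth_on_imp_differentiable:
  "open S \<Longrightarrow> smooth_on S f \<Longrightarrow> x \<in> S \<Longrightarrow> f differentiable (at x)"
  using smooth_on_iff_Ck_on Ck_on_imp_differentiable by blast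

lemma smooth_on_imp_continuous_on:
  assumes "open S" "smooth_on S f" shows "continuous_on S f"
  using smooth_on_imp_differentiable[OF assms] assms(1)
  by (simp add: continuous_on_eq_continuous_at differentiable_imp_continuous_within)

lemma smooth_on_local:
  assumes "open S" "\<And>x. x \<in> S \<Longrightarrow> \<exists>U. open U \<and> x \<in> U \<and> smooth_on U f"
  shows "smooth_on S f"
  unfolding smooth_on_iff_Ck_on[OF assms(1)]
proof (intro allI Ck_on_local)
  fix k x assume "x \<in> S"
  then obtain U where "open U" "x \<in> U" "smooth_on U f" using assms(2) by blast
  then show "\<exists>U. x \<in> U \<and> Ck_on k U f" using smooth_on_iff_Ck_on by blast
qed

lemma smooth_on_cong:
  assumes "open S" "smooth_on S f" "\<And>x. x \<in> S \<Longrightarrow> f x = g x"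
  shows "smooth_on S g"
  unfolding smooth_on_iff_Ck_on[OF assms(1)]
proof
  show "Ck_on k S g" for k
    using assms(2,3) smooth_on_iff_Ck_on[OF assms(1)] by (auto intro: Ck_on_cong[OF assms(1), of k f])
qed

lemma smooth_on_const: "open S \<Longrightarrow> smooth_on S (\<lambda>x. c)"
  by (simp add: smooth_on_iff_Ck_on Ck_on_const)

lemma smooth_on_ident: "open S \<Longrightarrow> smooth_on S (\<lambda>x. x)"
  by (simp add: smooth_on_iff_Ck_on Ck_on_ident)

lemma smooth_on_bounded_linear:
  "open S \<Longrightarrow> bounded_linear L \<Longrightarrow> smooth_on S f \<Longrightarrow> smooth_on S (\<lambda>x. L (f x))"
  by (simp add: smooth_on_iff_Ck_on Ck_on_bounded_linear)

lemma smooth_on_add: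
  "open S \<Longrightarrow> smooth_on S f \<Longrightarrow> smooth_on S g \<Longrightarrow> smooth_on S (\<lambda>x. f x + g x)"
  by (simp add: smooth_on_iff_Ck_on Ck_on_add)

lemma smooth_on_sum:
  "open S \<Longrightarrow> (\<And>i. i \<in> A \<Longrightarrow> smooth_on S (f i)) \<Longrightarrow> smooth_on S (\<lambda>x. \<Sum>i\<in>A. f i x)"
  by (simp add: smooth_on_iff_Ck_on Ck_on_sum)

lemma smooth_on_bilinear:
  "open S \<Longrightarrow> bounded_bilinear P \<Longrightarrow> smooth_on S f \<Longrightarrow> smooth_on S g \<Longrightarrow>
   smooth_on S (\<lambda>x. P (f x) (g x))"
  by (simp add: smooth_on_iff_Ck_on Ck_on_bilinear)

lemma smooth_on_scaleR:
  "open S \<Longrightarrow> smooth_on S f \<Longrightarrow> smooth_on S g \<Longrightarrow> smooth_on S (\<lambda>x. f x *\<^sub>R g x)"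
  by (rule smooth_on_bilinear[OF _ bounded_bilinear_scaleR])

lemma smooth_on_mult:
  fixes f g :: "'a::euclidean_space \<Rightarrow> real"
  shows "open S \<Longrightarrow> smooth_on S f \<Longrightarrow> smooth_on S g \<Longrightarrow> smooth_on S (\<lambda>x. f x * g x)"
  by (rule smooth_on_bilinear[OF _ bounded_bilinear_mult])

lemma smooth_on_prod:
  fixes f :: "'i \<Rightarrow> 'a::euclidean_space \<Rightarrow> real"
  assumes "open S" "\<And>i. i \<in> A \<Longrightarrow> smooth_on S (f i)"
  shows "smooth_on S (\<lambda>x. \<Prod>i\<in>A. f i x)"
  using assms(2)
  by (induction A rule: infinite_finite_induct) (auto intro: smooth_on_const smooth_on_mult assms(1))

lemma smooth_on_minus: "open S \<Longrightarrow> smooth_on S f \<Longrightarrow> smooth_on S (\<lambda>x. - f x)"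
  by (rule smooth_on_bounded_linear[OF _ bounded_linear_minus[OF bounded_linear_ident]])

lemma smooth_on_diff:
  "open S \<Longrightarrow> smooth_on S f \<Longrightarrow> smooth_on S g \<Longrightarrow> smooth_on S (\<lambda>x. f x - g x)"
  using smooth_on_add[OF _ _ smooth_on_minus, of S f g] by simp

lemma smooth_on_compose:
  "open S \<Longrightarrow> open U \<Longrightarrow> (\<And>x. x \<in> S \<Longrightarrow> h x \<in> U) \<Longrightarrow> smooth_on S h \<Longrightarrow> smooth_on U f \<Longrightarrow>
   smooth_on S (\<lambda>x. f (h x))"
  by (simp add: smooth_on_iff_Ck_on Ck_on_compose)

lemma smooth_on_inverse:
  fixes f :: "'a::euclidean_space \<Rightarrow> real"
  assumes "open S" "smooth_on S f" "\<And>x. x \<in> S \<Longrightarrow> f x \<noteq> 0"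
  shows "smooth_on S (\<lambda>x. inverse (f x))"
  by (rule smooth_on_compose[OF assms(1) _ _ assms(2), where U = "- {0}"])
    (use assms(3) in \<open>auto simp: smooth_on_iff_Ck_on[OF open_Compl[OF closed_singleton]] Ck_on_inverse_real\<close>)

lemma smooth_on_divide:
  fixes f g :: "'a::euclidean_space \<Rightarrow> real"
  assumes "open S" "smooth_on S f" "smooth_on S g" "\<And>x. x \<in> S \<Longrightarrow> g x \<noteq> 0"
  shows "smooth_on S (\<lambda>x. f x / g x)"
  unfolding divide_inverse by (intro smooth_on_mult smooth_on_inverse assms)

lemma smooth_on_sqrt:
  fixes f :: "'a::euclidean_space \<Rightarrow> real"
  assumes "open S" "smooth_on S f" "\<And>x. x \<in> S \<Longrightarrow> f x > 0"
  shows "smooth_on S (\<lambda>x. sqrt (f x))"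
  by (rule smooth_on_compose[OF assms(1) _ _ assms(2), where U = "{0<..}"])
    (use assms(3) in \<open>auto simp: smooth_on_iff_Ck_on Ck_on_sqrt_real\<close>)

lemma smooth_on_frechet_derivative_Basis:
  "open S \<Longrightarrow> smooth_on S f \<Longrightarrow> b \<in> Basis \<Longrightarrow> smooth_on S (\<lambda>x. frechet_derivative f (at x) b)"
  by (metis Ck_on.simps(2) smooth_on_iff_Ck_on)

lemma smooth_on_pd: "open S \<Longrightarrow> smooth_on S f \<Longrightarrow> smooth_on S (pd i f)"
  unfolding pd_def by (intro smooth_on_frechet_derivative_Basis) (auto simp: Basis_vec_def)

lemma smooth_on_vec_nth: "open S \<Longrightarrow> smooth_on S f \<Longrightarrow> smooth_on S (\<lambda>x. f x $ i)"
  by (rule smooth_on_bounded_linear[OF _ bounded_linear_vec_nth])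

lemma vec_eq_sum_scaleR_axis: "(v::real^'n) = (\<Sum>i\<in>UNIV. (v $ i) *\<^sub>R axis i 1)"
  by (simp add: vec_eq_iff axis_def if_distrib if_distribR cong: if_cong)

lemma smooth_on_vec_lambda:
  fixes f :: "'a::euclidean_space \<Rightarrow> 'n::finite \<Rightarrow> real"
  assumes "open S" "\<And>i. smooth_on S (\<lambda>x. f x i)"
  shows "smooth_on S (\<lambda>x. \<chi> i. f x i)"
proof (rule smooth_on_cong[OF assms(1)])
  show "smooth_on S (\<lambda>x. \<Sum>i\<in>UNIV. f x i *\<^sub>R (axis i 1::real^'n))"
    by (intro smooth_on_sum smooth_on_scaleR smooth_on_const assms)
  show "(\<Sum>i\<in>UNIV. f x i *\<^sub>R (axis i 1::real^'n)) = (\<chi> i. f x i)" for x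
    using vec_eq_sum_scaleR_axis[of "\<chi> i. f x i"] by simp
qed

section \<open>Symmetry of second derivatives\<close>

lemma has_field_derivative_along:
  fixes F :: "'a::euclidean_space \<Rightarrow> real"
  assumes F: "F differentiable (at (y + s *\<^sub>R c))"
  shows "((\<lambda>s. F (y + s *\<^sub>R c)) has_field_derivative frechet_derivative F (at (y + s *\<^sub>R c)) c) (at s)"
proof -
  have "((\<lambda>s. y + s *\<^sub>R c) has_derivative (\<lambda>h. h *\<^sub>R c)) (at s)"
    by (auto intro!: derivative_eq_intros)
  note has_derivative_compose[OF this has_derivative_frechet[OF F]]
  moreover have "(\<lambda>h. frechet_derivative F (at (y + s *\<^sub>R c)) (h *\<^sub>R c)) = (*) (frechet_derivative F (at (y + s *\<^sub>R c)) c)"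
    by (rule ext) (simp only: linear_scale[OF linear_frechet_derivative[OF F]] real_scaleR_def mult.commute)
  ultimately show ?thesis
    by (simp only: has_field_derivative_def)
qed

text \<open>The mean value theorem is used twice on the square with sides
  \<open>h *\<^sub>R a\<close> and \<open>h *\<^sub>R b\<close>: along \<open>a\<close> for the
  difference of \<open>f\<close> between two opposite sides, then along \<open>b\<close> for the
  derivative in direction \<open>a\<close>.\<close>

lemma second_difference_mean_value:
  fixes f :: "'a::euclidean_space \<Rightarrow> real"
  assumes S: "\<And>s t. 0 \<le> s \<Longrightarrow> s \<le> h \<Longrightarrow> 0 \<le> t \<Longrightarrow> t \<le> h \<Longrightarrow> x + s *\<^sub>R a + t *\<^sub>R b \<in> S"
    and f: "\<And>y. y \<in> S \<Longrightarrow> f differentiable (at y)"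
    and g: "\<And>y. y \<in> S \<Longrightarrow> (\<lambda>z. frechet_derivative f (at z) a) differentiable (at y)"
    and h: "0 < h"
  shows "\<exists>s t. 0 < s \<and> s < h \<and> 0 < t \<and> t < h \<and>
     f (x + h *\<^sub>R a + h *\<^sub>R b) - f (x + h *\<^sub>R a) - f (x + h *\<^sub>R b) + f x =
     h * h * frechet_derivative (\<lambda>z. frechet_derivative f (at z) a) (at (x + s *\<^sub>R a + t *\<^sub>R b)) b"
proof -
  define p where "p s = f ((x + h *\<^sub>R b) + s *\<^sub>R a) - f (x + s *\<^sub>R a)" for s
  define p' where "p' s = frechet_derivative f (at ((x + h *\<^sub>R b) + s *\<^sub>R a)) a - frechet_derivative f (at (x + s *\<^sub>R a)) a" for s
  have mem: "x + s *\<^sub>R a \<in> S" "(x + h *\<^sub>R b) + s *\<^sub>R a \<in> S" if "0 \<le> s" "s \<le> h" for s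
    using S[of s 0] S[of s h] that h by (auto simp: algebra_simps)
  have "\<exists>s>0. s < h \<and> p h - p 0 = (h - 0) * p' s"
    by (rule MVT2[OF h]) (auto simp: p_def[abs_def] p'_def intro!: DERIV_diff has_field_derivative_along f mem)
  then obtain s where s: "0 < s" "s < h" "p h - p 0 = h * p' s" by auto
  define q where "q t = frechet_derivative f (at ((x + s *\<^sub>R a) + t *\<^sub>R b)) a" for t
  have "\<exists>t>0. t < h \<and> q h - q 0 = (h - 0) * frechet_derivative (\<lambda>z. frechet_derivative f (at z) a) (at ((x + s *\<^sub>R a) + t *\<^sub>R b)) b"
    unfolding q_def
    by (rule MVT2[OF h, of "\<lambda>t. frechet_derivative f (at ((x + s *\<^sub>R a) + t *\<^sub>R b)) a"])
      (use S s in \<open>auto intro!: has_field_derivative_along g\<close>)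
  then obtain t where t: "0 < t" "t < h"
    "q h - q 0 = h * frechet_derivative (\<lambda>z. frechet_derivative f (at z) a) (at ((x + s *\<^sub>R a) + t *\<^sub>R b)) b" by auto
  have "p' s = q h - q 0" by (simp add: p'_def q_def algebra_simps)
  with s t have "p h - p 0 = h * h * frechet_derivative (\<lambda>z. frechet_derivative f (at z) a) (at ((x + s *\<^sub>R a) + t *\<^sub>R b)) b"
    by simp
  then have "f (x + h *\<^sub>R a + h *\<^sub>R b) - f (x + h *\<^sub>R a) - f (x + h *\<^sub>R b) + f x =
     h * h * frechet_derivative (\<lambda>z. frechet_derivative f (at z) a) (at (x + s *\<^sub>R a + t *\<^sub>R b)) b"
    by (simp add: p_def algebra_simps)
  with s t show ?thesis by blast
qed

text \<open>The second difference is symmetric in \<open>a\<close> and \<open>b\<close>. Divided by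
  \<open>h * h\<close> it is a value of either mixed derivative somewhere in the square, and by
  continuity both values approach those at \<open>x\<close> as the square shrinks.\<close>

lemma frechet_derivative_commute:
  fixes f :: "'a::euclidean_space \<Rightarrow> real"
  assumes S: "open S" and x: "x \<in> S" and f: "smooth_on S f" and ab: "a \<in> Basis" "b \<in> Basis"
  shows "frechet_derivative (\<lambda>z. frechet_derivative f (at z) a) (at x) b =
         frechet_derivative (\<lambda>z. frechet_derivative f (at z) b) (at x) a"
proof -
  define D where "D a b = (\<lambda>y. frechet_derivative (\<lambda>z. frechet_derivative f (at z) a) (at y) b)" for a b
  have D: "continuous (at x) (D a b)" if "a \<in> Basis" "b \<in> Basis" for a b
    using smooth_on_imp_continuous_on[OF S smooth_on_frechet_derivative_Basis[OF S
        smooth_on_frechet_derivative_Basis[OF S f that(1)] that(2)]] x S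
    by (simp add: D_def continuous_on_eq_continuous_at)
  have n: "norm a = 1" "norm b = 1" using ab by auto
  have "\<bar>D a b x - D b a x\<bar> \<le> e" if e: "e > 0" for e :: real
  proof -
    obtain r where r: "r > 0" "ball x r \<subseteq> S" using S x open_contains_ball by blast
    obtain d1 where d1: "d1 > 0" "\<And>y. dist y x < d1 \<Longrightarrow> dist (D a b y) (D a b x) < e / 2"
      using D[OF ab] e unfolding continuous_at_eps_delta by (meson half_gt_zero)
    obtain d2 where d2: "d2 > 0" "\<And>y. dist y x < d2 \<Longrightarrow> dist (D b a y) (D b a x) < e / 2"
      using D[OF ab(2,1)] e unfolding continuous_at_eps_delta by (meson half_gt_zero)
    \<comment> \<open>Points of the square are within \<open>2 * h\<close> of \<open>x\<close>; a
      third of the smallest radius keeps them strictly inside all three balls.\<close>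
    define h where "h = Min {r, d1, d2} / 3"
    have h: "h > 0" "2 * h < r" "2 * h < d1" "2 * h < d2"
      using r d1 d2 by (auto simp: h_def)
    have near: "dist (x + s *\<^sub>R u + t *\<^sub>R v) x \<le> 2 * h"
      if "0 \<le> s" "s \<le> h" "0 \<le> t" "t \<le> h" "norm u = 1" "norm v = 1" for s t u v
      using that norm_triangle_ineq[of "s *\<^sub>R u" "t *\<^sub>R v"] by (simp add: dist_norm add.assoc)
    have in_S: "x + s *\<^sub>R u + t *\<^sub>R v \<in> S"
      if "0 \<le> s" "s \<le> h" "0 \<le> t" "t \<le> h" "norm u = 1" "norm v = 1" for s t u v
      using near[OF that] h r(2) by (force simp: dist_commute)
    have diff: "f differentiable at y" if "y \<in> S" for y
      using smooth_on_imp_differentiable[OF S f that] .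
    have diff': "(\<lambda>z. frechet_derivative f (at z) c) differentiable at y" if "y \<in> S" "c \<in> Basis" for y c
      using smooth_on_imp_differentiable[OF S smooth_on_frechet_derivative_Basis[OF S f that(2)] that(1)] .
    obtain s t where st: "0 < s" "s < h" "0 < t" "t < h"
      "f (x + h *\<^sub>R a + h *\<^sub>R b) - f (x + h *\<^sub>R a) - f (x + h *\<^sub>R b) + f x = h * h * D a b (x + s *\<^sub>R a + t *\<^sub>R b)"
      using second_difference_mean_value[of h x a b S f, OF in_S[OF _ _ _ _ n] diff diff'[OF _ ab(1)] h(1)]
      unfolding D_def by blast
    obtain s' t' where st': "0 < s'" "s' < h" "0 < t'" "t' < h"
      "f (x + h *\<^sub>R b + h *\<^sub>R a) - f (x + h *\<^sub>R b) - f (x + h *\<^sub>R a) + f x = h * h * D b a (x + s' *\<^sub>R b + t' *\<^sub>R a)"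
      using second_difference_mean_value[of h x b a S f, OF in_S[OF _ _ _ _ n(2,1)] diff diff'[OF _ ab(2)] h(1)]
      unfolding D_def by blast
    have "h * h * D a b (x + s *\<^sub>R a + t *\<^sub>R b) = h * h * D b a (x + s' *\<^sub>R b + t' *\<^sub>R a)"
      using st(5) st'(5) by (simp add: algebra_simps)
    then have "D a b (x + s *\<^sub>R a + t *\<^sub>R b) = D b a (x + s' *\<^sub>R b + t' *\<^sub>R a)"
      using h(1) by simp
    moreover have "dist (D a b (x + s *\<^sub>R a + t *\<^sub>R b)) (D a b x) < e / 2"
      using near[of s t a b] st n h by (intro d1) auto
    moreover have "dist (D b a (x + s' *\<^sub>R b + t' *\<^sub>R a)) (D b a x) < e / 2"
      using near[of s' t' b a] st' n h by (intro d2) auto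
    ultimately show ?thesis unfolding dist_real_def by linarith
  qed
  then have "\<bar>D a b x - D b a x\<bar> \<le> 0" by (metis dense_ge)
  then show ?thesis by (simp add: D_def)
qed

lemma pd_commute:
  assumes "open S" "x \<in> S" "smooth_on S f"
  shows "pd i (pd j f) x = pd j (pd i f) x"
  unfolding pd_def by (rule frechet_derivative_commute[OF assms]) (auto simp: Basis_vec_def)

section \<open>Bump functions\<close>

text \<open>Index 0 is the classical flat function \<open>exp (- 1 / t)\<close>. The powers of
  \<open>1 / t\<close> are included because the family is then closed under differentiation, up to
  linear combinations.\<close>

definition flat_exp :: "nat \<Rightarrow> real \<Rightarrow> real" where
  "flat_exp n t = (if t > 0 then inverse t ^ n * exp (- inverse t) else 0)"

text \<open>Keeping only the term of degree \<open>n + 2\<close> of the series of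
  \<open>exp (1 / t)\<close> bounds it from below. The two surplus powers leave
  \<open>t\<^sup>2\<close>, which makes the difference quotient at 0 tend to 0.\<close>

lemma flat_exp_le:
  assumes "t > 0" shows "flat_exp n t \<le> fact (n + 2) * t\<^sup>2"
proof -
  define c :: real where "c = fact (n + 2)"
  have c: "c > 0" by (simp add: c_def del: fact_Suc)
  have "inverse t ^ (n + 2) / c \<le> exp (inverse t)"
  proof -
    have "(\<Sum>k\<in>{n + 2}. inverse t ^ k /\<^sub>R fact k) \<le> (\<Sum>k. inverse t ^ k /\<^sub>R fact k)"
      using assms by (intro sum_le_suminf summable_exp_generic) auto
    also have "\<dots> = exp (inverse t)" by (simp add: exp_def)
    finally show ?thesis by (simp add: c_def divide_inverse_commute del: fact_Suc power_Suc)
  qed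
  then have "inverse t ^ (n + 2) \<le> c * exp (inverse t)"
    using c by (simp add: pos_divide_le_eq mult.commute)
  then have "inverse t ^ (n + 2) * exp (- inverse t) \<le> c"
    by (simp add: exp_minus pos_divide_le_eq flip: divide_inverse)
  then have "inverse t ^ (n + 2) * exp (- inverse t) * t\<^sup>2 \<le> c * t\<^sup>2"
    by (intro mult_right_mono) auto
  moreover have "inverse t ^ (n + 2) * exp (- inverse t) * t\<^sup>2 = flat_exp n t"
    using assms by (simp add: flat_exp_def field_simps power_add power2_eq_square)
  ultimately show ?thesis by (simp add: c_def del: fact_Suc)
qed

lemma flat_exp_has_derivative:
  "(flat_exp n has_real_derivative flat_exp (n + 2) t - n * flat_exp (n + 1) t) (at t)"
proof -
  consider "t > 0" | "t < 0" | "t = 0" by linarith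
  then show ?thesis
  proof cases
    case 1
    have d: "(inverse has_real_derivative - (inverse t * inverse t)) (at t)"
      using DERIV_inverse[of t] 1 by (simp add: numeral_2_eq_2)
    have "real n * (- (inverse t * inverse t) * inverse t ^ (n - Suc 0)) = - (real n * inverse t ^ (n + 1))"
      by (cases n) auto
    with DERIV_power[OF d, of n]
    have "((\<lambda>t. inverse t ^ n) has_real_derivative - (real n * inverse t ^ (n + 1))) (at t)"
      by metis
    from DERIV_mult[OF this DERIV_fun_exp[OF DERIV_minus[OF d]]]
    have "((\<lambda>t. inverse t ^ n * exp (- inverse t)) has_real_derivative flat_exp (n + 2) t - n * flat_exp (n + 1) t) (at t)"
      using 1 by (simp add: flat_exp_def algebra_simps)
    then show ?thesis
      by (rule has_field_derivative_transform_within_open[where S = "{0<..}"]) (use 1 in \<open>auto simp: flat_exp_def\<close>)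
  next
    case 2
    have "((\<lambda>t. 0) has_real_derivative flat_exp (n + 2) t - n * flat_exp (n + 1) t) (at t)"
      using 2 by (auto simp: flat_exp_def)
    then show ?thesis
      by (rule has_field_derivative_transform_within_open[where S = "{..<0}"]) (use 2 in \<open>auto simp: flat_exp_def\<close>)
  next
    case 3
    have bd: "\<bar>flat_exp n y\<bar> \<le> fact (n + 2) * y\<^sup>2" for y
      using flat_exp_le[of y n] by (cases "y > 0") (auto simp: flat_exp_def)
    have "((\<lambda>y. flat_exp n y / y) \<longlongrightarrow> 0) (at 0)"
    proof (rule Lim_null_comparison)
      show "\<forall>\<^sub>F y in at 0. norm (flat_exp n y / y) \<le> fact (n + 2) * \<bar>y\<bar>"
        unfolding eventually_at
      proof (intro exI[of _ 1] conjI ballI impI)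
        fix y :: real assume "y \<noteq> 0 \<and> dist y 0 < 1"
        then have "y \<noteq> 0" by simp
        moreover have "y\<^sup>2 = \<bar>y\<bar> * \<bar>y\<bar>" by (simp add: power2_eq_square flip: abs_mult)
        ultimately show "norm (flat_exp n y / y) \<le> fact (n + 2) * \<bar>y\<bar>"
          using bd[of y] by (simp add: pos_divide_le_eq mult.assoc del: fact_Suc)
      qed simp
      show "((\<lambda>y. fact (n + 2) * \<bar>y\<bar>) \<longlongrightarrow> 0) (at (0::real))"
        by (auto intro!: tendsto_eq_intros)
    qed
    then show ?thesis
      using 3 by (simp add: has_field_derivative_iff flat_exp_def)
  qed
qed

lemma Ck_on_flat_exp: "Ck_on k UNIV (flat_exp n)"
proof (induction k arbitrary: n)
  case 0
  show ?case
    using flat_exp_has_derivative has_field_derivative_imp_has_derivative unfolding differentiable_def Ck_on.simps by blast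
next
  case (Suc k)
  show ?case
  proof (rule Ck_on_SucI)
    show "(flat_exp n has_derivative (*) (flat_exp (n + 2) x + - real n * flat_exp (n + 1) x)) (at x)" for x
      using flat_exp_has_derivative[of n x] by (simp add: has_field_derivative_def)
    show "Ck_on k UNIV (\<lambda>x. (flat_exp (n + 2) x + - real n * flat_exp (n + 1) x) * b)" for b
      by (intro Ck_on_bilinear[OF _ bounded_bilinear_mult] Ck_on_add Ck_on_const Suc) auto
  qed auto
qed

text \<open>The flat function is composed with \<open>r\<^sup>2 - |x - a|\<^sup>2\<close>, a
  polynomial that is positive exactly on the ball; the norm itself is not differentiable at the
  centre.\<close>

lemma exists_smooth_bump:
  fixes a :: "'a::euclidean_space"
  assumes "r > 0"
  obtains f :: "'a \<Rightarrow> real" where "smooth_on UNIV f" "\<And>x. 0 \<le> f x" "\<And>x. f x \<noteq> 0 \<longleftrightarrow> x \<in> ball a r"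
proof
  let ?f = "\<lambda>x. flat_exp 0 (r * r + (-1) * ((x - a) \<bullet> (x - a)))"
  have f: "smooth_on UNIV (flat_exp 0)" by (simp add: smooth_on_iff_Ck_on Ck_on_flat_exp)
  have h: "smooth_on UNIV (\<lambda>x. r * r + (-1) * ((x - a) \<bullet> (x - a)))"
    by (intro smooth_on_add smooth_on_mult smooth_on_const smooth_on_diff
        smooth_on_bilinear[OF _ bounded_bilinear_inner] smooth_on_ident open_UNIV)
  show "smooth_on UNIV ?f"
    by (rule smooth_on_compose[OF open_UNIV open_UNIV UNIV_I h f])
  show "0 \<le> ?f x" for x by (simp add: flat_exp_def)
  show "?f x \<noteq> 0 \<longleftrightarrow> x \<in> ball a r" for x
    using power_strict_mono[of "norm (x - a)" r 2] power_mono[of r "norm (x - a)" 2] assms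
    by (cases "norm (x - a) < r")
      (auto simp: flat_exp_def dot_square_norm dist_norm norm_minus_commute power2_eq_square)
qed

section \<open>Tensor calculus in a chart\<close>

lemma pd_eqI: "(f has_derivative D) (at x) \<Longrightarrow> pd i f x = D (axis i 1)"
  unfolding pd_def using frechet_derivative_at by metis

lemma pd_cong:
  assumes "open V" "x \<in> V" "f differentiable (at x)" "\<And>y. y \<in> V \<Longrightarrow> f y = g y"
  shows "pd i f x = pd i g x"
  unfolding pd_def using frechet_derivative_transform_within_open[OF assms(3,1,2,4)] by simp

lemma pd_const: "pd i (\<lambda>y. c) x = 0"
  by (rule pd_eqI) simp

lemma pd_add:
  assumes "f differentiable (at x)" "g differentiable (at x)"
  shows "pd i (\<lambda>y. f y + g y) x = pd i f x + pd i g x"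
  using pd_eqI[OF has_derivative_add[OF assms[THEN has_derivative_frechet]]] by (simp add: pd_def)

lemma pd_mult:
  assumes "f differentiable (at x)" "g differentiable (at x)"
  shows "pd i (\<lambda>y. f y * g y) x = pd i f x * g x + f x * pd i g x"
  using pd_eqI[OF has_derivative_mult[OF assms[THEN has_derivative_frechet]]] by (simp add: pd_def)

lemma pd_sum:
  assumes "\<And>a. a \<in> A \<Longrightarrow> f a differentiable (at x)"
  shows "pd i (\<lambda>y. \<Sum>a\<in>A. f a y) x = (\<Sum>a\<in>A. pd i (f a) x)"
  using pd_eqI[OF has_derivative_sum[OF has_derivative_frechet[OF assms]]] by (simp add: pd_def)

lemma pd_sqrt:
  assumes "f differentiable (at x)" "f x > 0"
  shows "pd i (\<lambda>y. sqrt (f y)) x = pd i f x / (2 * sqrt (f x))"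
proof -
  have "(sqrt has_derivative (*) (inverse (sqrt (f x)) / 2)) (at (f x))"
    using DERIV_real_sqrt[OF assms(2)] by (simp add: has_field_derivative_def)
  from pd_eqI[OF has_derivative_compose[OF has_derivative_frechet[OF assms(1)] this]]
  show ?thesis unfolding pd_def by (simp only: divide_inverse) (simp add: field_simps)
qed

text \<open>Jacobi's formula. Differentiating the Leibniz sum gives one determinant for each row,
  with that row differentiated. The left inverse \<open>N\<close> writes the new row as a
  combination of the rows of \<open>M x\<close>, and Cramer's lemma reads off the coefficient of the
  row that was replaced.\<close>

lemma pd_det:
  fixes M :: "real ^ 'n::finite \<Rightarrow> real ^ 'n ^ 'n"
  assumes M: "\<And>i j. (\<lambda>y. M y $ i $ j) differentiable (at x)" and N: "N ** M x = mat 1"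
  shows "(\<lambda>y. det (M y)) differentiable (at x)"
    and "pd k (\<lambda>y. det (M y)) x = det (M x) * (\<Sum>i\<in>UNIV. \<Sum>j\<in>UNIV. pd k (\<lambda>y. M y $ i $ j) x * N $ j $ i)"
proof -
  define P where "P = {p. p permutes (UNIV :: 'n set)}"
  have hd: "((\<lambda>y. det (M y)) has_derivative
     (\<lambda>v. \<Sum>p\<in>P. of_int (sign p) * (\<Sum>i\<in>UNIV. frechet_derivative (\<lambda>y. M y $ i $ p i) (at x) v * (\<Prod>j\<in>UNIV - {i}. M x $ j $ p j)))) (at x)"
    unfolding det_def P_def
    by (intro has_derivative_sum has_derivative_mult_right has_derivative_prod has_derivative_frechet M)
  then show "(\<lambda>y. det (M y)) differentiable (at x)"
    by (auto simp: differentiable_def)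
  define d where "d i j = pd k (\<lambda>y. M y $ i $ j) x" for i j
  have row: "det (\<chi> r. if r = i then (\<Sum>s\<in>UNIV. (\<Sum>c\<in>UNIV. d i c * N $ c $ s) *s row s (M x)) else row r (M x))
     = (\<Sum>c\<in>UNIV. d i c * N $ c $ i) * det (M x)" for i
    using cramer_lemma_transpose[of i "\<chi> s. \<Sum>c\<in>UNIV. d i c * N $ c $ s" "M x"] by (simp cong: if_cong)
  have NM: "(\<Sum>s\<in>UNIV. N $ c $ s * M x $ s $ j) = (if c = j then 1 else 0)" for c j
    using arg_cong[OF N, of "\<lambda>A. A $ c $ j"] by (simp add: matrix_matrix_mult_def mat_def)
  have vec: "(\<Sum>s\<in>UNIV. (\<Sum>c\<in>UNIV. d i c * N $ c $ s) *s row s (M x)) = (\<chi> j. d i j)" for i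
  proof (rule vec_eq_iff[THEN iffD2], rule allI)
    fix j
    have "(\<Sum>s\<in>UNIV. (\<Sum>c\<in>UNIV. d i c * N $ c $ s) *s row s (M x)) $ j
      = (\<Sum>s\<in>UNIV. \<Sum>c\<in>UNIV. d i c * (N $ c $ s * M x $ s $ j))"
      by (simp add: sum_distrib_right row_def mult.assoc)
    also have "\<dots> = (\<Sum>c\<in>UNIV. d i c * (\<Sum>s\<in>UNIV. N $ c $ s * M x $ s $ j))"
      by (subst sum.swap) (simp add: sum_distrib_left)
    also have "\<dots> = d i j" by (simp add: NM if_distrib cong: if_cong)
    finally show "(\<Sum>s\<in>UNIV. (\<Sum>c\<in>UNIV. d i c * N $ c $ s) *s row s (M x)) $ j = (\<chi> j. d i j) $ j" by simp
  qed
  have "pd k (\<lambda>y. det (M y)) x =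
     (\<Sum>p\<in>P. of_int (sign p) * (\<Sum>i\<in>UNIV. d i (p i) * (\<Prod>j\<in>UNIV - {i}. M x $ j $ p j)))"
    using pd_eqI[OF hd] by (simp add: d_def pd_def)
  also have "\<dots> = (\<Sum>i\<in>UNIV. \<Sum>p\<in>P. of_int (sign p) * (d i (p i) * (\<Prod>j\<in>UNIV - {i}. M x $ j $ p j)))"
    by (subst sum.swap) (simp add: sum_distrib_left)
  also have "\<dots> = (\<Sum>i\<in>UNIV. det (\<chi> r. if r = i then (\<chi> j. d i j) else row r (M x)))"
  proof (rule sum.cong[OF refl])
    fix i :: 'n
    have "(\<Prod>j\<in>UNIV. (\<chi> r. if r = i then (\<chi> j. d i j) else row r (M x)) $ j $ p j)
       = d i (p i) * (\<Prod>j\<in>UNIV - {i}. M x $ j $ p j)" for p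
      by (subst prod.remove[of _ i]) (auto simp: row_def intro!: prod.cong)
    then show "(\<Sum>p\<in>P. of_int (sign p) * (d i (p i) * (\<Prod>j\<in>UNIV - {i}. M x $ j $ p j)))
       = det (\<chi> r. if r = i then (\<chi> j. d i j) else row r (M x))"
      unfolding det_def P_def by simp
  qed
  also have "\<dots> = (\<Sum>i\<in>UNIV. (\<Sum>c\<in>UNIV. d i c * N $ c $ i) * det (M x))"
    by (intro sum.cong refl) (rule row[unfolded vec])
  finally show "pd k (\<lambda>y. det (M y)) x = det (M x) * (\<Sum>i\<in>UNIV. \<Sum>j\<in>UNIV. pd k (\<lambda>y. M y $ i $ j) x * N $ j $ i)"
    by (simp add: d_def sum_distrib_left sum_distrib_right mult.commute)
qed

lemma smooth_on_det:
  fixes M :: "'a::euclidean_space \<Rightarrow> real ^ 'n::finite ^ 'n"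
  assumes "open S" "\<And>i j. smooth_on S (\<lambda>x. M x $ i $ j)"
  shows "smooth_on S (\<lambda>x. det (M x))"
  unfolding det_def
  by (intro smooth_on_sum smooth_on_mult smooth_on_const smooth_on_prod assms)

text \<open>Every matrix on the segment from the identity to \<open>A\<close> is positive definite,
  hence injective, so the determinant has no zero on its way from 1 to \<open>det A\<close>.\<close>

lemma positive_definite_det_pos:
  fixes A :: "real ^ 'n::finite ^ 'n"
  assumes "\<And>v. v \<noteq> 0 \<Longrightarrow> v \<bullet> (A *v v) > 0"
  shows "det A > 0"
proof (rule ccontr)
  assume neg: "\<not> det A > 0"
  define f where "f t = det (\<chi> i j. (1 - t) * mat 1 $ i $ j + t * A $ i $ j)" for t :: real
  have "continuous_on {0..1} f"
    unfolding f_def det_def by (intro continuous_intros)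
  moreover have "f 0 = 1" "f 1 = det A" by (simp_all add: f_def vec_nth_inverse flip: mat_def)
  ultimately obtain t where t: "0 \<le> t" "t \<le> 1" "f t = 0"
    using IVT2'[of f 1 0 0] neg by auto
  define B where "B = (\<chi> i j. (1 - t) * mat 1 $ i $ j + t * A $ i $ j)"
  have "det B = 0" using t by (simp add: B_def f_def)
  then obtain v where v: "v \<noteq> 0" "B *v v = 0"
    using matrix_left_invertible_ker[of B] invertible_det_nz[of B] invertible_left_inverse[of B] by auto
  have "B = (1 - t) *\<^sub>R mat 1 + t *\<^sub>R A" by (simp add: B_def vec_eq_iff)
  then have "v \<bullet> (B *v v) = (1 - t) * (v \<bullet> v) + t * (v \<bullet> (A *v v))"
    by (simp add: matrix_vector_mult_add_rdistrib scaleR_matrix_vector_assoc[symmetric] inner_add_right)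
  also have "\<dots> > 0"
  proof (cases "t = 0")
    case True
    then show ?thesis using v by simp
  next
    case False
    then have "t * (v \<bullet> (A *v v)) > 0" using assms[OF v(1)] t by simp
    moreover have "(1 - t) * (v \<bullet> v) \<ge> 0" using t by simp
    ultimately show ?thesis by linarith
  qed
  finally show False using v by simp
qed

text \<open>Symmetric Gaussian elimination: subtracting the rank one form \<open>q q\<^sup>T\<close> with
  \<open>q = H e\<^sub>a / \<surd>H\<^sub>a\<^sub>a\<close> from \<open>H\<close> kills the index \<open>a\<close> and keeps the form nonnegative.\<close>

lemma sum_psd_mult_nonneg:
  fixes H K :: "'n::finite \<Rightarrow> 'n \<Rightarrow> real"
  assumes "\<And>i j. H i j = H j i" "\<And>v. 0 \<le> (\<Sum>i\<in>UNIV. \<Sum>j\<in>UNIV. H i j * v i * v j)"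
    and "\<And>v. 0 \<le> (\<Sum>i\<in>UNIV. \<Sum>j\<in>UNIV. K i j * v i * v j)"
  shows "0 \<le> (\<Sum>i\<in>UNIV. \<Sum>j\<in>UNIV. H i j * K i j)"
proof -
  \<comment> \<open>Induction over a finite set \<open>I\<close> of indices outside which the rows
    of \<open>H\<close> vanish; \<open>K\<close> stays fixed.\<close>
  have "0 \<le> (\<Sum>i\<in>UNIV. \<Sum>j\<in>UNIV. H i j * K i j)"
    if "finite I" "\<And>i j. H i j = H j i" "\<And>v. 0 \<le> (\<Sum>i\<in>UNIV. \<Sum>j\<in>UNIV. H i j * v i * v j)"
      "\<And>i j. i \<notin> I \<Longrightarrow> H i j = 0" for I and H :: "'n \<Rightarrow> 'n \<Rightarrow> real"
    using that
  proof (induction I arbitrary: H)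
    case empty
    then show ?case by simp
  next
    case (insert a I)
    note sym = insert.prems(1) and psd = insert.prems(2)
    \<comment> \<open>The form at \<open>v + s e\<^sub>a\<close> as a quadratic polynomial in
      \<open>s\<close>; its nonnegativity for suitable \<open>s\<close> is all that is used of
      \<open>H\<close> below.\<close>
    have quad: "(\<Sum>i\<in>UNIV. \<Sum>j\<in>UNIV. H i j * (v i + s * (if i = a then 1 else 0)) * (v j + s * (if j = a then 1 else 0)))
      = (\<Sum>i\<in>UNIV. \<Sum>j\<in>UNIV. H i j * v i * v j) + 2 * s * (\<Sum>j\<in>UNIV. H a j * v j) + s\<^sup>2 * H a a" for v s
    proof -
      have "(\<Sum>i\<in>UNIV. \<Sum>j\<in>UNIV. H i j * (v i + s * (if i = a then 1 else 0)) * (v j + s * (if j = a then 1 else 0)))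
        = (\<Sum>i\<in>UNIV. \<Sum>j\<in>UNIV. H i j * v i * v j + (if j = a then s * H i a * v i else 0)
            + (if i = a then s * H a j * v j else 0) + (if i = a then if j = a then s\<^sup>2 * H a a else 0 else 0))"
        by (intro sum.cong refl) (auto simp: algebra_simps power2_eq_square)
      also have "\<dots> = (\<Sum>i\<in>UNIV. \<Sum>j\<in>UNIV. H i j * v i * v j) + (\<Sum>i\<in>UNIV. s * H i a * v i)
            + (\<Sum>j\<in>UNIV. s * H a j * v j) + s\<^sup>2 * H a a"
      proof -
        have swp: "(\<Sum>i\<in>UNIV. \<Sum>j\<in>UNIV. if i = a then f j else 0) = (\<Sum>j\<in>UNIV. f j)" for f :: "'n \<Rightarrow> real"
          by (subst sum.swap) simp
        show ?thesis by (simp add: sum.distrib swp)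
      qed
      also have "(\<Sum>i\<in>UNIV. s * H i a * v i) = (\<Sum>j\<in>UNIV. s * H a j * v j)"
        using sym by (intro sum.cong) auto
      finally show ?thesis by (simp add: sum_distrib_left mult.assoc)
    qed
    have disc: "0 \<le> (\<Sum>i\<in>UNIV. \<Sum>j\<in>UNIV. H i j * v i * v j) + 2 * s * (\<Sum>j\<in>UNIV. H a j * v j) + s\<^sup>2 * H a a" for v s
      using psd[of "\<lambda>i. v i + s * (if i = a then 1 else 0)"] quad[of v s] by simp
    have Haa: "H a a \<ge> 0"
      using disc[of "\<lambda>_. 0" 1] by simp
    show ?case
    proof (cases "H a a = 0")
      case True
      have z: "H a j = 0" for j
      proof (rule ccontr)
        assume nz: "H a j \<noteq> 0"
        define v where "v = (\<lambda>i. if i = j then 1 else (0::real))"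
        have "(\<Sum>i\<in>UNIV. \<Sum>l\<in>UNIV. H i l * v i * v l) = (\<Sum>i\<in>UNIV. \<Sum>l\<in>UNIV. if l = j then if i = j then H j j else 0 else 0)"
          by (intro sum.cong refl) (simp add: v_def)
        then have v: "(\<Sum>i\<in>UNIV. \<Sum>l\<in>UNIV. H i l * v i * v l) = H j j" by simp
        have v': "(\<Sum>i\<in>UNIV. H a i * v i) = H a j"
          by (simp add: v_def if_distrib cong: if_cong)
        \<comment> \<open>With \<open>H a a = 0\<close> the polynomial is affine in
          \<open>s\<close>. This \<open>s\<close> makes the linear term cancel \<open>H j j\<close>
          and leaves \<open>-1\<close>.\<close>
        have "0 \<le> H j j + 2 * (- (H j j + 1) / (2 * H a j)) * H a j"
          using disc[of v "- (H j j + 1) / (2 * H a j)"] v v' True by simp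
        also have "2 * (- (H j j + 1) / (2 * H a j)) * H a j = - (H j j + 1)"
          using nz by simp
        finally show False by simp
      qed
      show ?thesis
        by (rule insert.IH[OF sym psd]) (use z insert.prems(3) in \<open>metis insert_iff\<close>)
    next
      case False
      with Haa have Hp: "H a a > 0" by simp
      define H' where "H' i j = H i j - H a i * H a j / H a a" for i j
      have split: "(\<Sum>i\<in>UNIV. \<Sum>j\<in>UNIV. H' i j * L i j) =
          (\<Sum>i\<in>UNIV. \<Sum>j\<in>UNIV. H i j * L i j) - (\<Sum>i\<in>UNIV. \<Sum>j\<in>UNIV. L i j * H a i * H a j) / H a a" for L
      proof -
        have "H' i j * L i j = H i j * L i j - L i j * H a i * H a j / H a a" for i j
          by (simp add: H'_def algebra_simps)
        then show ?thesis by (simp only: sum_subtractf sum_divide_distrib)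
      qed
      have psd': "0 \<le> (\<Sum>i\<in>UNIV. \<Sum>j\<in>UNIV. H' i j * v i * v j)" for v
      proof -
        define q where "q = (\<Sum>j\<in>UNIV. H a j * v j)"
        have "(\<Sum>i\<in>UNIV. \<Sum>j\<in>UNIV. (v i * v j) * H a i * H a j) = q\<^sup>2"
          unfolding q_def power2_eq_square sum_product by (intro sum.cong refl) simp
        then have "(\<Sum>i\<in>UNIV. \<Sum>j\<in>UNIV. H' i j * v i * v j) = (\<Sum>i\<in>UNIV. \<Sum>j\<in>UNIV. H i j * v i * v j) - q\<^sup>2 / H a a"
          using split[of "\<lambda>i j. v i * v j"] by (simp add: mult.assoc)
        \<comment> \<open>Completing the square: \<open>s = - q / H a a\<close> is where the
          quadratic polynomial is smallest.\<close>
        also have "\<dots> = (\<Sum>i\<in>UNIV. \<Sum>j\<in>UNIV. H i j * v i * v j) + 2 * (- q / H a a) * q + (- q / H a a)\<^sup>2 * H a a"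
          using Hp by (simp add: power2_eq_square field_simps)
        also have "\<dots> \<ge> 0" using disc[of v "- q / H a a"] by (simp only: q_def)
        finally show ?thesis .
      qed
      have "0 \<le> (\<Sum>i\<in>UNIV. \<Sum>j\<in>UNIV. H' i j * K i j)"
      proof (rule insert.IH[OF _ psd'])
        show "H' i j = H' j i" for i j using sym by (simp add: H'_def mult.commute)
        show "H' i j = 0" if "i \<notin> I" for i j
        proof (cases "i = a")
          case True
          then show ?thesis using Hp by (simp add: H'_def)
        next
          case False
          then have "H i j = 0" "H a i = 0" using insert.prems(3)[of i] that sym[of a i] by auto
          then show ?thesis by (simp add: H'_def)
        qed
      qed
      moreover have "0 \<le> (\<Sum>i\<in>UNIV. \<Sum>j\<in>UNIV. K i j * H a i * H a j) / H a a"
        using assms(3)[of "H a"] Hp by simp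
      ultimately show ?thesis using split[of K] by linarith
    qed
  qed
  from this[of UNIV H] assms(1,2) show ?thesis by simp
qed

section \<open>A Riemannian metric on an open set of coordinates\<close>

locale metric_chart =
  fixes G :: "real ^ 'n::finite \<Rightarrow> real ^ 'n ^ 'n" and V :: "(real ^ 'n) set"
  assumes open_V: "open V" and smooth_G: "smooth_on V G"
    and sym_G: "\<And>x. x \<in> V \<Longrightarrow> transpose (G x) = G x"
    and pos_G: "\<And>x v. x \<in> V \<Longrightarrow> v \<noteq> 0 \<Longrightarrow> v \<bullet> (G x *v v) > 0"
begin

abbreviation ginv :: "real ^ 'n \<Rightarrow> real ^ 'n ^ 'n" where
  "ginv x \<equiv> matrix_inv (G x)"

abbreviation chris :: "real ^ 'n \<Rightarrow> 'n \<Rightarrow> 'n \<Rightarrow> 'n \<Rightarrow> real" where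
  "chris \<equiv> christoffel G"

lemma G_commute: "x \<in> V \<Longrightarrow> G x $ i $ j = G x $ j $ i"
  using arg_cong[OF sym_G, of x "\<lambda>A. A $ j $ i"] by (simp add: transpose_def)

lemma smooth_G_nth: "smooth_on V (\<lambda>x. G x $ i $ j)"
  by (intro smooth_on_vec_nth open_V smooth_G)

lemma differentiable_smooth: "smooth_on V f \<Longrightarrow> x \<in> V \<Longrightarrow> f differentiable (at x)"
  by (rule smooth_on_imp_differentiable[OF open_V])

lemma det_G_pos: "x \<in> V \<Longrightarrow> det (G x) > 0"
  using positive_definite_det_pos pos_G by blast

lemma invertible_G: "x \<in> V \<Longrightarrow> invertible (G x)"
  using det_G_pos invertible_det_nz by (metis less_irrefl)

lemma ginv_mult:
  assumes "x \<in> V" shows "ginv x ** G x = mat 1" "G x ** ginv x = mat 1"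
proof -
  have "G x ** ginv x = mat 1 \<and> ginv x ** G x = mat 1"
    unfolding matrix_inv_def
    by (rule someI_ex) (use invertible_G[OF assms] in \<open>simp add: invertible_def\<close>)
  then show "ginv x ** G x = mat 1" "G x ** ginv x = mat 1" by auto
qed

lemma sum_G_ginv: "x \<in> V \<Longrightarrow> (\<Sum>l\<in>UNIV. G x $ a $ l * ginv x $ l $ m) = (if a = m then 1 else 0)"
  using arg_cong[OF ginv_mult(2), of x "\<lambda>A. A $ a $ m"] by (simp add: matrix_matrix_mult_def mat_def)

lemma sum_ginv_G: "x \<in> V \<Longrightarrow> (\<Sum>l\<in>UNIV. ginv x $ a $ l * G x $ l $ m) = (if a = m then 1 else 0)"
  using arg_cong[OF ginv_mult(1), of x "\<lambda>A. A $ a $ m"] by (simp add: matrix_matrix_mult_def mat_def)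

lemma transpose_ginv:
  assumes "x \<in> V" shows "transpose (ginv x) = ginv x"
proof -
  have "transpose (ginv x) ** G x = mat 1"
    by (metis assms ginv_mult(2) matrix_transpose_mul sym_G transpose_mat)
  then show ?thesis
    by (metis assms ginv_mult(2) matrix_mul_assoc matrix_mul_lid matrix_mul_rid)
qed

lemma ginv_commute: "x \<in> V \<Longrightarrow> ginv x $ i $ j = ginv x $ j $ i"
  using arg_cong[OF transpose_ginv, of x "\<lambda>A. A $ j $ i"] by (simp add: transpose_def)

lemma ginv_psd:
  assumes "x \<in> V" shows "0 \<le> (\<Sum>i\<in>UNIV. \<Sum>j\<in>UNIV. ginv x $ i $ j * v i * v j)"
proof -
  define w where "w = ginv x *v (\<chi> i. v i)"
  have Gw: "G x *v w = (\<chi> i. v i)"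
    by (simp add: w_def matrix_vector_mul_assoc ginv_mult assms)
  have "0 \<le> w \<bullet> (G x *v w)"
    using pos_G[OF assms, of w] by (cases "w = 0") auto
  also have "\<dots> = (\<Sum>i\<in>UNIV. \<Sum>j\<in>UNIV. ginv x $ i $ j * v i * v j)"
    unfolding Gw by (simp add: w_def inner_vec_def matrix_vector_mult_def sum_distrib_right sum_distrib_left mult_ac)
  finally show ?thesis .
qed

text \<open>\<open>matrix_inv\<close> is a choice and shows no regularity by itself; Cramer's rule
  presents its entries as quotients of determinants.\<close>

lemma smooth_ginv_nth: "smooth_on V (\<lambda>x. ginv x $ k $ l)"
proof (rule smooth_on_cong[OF open_V])
  show "smooth_on V (\<lambda>x. det (\<chi> i j. if j = k then axis l 1 $ i else G x $ i $ j) / det (G x))"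
  proof (intro smooth_on_divide smooth_on_det open_V smooth_G_nth)
    show "smooth_on V (\<lambda>x. (\<chi> i j. if j = k then axis l 1 $ i else G x $ i $ j) $ i $ j)" for i j
      by (cases "j = k") (auto intro: smooth_on_const open_V smooth_G_nth)
    show "det (G x) \<noteq> 0" if "x \<in> V" for x using det_G_pos[OF that] by simp
  qed
  fix x assume x: "x \<in> V"
  have "G x *v (ginv x *v axis l 1) = axis l 1"
    by (simp add: matrix_vector_mul_assoc ginv_mult x)
  then have "ginv x *v axis l 1 = (\<chi> k. det (\<chi> i j. if j = k then axis l 1 $ i else G x $ i $ j) / det (G x))"
    using cramer[of "G x"] det_G_pos[OF x] by force
  moreover have "(ginv x *v axis l 1) $ k = ginv x $ k $ l"
    by (simp add: matrix_vector_mult_def axis_def if_distrib cong: if_cong)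
  ultimately show "det (\<chi> i j. if j = k then axis l 1 $ i else G x $ i $ j) / det (G x) = ginv x $ k $ l"
    by simp
qed

lemma smooth_chris: "smooth_on V (\<lambda>x. chris x k i j)"
  unfolding christoffel_def
  by (intro smooth_on_mult smooth_on_sum smooth_on_const smooth_on_add smooth_on_diff smooth_on_pd
      smooth_G_nth smooth_ginv_nth open_V)

lemma smooth_sqrt_det: "smooth_on V (\<lambda>x. sqrt (det (G x)))"
  by (intro smooth_on_sqrt smooth_on_det open_V smooth_G_nth det_G_pos)

lemma pd_G_commute: "x \<in> V \<Longrightarrow> pd k (\<lambda>y. G y $ i $ j) x = pd k (\<lambda>y. G y $ j $ i) x"
  by (rule pd_metric_sym[OF open_V]) (auto intro: differentiable_smooth smooth_G sym_G)

lemma chris_commute: "x \<in> V \<Longrightarrow> chris x k i j = chris x k j i"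
  by (rule christoffel_torsion_free[OF open_V]) (auto intro: differentiable_smooth smooth_G sym_G)

lemma pd_G: "x \<in> V \<Longrightarrow> pd k (\<lambda>y. G y $ i $ j) x =
    (\<Sum>l\<in>UNIV. chris x l k i * G x $ l $ j + chris x l k j * G x $ i $ l)"
  by (rule christoffel_metric[OF open_V]) (auto intro: differentiable_smooth smooth_G sym_G invertible_G)

text \<open>Of the three metric derivatives in the contracted symbol, two cancel because the inverse
  metric is symmetric. By Jacobi's formula the remaining one is half the logarithmic derivative of
  \<open>det (G x)\<close>.\<close>

lemma sum_chris_diag:
  assumes x: "x \<in> V"
  shows "(\<Sum>i\<in>UNIV. chris x i i k) = (\<Sum>i\<in>UNIV. \<Sum>j\<in>UNIV. pd k (\<lambda>y. G y $ i $ j) x * ginv x $ j $ i) / 2"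
proof -
  define P where "P = (\<Sum>i\<in>UNIV. \<Sum>l\<in>UNIV. ginv x $ i $ l * pd i (\<lambda>y. G y $ k $ l) x)"
  have "P = (\<Sum>i\<in>UNIV. \<Sum>l\<in>UNIV. ginv x $ i $ l * pd l (\<lambda>y. G y $ i $ k) x)"
    unfolding P_def by (subst sum.swap) (simp add: ginv_commute[OF x] pd_G_commute[OF x, of _ k])
  moreover have "(\<Sum>i\<in>UNIV. chris x i i k) = (P + (\<Sum>i\<in>UNIV. \<Sum>l\<in>UNIV. ginv x $ i $ l * pd k (\<lambda>y. G y $ i $ l) x)
     - (\<Sum>i\<in>UNIV. \<Sum>l\<in>UNIV. ginv x $ i $ l * pd l (\<lambda>y. G y $ i $ k) x)) / 2"
    unfolding christoffel_def P_def
    by (simp add: ring_distribs sum.distrib sum_subtractf flip: sum_distrib_left sum_divide_distrib)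
  ultimately show ?thesis
    by (simp add: ginv_commute[OF x] mult.commute)
qed

text \<open>The contracted Christoffel symbol is the logarithmic derivative of the volume density.
  The covariant divergence times the density is thus a coordinate divergence, ready for integration
  by parts against Lebesgue measure.\<close>

lemma div_vec_sqrt_det:
  assumes Y: "smooth_on V Y" and x: "x \<in> V"
  shows "div_vec G Y x * sqrt (det (G x)) = (\<Sum>i\<in>UNIV. pd i (\<lambda>y. sqrt (det (G y)) * Y y $ i) x)"
proof -
  define s where "s = sqrt (det (G x))"
  have s: "s > 0" "det (G x) = s * s" using det_G_pos[OF x] by (simp_all add: s_def)
  have ps: "pd k (\<lambda>y. sqrt (det (G y))) x = s * (\<Sum>i\<in>UNIV. chris x i i k)" for k
  proof -
    have d: "(\<lambda>y. G y $ i $ j) differentiable (at x)" for i j by (rule differentiable_smooth[OF smooth_G_nth x])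
    have "pd k (\<lambda>y. sqrt (det (G y))) x = pd k (\<lambda>y. det (G y)) x / (2 * s)"
      unfolding s_def by (rule pd_sqrt[OF pd_det(1)[OF d ginv_mult(1)[OF x]] det_G_pos[OF x]])
    also have "pd k (\<lambda>y. det (G y)) x = s * s * (2 * (\<Sum>i\<in>UNIV. chris x i i k))"
      by (simp add: pd_det(2)[OF d ginv_mult(1)[OF x]] sum_chris_diag[OF x] s(2))
    finally show ?thesis using s by simp
  qed
  have "(\<Sum>i\<in>UNIV. pd i (\<lambda>y. sqrt (det (G y)) * Y y $ i) x) =
     (\<Sum>i\<in>UNIV. s * (\<Sum>j\<in>UNIV. chris x j j i) * Y x $ i + s * pd i (\<lambda>y. Y y $ i) x)"
    by (intro sum.cong refl, subst pd_mult)
      (auto intro!: differentiable_smooth[OF _ x] smooth_sqrt_det smooth_on_vec_nth open_V Y simp: ps s_def[symmetric])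
  also have "\<dots> = s * ((\<Sum>i\<in>UNIV. pd i (\<lambda>y. Y y $ i) x) + (\<Sum>i\<in>UNIV. \<Sum>j\<in>UNIV. chris x j j i * Y x $ i))"
    by (simp add: sum.distrib sum_distrib_left sum_distrib_right algebra_simps)
  also have "(\<Sum>i\<in>UNIV. \<Sum>j\<in>UNIV. chris x j j i * Y x $ i) = (\<Sum>j\<in>UNIV. \<Sum>i\<in>UNIV. chris x j j i * Y x $ i)"
    by (rule sum.swap)
  finally show ?thesis
    by (simp add: div_vec_def cov_vec_def sum.distrib s_def mult.commute)
qed

lemma inner_G_commute:
  assumes "x \<in> V" shows "v \<bullet> (G x *v w) = w \<bullet> (G x *v v)"
proof -
  have "v \<bullet> (G x *v w) = (transpose (G x) *v v) \<bullet> w"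
    by (simp only: transpose_matrix_vector dot_lmul_matrix)
  then show ?thesis by (simp add: sym_G[OF assms] inner_commute)
qed

lemma lower_nth: "lower G X y $ j = (\<Sum>k\<in>UNIV. G y $ j $ k * X y $ k)"
  by (simp add: lower_def matrix_vector_mult_def)

lemma norm2_vec_eq: "norm2_vec G X y = (\<Sum>j\<in>UNIV. X y $ j * lower G X y $ j)"
  by (simp add: norm2_vec_def inner_vec_def lower_def)

section \<open>One vector field in the chart: covariant derivative and associated one-forms\<close>

context
  fixes X :: "real ^ 'n \<Rightarrow> real ^ 'n"
  assumes smooth_X: "smooth_on V X"
begin

lemma smooth_X_nth: "smooth_on V (\<lambda>x. X x $ i)"
  by (intro smooth_on_vec_nth open_V smooth_X)

lemma smooth_lower_nth: "smooth_on V (\<lambda>x. lower G X x $ i)"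
  unfolding lower_nth by (intro smooth_on_sum smooth_on_mult smooth_G_nth smooth_X_nth open_V)

lemma smooth_norm2_vec: "smooth_on V (norm2_vec G X)"
  unfolding norm2_vec_eq[abs_def] by (intro smooth_on_sum smooth_on_mult smooth_lower_nth smooth_X_nth open_V)

lemma smooth_cov_vec: "smooth_on V (\<lambda>x. cov_vec G X x i j)"
  unfolding cov_vec_def
  by (intro smooth_on_add smooth_on_sum smooth_on_mult smooth_on_pd smooth_chris smooth_X_nth open_V)

lemma smooth_div_vec: "smooth_on V (div_vec G X)"
  unfolding div_vec_def[abs_def] by (intro smooth_on_sum smooth_cov_vec open_V)

lemma smooth_cov_covec: "smooth_on V (\<lambda>x. cov_covec G (lower G X) x i j)"
  unfolding cov_covec_def
  by (intro smooth_on_diff smooth_on_sum smooth_on_mult smooth_on_pd smooth_chris smooth_lower_nth open_V)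

lemma smooth_raise2_stress: "smooth_on V (\<lambda>x. raise2 G (stress G X) x i j)"
  unfolding raise2_def stress_def
  by (intro smooth_on_add smooth_on_sum smooth_on_mult smooth_cov_covec smooth_ginv_nth open_V)

text \<open>Lowering commutes with differentiation because the metric is parallel: of the two
  Christoffel terms in the derivative of \<open>G\<close>, one cancels the correction in
  \<open>cov_covec\<close> and the other becomes the one in \<open>cov_vec\<close>.\<close>

lemma cov_covec_lower:
  assumes x: "x \<in> V"
  shows "cov_covec G (lower G X) x i j = (\<Sum>k\<in>UNIV. G x $ j $ k * cov_vec G X x i k)"
proof -
  have "pd i (\<lambda>y. lower G X y $ j) x = (\<Sum>k\<in>UNIV. pd i (\<lambda>y. G y $ j $ k) x * X x $ k + G x $ j $ k * pd i (\<lambda>y. X y $ k) x)"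
    unfolding lower_nth
    by (subst pd_sum) (auto intro!: sum.cong pd_mult differentiable_smooth[OF _ x] smooth_on_mult smooth_G_nth smooth_X_nth open_V)
  also have "\<dots> = (\<Sum>k\<in>UNIV. \<Sum>l\<in>UNIV. chris x l i j * G x $ l $ k * X x $ k)
     + (\<Sum>k\<in>UNIV. \<Sum>l\<in>UNIV. chris x l i k * G x $ j $ l * X x $ k) + (\<Sum>k\<in>UNIV. G x $ j $ k * pd i (\<lambda>y. X y $ k) x)"
    by (simp add: pd_G[OF x] sum.distrib sum_distrib_right distrib_right)
  also have "(\<Sum>k\<in>UNIV. \<Sum>l\<in>UNIV. chris x l i j * G x $ l $ k * X x $ k) = (\<Sum>k\<in>UNIV. chris x k i j * lower G X x $ k)"
    by (subst sum.swap) (simp add: lower_nth sum_distrib_left mult.assoc)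
  also have "(\<Sum>k\<in>UNIV. \<Sum>l\<in>UNIV. chris x l i k * G x $ j $ l * X x $ k) = (\<Sum>k\<in>UNIV. \<Sum>l\<in>UNIV. G x $ j $ k * (chris x k i l * X x $ l))"
    by (subst sum.swap) (simp add: mult_ac)
  finally show ?thesis
    by (simp add: cov_covec_def cov_vec_def sum.distrib distrib_left sum_distrib_left)
qed

text \<open>The one-form \<open>dX\<^sup>\<flat>(X, \<cdot>)\<close>. Together with the differential of \<open>|X|\<^sup>2\<close> it expresses \<open>\<nabla>\<^sub>X X\<close> and
  \<open>S(X, \<cdot>)\<close> without Christoffel symbols, which makes their change of coordinates accessible.\<close>

definition curl_form :: "real ^ 'n \<Rightarrow> real ^ 'n" where
  "curl_form x = (\<chi> b. \<Sum>a\<in>UNIV. X x $ a * (pd a (\<lambda>y. lower G X y $ b) x - pd b (\<lambda>y. lower G X y $ a) x))"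

definition grad_form :: "real ^ 'n \<Rightarrow> real ^ 'n" where
  "grad_form x = (\<chi> b. pd b (norm2_vec G X) x)"

text \<open>An antisymmetric form is evaluated twice on the same vector.\<close>

lemma X_inner_curl_form: "X x \<bullet> curl_form x = 0"
proof -
  have "X x \<bullet> curl_form x = (\<Sum>b\<in>UNIV. \<Sum>a\<in>UNIV. X x $ b * X x $ a * pd a (\<lambda>y. lower G X y $ b) x)
     - (\<Sum>b\<in>UNIV. \<Sum>a\<in>UNIV. X x $ b * X x $ a * pd b (\<lambda>y. lower G X y $ a) x)"
    by (simp add: curl_form_def inner_vec_def sum_distrib_left sum_subtractf algebra_simps)
  also have "(\<Sum>b\<in>UNIV. \<Sum>a\<in>UNIV. X x $ b * X x $ a * pd b (\<lambda>y. lower G X y $ a) x)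
     = (\<Sum>b\<in>UNIV. \<Sum>a\<in>UNIV. X x $ b * X x $ a * pd a (\<lambda>y. lower G X y $ b) x)"
    by (subst sum.swap) (simp add: mult_ac)
  finally show ?thesis by simp
qed

text \<open>The contraction is computed twice, through \<open>\<nabla>\<^sub>b X\<^sub>a\<close> and
  through \<open>\<nabla>\<^sub>b X\<^sup>k\<close>. The Christoffel terms have opposite signs, so
  the two expressions add up to the partial derivative of \<open>|X|\<^sup>2\<close>.\<close>

lemma cov_covec_contract_right:
  assumes x: "x \<in> V"
  shows "(\<Sum>a\<in>UNIV. X x $ a * cov_covec G (lower G X) x b a) = grad_form x $ b / 2"
proof -
  have "grad_form x $ b = (\<Sum>a\<in>UNIV. pd b (\<lambda>y. X y $ a) x * lower G X x $ a + X x $ a * pd b (\<lambda>y. lower G X y $ a) x)"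
    unfolding grad_form_def norm2_vec_eq[abs_def] vec_lambda_beta
    by (subst pd_sum) (auto intro!: sum.cong pd_mult differentiable_smooth[OF _ x] smooth_on_mult smooth_lower_nth smooth_X_nth open_V)
  moreover have "(\<Sum>a\<in>UNIV. X x $ a * cov_covec G (lower G X) x b a) =
     (\<Sum>a\<in>UNIV. X x $ a * pd b (\<lambda>y. lower G X y $ a) x) - (\<Sum>a\<in>UNIV. \<Sum>k\<in>UNIV. X x $ a * chris x k b a * lower G X x $ k)"
    by (simp add: cov_covec_def sum_subtractf right_diff_distrib sum_distrib_left mult.assoc)
  moreover have "(\<Sum>a\<in>UNIV. X x $ a * cov_covec G (lower G X) x b a) =
     (\<Sum>k\<in>UNIV. lower G X x $ k * cov_vec G X x b k)"
  proof -
    have "(\<Sum>a\<in>UNIV. X x $ a * cov_covec G (lower G X) x b a) = (\<Sum>a\<in>UNIV. \<Sum>k\<in>UNIV. X x $ a * G x $ a $ k * cov_vec G X x b k)"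
      by (simp add: cov_covec_lower[OF x] sum_distrib_left mult.assoc)
    also have "\<dots> = (\<Sum>k\<in>UNIV. lower G X x $ k * cov_vec G X x b k)"
      by (subst sum.swap) (simp add: lower_nth G_commute[OF x] sum_distrib_left sum_distrib_right mult_ac)
    finally show ?thesis .
  qed
  moreover have "(\<Sum>k\<in>UNIV. lower G X x $ k * cov_vec G X x b k) =
     (\<Sum>k\<in>UNIV. pd b (\<lambda>y. X y $ k) x * lower G X x $ k) + (\<Sum>a\<in>UNIV. \<Sum>k\<in>UNIV. X x $ a * chris x k b a * lower G X x $ k)"
  proof -
    have "(\<Sum>a\<in>UNIV. \<Sum>k\<in>UNIV. X x $ a * chris x k b a * lower G X x $ k) = (\<Sum>k\<in>UNIV. \<Sum>a\<in>UNIV. X x $ a * chris x k b a * lower G X x $ k)"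
      by (rule sum.swap)
    then show ?thesis
      by (simp add: cov_vec_def distrib_left sum.distrib sum_distrib_left mult_ac)
  qed
  ultimately show ?thesis by (simp add: sum.distrib)
qed

text \<open>By torsion-freeness the Christoffel symbols cancel in
  \<open>\<nabla>\<^sub>a X\<^sub>b - \<nabla>\<^sub>b X\<^sub>a\<close>, which is the exterior
  derivative of the lowered field; contracted with \<open>X\<close> it is
  \<open>curl_form\<close>.\<close>

lemma cov_covec_contract_left:
  assumes x: "x \<in> V"
  shows "(\<Sum>a\<in>UNIV. X x $ a * cov_covec G (lower G X) x a b) = grad_form x $ b / 2 + curl_form x $ b"
proof -
  have "cov_covec G (lower G X) x a b = cov_covec G (lower G X) x b a + (pd a (\<lambda>y. lower G X y $ b) x - pd b (\<lambda>y. lower G X y $ a) x)" for a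
    by (simp add: cov_covec_def chris_commute[OF x, of _ a b])
  then have "(\<Sum>a\<in>UNIV. X x $ a * cov_covec G (lower G X) x a b) =
     (\<Sum>a\<in>UNIV. X x $ a * cov_covec G (lower G X) x b a) + curl_form x $ b"
    by (simp add: curl_form_def distrib_left sum.distrib)
  then show ?thesis using cov_covec_contract_right[OF x] by simp
qed

lemma G_cov_along:
  assumes x: "x \<in> V"
  shows "G x *v cov_along G X X x = (1/2) *\<^sub>R grad_form x + curl_form x"
proof (rule vec_eq_iff[THEN iffD2], rule allI)
  fix b
  have "(G x *v cov_along G X X x) $ b = (\<Sum>k\<in>UNIV. \<Sum>a\<in>UNIV. X x $ a * (G x $ b $ k * cov_vec G X x a k))"
    by (simp add: matrix_vector_mult_def cov_along_def sum_distrib_left mult_ac)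
  also have "\<dots> = (\<Sum>a\<in>UNIV. X x $ a * cov_covec G (lower G X) x a b)"
    by (subst sum.swap) (simp add: cov_covec_lower[OF x] sum_distrib_left)
  finally show "(G x *v cov_along G X X x) $ b = ((1/2) *\<^sub>R grad_form x + curl_form x) $ b"
    using cov_covec_contract_left[OF x] by simp
qed

lemma cov_along_eq: "x \<in> V \<Longrightarrow> cov_along G X X x = ginv x *v ((1/2) *\<^sub>R grad_form x + curl_form x)"
  by (metis G_cov_along ginv_mult(1) matrix_vector_mul_assoc matrix_vector_mul_lid)

lemma X_inner_G_cov_along:
  assumes x: "x \<in> V"
  shows "X x \<bullet> (G x *v cov_along G X X x) = (\<Sum>i\<in>UNIV. X x $ i * pd i (norm2_vec G X) x) / 2"
  by (simp add: G_cov_along[OF x] inner_add_right X_inner_curl_form)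
    (simp add: inner_vec_def grad_form_def)

text \<open>The field \<open>W\<close> of the overview. The doubly raised tensor is used because
  that is what \<open>div_tensor\<close> differentiates.\<close>

definition stress_flux :: "real ^ 'n \<Rightarrow> real ^ 'n" where
  "stress_flux x = (\<chi> j. \<Sum>i\<in>UNIV. lower G X x $ i * raise2 G (stress G X) x i j)"

lemma stress_commute: "stress G X x i j = stress G X x j i"
  by (simp add: stress_def)

lemma raise2_stress_commute: "raise2 G (stress G X) x i j = raise2 G (stress G X) x j i"
  unfolding raise2_def by (subst sum.swap) (simp add: stress_commute mult_ac)

lemma ginv_lower: "x \<in> V \<Longrightarrow> (\<Sum>i\<in>UNIV. lower G X x $ i * ginv x $ i $ a) = X x $ a"
proof -
  assume x: "x \<in> V"
  have "ginv x *v lower G X x = X x"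
    by (simp add: lower_def matrix_vector_mul_assoc ginv_mult x)
  from arg_cong[OF this, of "\<lambda>v. v $ a"] show ?thesis
    by (simp add: matrix_vector_mult_def ginv_commute[OF x, of a] mult.commute)
qed

text \<open>\<open>S(X, \<cdot>)\<close> is the sum of the two contractions of the covariant
  derivative with \<open>X\<close>, each contributing half of \<open>grad_form\<close>.\<close>

lemma stress_flux_eq:
  assumes x: "x \<in> V"
  shows "stress_flux x = ginv x *v (grad_form x + curl_form x)"
proof (rule vec_eq_iff[THEN iffD2], rule allI)
  have sx: "(\<Sum>a\<in>UNIV. X x $ a * stress G X x a b) = (grad_form x + curl_form x) $ b" for b
    using cov_covec_contract_left[OF x, of b] cov_covec_contract_right[OF x, of b]
    by (simp add: stress_def distrib_left sum.distrib)
  fix j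
  have "stress_flux x $ j = (\<Sum>i\<in>UNIV. \<Sum>a\<in>UNIV. \<Sum>b\<in>UNIV. (lower G X x $ i * ginv x $ i $ a) * (ginv x $ j $ b * stress G X x a b))"
    by (simp add: stress_flux_def raise2_def sum_distrib_left mult_ac)
  also have "\<dots> = (\<Sum>a\<in>UNIV. (\<Sum>i\<in>UNIV. lower G X x $ i * ginv x $ i $ a) * (\<Sum>b\<in>UNIV. ginv x $ j $ b * stress G X x a b))"
    by (subst sum.swap) (simp add: sum_product)
  also have "\<dots> = (\<Sum>a\<in>UNIV. \<Sum>b\<in>UNIV. ginv x $ j $ b * (X x $ a * stress G X x a b))"
    by (simp add: ginv_lower[OF x] sum_distrib_left mult_ac)
  also have "\<dots> = (\<Sum>b\<in>UNIV. ginv x $ j $ b * (\<Sum>a\<in>UNIV. X x $ a * stress G X x a b))"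
    by (subst sum.swap) (simp add: sum_distrib_left)
  finally show "stress_flux x $ j = (ginv x *v (grad_form x + curl_form x)) $ j"
    by (simp add: matrix_vector_mult_def sx)
qed

section \<open>Pointwise identities behind the energy balance\<close>

definition stress_norm2 :: "real ^ 'n \<Rightarrow> real" where
  "stress_norm2 x = (\<Sum>i\<in>UNIV. \<Sum>j\<in>UNIV. raise2 G (stress G X) x i j * stress G X x i j)"

lemma smooth_stress_flux: "smooth_on V stress_flux"
  unfolding stress_flux_def[abs_def]
  by (intro smooth_on_vec_lambda smooth_on_sum smooth_on_mult smooth_lower_nth smooth_raise2_stress open_V)

lemma smooth_stress_norm2: "smooth_on V stress_norm2"
  unfolding stress_norm2_def[abs_def] stress_def
  by (intro smooth_on_sum smooth_on_mult smooth_on_add smooth_raise2_stress[unfolded stress_def] smooth_cov_covec open_V)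

lemma smooth_cov_along: "smooth_on V (cov_along G X X)"
  unfolding cov_along_def[abs_def]
  by (intro smooth_on_vec_lambda smooth_on_sum smooth_on_mult smooth_X_nth smooth_cov_vec open_V)

text \<open>Product rule for \<open>\<nabla>\<^sub>j (X\<^sub>i S\<^sup>i\<^sup>j)\<close>. The
  factor one half arises because the symmetric \<open>S\<^sup>i\<^sup>j\<close> sees only the
  symmetric part of \<open>\<nabla>X\<close>, which is \<open>S / 2\<close>. The sums
  \<open>T2\<close> and \<open>T3\<close> occur in both divergences, while \<open>T1 - T4\<close>
  assembles \<open>\<nabla>\<^sub>j X\<^sub>i S\<^sup>i\<^sup>j\<close>.\<close>

lemma div_stress_flux:
  assumes x: "x \<in> V"
  shows "div_vec G stress_flux x = X x \<bullet> (G x *v div_tensor G (stress G X) x) + stress_norm2 x / 2"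
proof -
  let ?S = "\<lambda>i j. raise2 G (stress G X) x i j"
  let ?w = "\<lambda>i. lower G X x $ i"
  have pdW: "pd j (\<lambda>y. stress_flux y $ j) x = (\<Sum>i\<in>UNIV. pd j (\<lambda>y. lower G X y $ i) x * ?S i j + ?w i * pd j (\<lambda>y. raise2 G (stress G X) y i j) x)" for j
    unfolding stress_flux_def vec_lambda_beta
    by (subst pd_sum) (auto intro!: sum.cong pd_mult differentiable_smooth[OF _ x] smooth_on_mult smooth_lower_nth smooth_raise2_stress open_V)
  define T1 where "T1 = (\<Sum>j\<in>UNIV. \<Sum>i\<in>UNIV. pd j (\<lambda>y. lower G X y $ i) x * ?S i j)"
  define T2 where "T2 = (\<Sum>j\<in>UNIV. \<Sum>i\<in>UNIV. ?w i * pd j (\<lambda>y. raise2 G (stress G X) y i j) x)"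
  define T3 where "T3 = (\<Sum>j\<in>UNIV. \<Sum>k\<in>UNIV. \<Sum>i\<in>UNIV. chris x j j k * ?w i * ?S i k)"
  define T4 where "T4 = (\<Sum>i\<in>UNIV. \<Sum>j\<in>UNIV. \<Sum>k\<in>UNIV. ?w i * chris x i j k * ?S k j)"
  have "div_vec G stress_flux x = T1 + T2 + T3"
    unfolding div_vec_def cov_vec_def pdW T1_def T2_def T3_def
    by (simp add: sum.distrib stress_flux_def sum_distrib_left mult.assoc)
  moreover have "X x \<bullet> (G x *v v) = (\<Sum>i\<in>UNIV. ?w i * v $ i)" for v
  proof -
    have "X x \<bullet> (G x *v v) = (G x *v X x) \<bullet> v"
      by (metis dot_lmul_matrix sym_G[OF x] transpose_matrix_vector)
    then show ?thesis by (simp add: lower_def inner_vec_def)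
  qed
  then have "X x \<bullet> (G x *v div_tensor G (stress G X) x) =
     (\<Sum>i\<in>UNIV. \<Sum>j\<in>UNIV. ?w i * pd j (\<lambda>y. raise2 G (stress G X) y i j) x) + (T4 +
     (\<Sum>i\<in>UNIV. \<Sum>j\<in>UNIV. \<Sum>k\<in>UNIV. chris x j j k * ?w i * ?S i k))"
    by (simp add: div_tensor_def T4_def sum_distrib_left distrib_left sum.distrib mult_ac)
  moreover have "(\<Sum>i\<in>UNIV. \<Sum>j\<in>UNIV. ?w i * pd j (\<lambda>y. raise2 G (stress G X) y i j) x) = T2"
    unfolding T2_def by (rule sum.swap)
  moreover have "(\<Sum>i\<in>UNIV. \<Sum>j\<in>UNIV. \<Sum>k\<in>UNIV. chris x j j k * ?w i * ?S i k) = T3"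
  proof -
    have "(\<Sum>i\<in>UNIV. \<Sum>j\<in>UNIV. \<Sum>k\<in>UNIV. chris x j j k * ?w i * ?S i k) = (\<Sum>j\<in>UNIV. \<Sum>i\<in>UNIV. \<Sum>k\<in>UNIV. chris x j j k * ?w i * ?S i k)"
      by (rule sum.swap)
    also have "\<dots> = T3" unfolding T3_def by (intro sum.cong refl sum.swap)
    finally show ?thesis .
  qed
  moreover have "T1 - T4 = stress_norm2 x / 2"
  proof -
    have "T4 = (\<Sum>j\<in>UNIV. \<Sum>i\<in>UNIV. \<Sum>k\<in>UNIV. chris x k j i * ?w k * ?S i j)"
    proof -
      have "T4 = (\<Sum>j\<in>UNIV. \<Sum>i\<in>UNIV. \<Sum>k\<in>UNIV. ?w i * chris x i j k * ?S k j)"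
        unfolding T4_def by (rule sum.swap)
      also have "\<dots> = (\<Sum>j\<in>UNIV. \<Sum>k\<in>UNIV. \<Sum>i\<in>UNIV. ?w i * chris x i j k * ?S k j)"
        by (intro sum.cong refl sum.swap)
      finally show ?thesis by (simp add: mult_ac)
    qed
    then have "T1 - T4 = (\<Sum>j\<in>UNIV. \<Sum>i\<in>UNIV. cov_covec G (lower G X) x j i * ?S i j)"
      unfolding T1_def cov_covec_def by (simp add: left_diff_distrib sum_subtractf sum_distrib_right)
    moreover have "stress_norm2 x = (\<Sum>j\<in>UNIV. \<Sum>i\<in>UNIV. cov_covec G (lower G X) x j i * ?S i j) + (\<Sum>i\<in>UNIV. \<Sum>j\<in>UNIV. cov_covec G (lower G X) x j i * ?S i j)"
    proof -
      have "stress_norm2 x = (\<Sum>i\<in>UNIV. \<Sum>j\<in>UNIV. cov_covec G (lower G X) x i j * ?S i j) + (\<Sum>i\<in>UNIV. \<Sum>j\<in>UNIV. cov_covec G (lower G X) x j i * ?S i j)"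
        unfolding stress_norm2_def by (simp add: stress_def distrib_left sum.distrib mult.commute)
      also have "(\<Sum>i\<in>UNIV. \<Sum>j\<in>UNIV. cov_covec G (lower G X) x i j * ?S i j) = (\<Sum>j\<in>UNIV. \<Sum>i\<in>UNIV. cov_covec G (lower G X) x j i * ?S i j)"
        by (simp add: raise2_stress_commute)
      finally show ?thesis .
    qed
    moreover have "(\<Sum>i\<in>UNIV. \<Sum>j\<in>UNIV. cov_covec G (lower G X) x j i * ?S i j) = (\<Sum>j\<in>UNIV. \<Sum>i\<in>UNIV. cov_covec G (lower G X) x j i * ?S i j)"
      by (rule sum.swap)
    ultimately show ?thesis by simp
  qed
  ultimately show ?thesis by simp
qed

text \<open>As a trace this is \<open>tr (G\<^sup>-\<^sup>1 S G\<^sup>-\<^sup>1 S)\<close>, the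
  pairing of the nonnegative form \<open>G\<^sup>-\<^sup>1\<close> with
  \<open>S G\<^sup>-\<^sup>1 S\<close>. Pairing two nonnegative forms replaces the choice of an
  orthonormal frame.\<close>

lemma stress_norm2_nonneg:
  assumes x: "x \<in> V"
  shows "0 \<le> stress_norm2 x"
proof -
  let ?s = "stress G X x"
  define K where "K j b = (\<Sum>i\<in>UNIV. \<Sum>a\<in>UNIV. ginv x $ i $ a * ?s i j * ?s a b)" for j b
  have "0 \<le> (\<Sum>j\<in>UNIV. \<Sum>b\<in>UNIV. ginv x $ j $ b * K j b)"
  proof (rule sum_psd_mult_nonneg)
    show "ginv x $ i $ j = ginv x $ j $ i" for i j by (rule ginv_commute[OF x])
    show "0 \<le> (\<Sum>i\<in>UNIV. \<Sum>j\<in>UNIV. ginv x $ i $ j * v i * v j)" for v by (rule ginv_psd[OF x])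
    fix v :: "'n \<Rightarrow> real"
    \<comment> \<open>Evaluating \<open>K\<close> at \<open>v\<close> is evaluating the inverse
      metric at \<open>S v\<close>, since \<open>S\<close> is symmetric.\<close>
    define u where "u i = (\<Sum>j\<in>UNIV. ?s i j * v j)" for i
    have "(\<Sum>j\<in>UNIV. \<Sum>b\<in>UNIV. K j b * v j * v b) = (\<Sum>j\<in>UNIV. \<Sum>b\<in>UNIV. \<Sum>i\<in>UNIV. \<Sum>a\<in>UNIV. ginv x $ i $ a * (?s i j * v j) * (?s a b * v b))"
      by (simp add: K_def sum_distrib_right sum_distrib_left mult_ac)
    also have "\<dots> = (\<Sum>j\<in>UNIV. \<Sum>i\<in>UNIV. \<Sum>b\<in>UNIV. \<Sum>a\<in>UNIV. ginv x $ i $ a * (?s i j * v j) * (?s a b * v b))"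
      by (intro sum.cong refl sum.swap)
    also have "\<dots> = (\<Sum>i\<in>UNIV. \<Sum>j\<in>UNIV. \<Sum>b\<in>UNIV. \<Sum>a\<in>UNIV. ginv x $ i $ a * (?s i j * v j) * (?s a b * v b))"
      by (rule sum.swap)
    also have "\<dots> = (\<Sum>i\<in>UNIV. \<Sum>j\<in>UNIV. \<Sum>a\<in>UNIV. \<Sum>b\<in>UNIV. ginv x $ i $ a * (?s i j * v j) * (?s a b * v b))"
      by (intro sum.cong refl sum.swap)
    also have "\<dots> = (\<Sum>i\<in>UNIV. \<Sum>a\<in>UNIV. \<Sum>j\<in>UNIV. \<Sum>b\<in>UNIV. ginv x $ i $ a * (?s i j * v j) * (?s a b * v b))"
      by (intro sum.cong refl sum.swap)
    also have "\<dots> = (\<Sum>i\<in>UNIV. \<Sum>a\<in>UNIV. ginv x $ i $ a * u i * u a)"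
    proof -
      have "u i * u a = (\<Sum>j\<in>UNIV. \<Sum>b\<in>UNIV. (?s i j * v j) * (?s a b * v b))" for i a
        unfolding u_def by (rule sum_product)
      then show ?thesis by (simp add: mult.assoc sum_distrib_left)
    qed
    also have "\<dots> \<ge> 0" by (rule ginv_psd[OF x])
    finally show "0 \<le> (\<Sum>j\<in>UNIV. \<Sum>b\<in>UNIV. K j b * v j * v b)" .
  qed
  also have "\<dots> = (\<Sum>j\<in>UNIV. \<Sum>b\<in>UNIV. \<Sum>i\<in>UNIV. \<Sum>a\<in>UNIV. ginv x $ j $ b * (ginv x $ i $ a * ?s i j * ?s a b))"
    by (simp add: K_def sum_distrib_left)
  also have "\<dots> = (\<Sum>j\<in>UNIV. \<Sum>i\<in>UNIV. \<Sum>b\<in>UNIV. \<Sum>a\<in>UNIV. ginv x $ j $ b * (ginv x $ i $ a * ?s i j * ?s a b))"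
    by (intro sum.cong refl sum.swap)
  also have "\<dots> = (\<Sum>i\<in>UNIV. \<Sum>j\<in>UNIV. \<Sum>b\<in>UNIV. \<Sum>a\<in>UNIV. ginv x $ j $ b * (ginv x $ i $ a * ?s i j * ?s a b))"
    by (rule sum.swap)
  also have "\<dots> = (\<Sum>i\<in>UNIV. \<Sum>j\<in>UNIV. \<Sum>a\<in>UNIV. \<Sum>b\<in>UNIV. ginv x $ j $ b * (ginv x $ i $ a * ?s i j * ?s a b))"
    by (intro sum.cong refl sum.swap)
  also have "\<dots> = stress_norm2 x"
    by (simp add: stress_norm2_def raise2_def sum_distrib_right sum_distrib_left mult_ac)
  finally show ?thesis .
qed

text \<open>Half of \<open>|N + N\<^sup>T|\<^sup>2\<close> is \<open>|N|\<^sup>2\<close> plus the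
  pairing of \<open>N\<close> with its transpose. In mixed components the metric drops out of that
  pairing, which is the form in which it also arises from \<open>div_cov_along\<close>.\<close>

lemma norm2_cov_stress:
  assumes x: "x \<in> V"
  shows "stress_norm2 x / 2 = norm2_cov G X x + (\<Sum>i\<in>UNIV. \<Sum>k\<in>UNIV. cov_vec G X x i k * cov_vec G X x k i)"
proof -
  let ?N = "cov_covec G (lower G X) x"
  let ?R = "raise2 G (cov_covec G (lower G X)) x"
  let ?M = "cov_vec G X x"
  have R: "raise2 G (stress G X) x i j = ?R i j + ?R j i" for i j
  proof -
    have "(\<Sum>a\<in>UNIV. \<Sum>b\<in>UNIV. ginv x $ i $ a * ginv x $ j $ b * ?N b a) = ?R j i"
      unfolding raise2_def by (subst sum.swap) (simp add: mult_ac)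
    then show ?thesis
      by (simp add: raise2_def stress_def distrib_left sum.distrib)
  qed
  \<comment> \<open>Raising the second index undoes the lowering of \<open>X\<close>, so only the
    derivative index still carries an inverse metric.\<close>
  have up: "?R j i = (\<Sum>a\<in>UNIV. ginv x $ j $ a * ?M a i)" for i j
  proof -
    have "?R j i = (\<Sum>a\<in>UNIV. ginv x $ j $ a * (\<Sum>b\<in>UNIV. \<Sum>c\<in>UNIV. ginv x $ i $ b * G x $ b $ c * ?M a c))"
      by (simp add: raise2_def cov_covec_lower[OF x] sum_distrib_left mult_ac)
    also have "(\<lambda>a. \<Sum>b\<in>UNIV. \<Sum>c\<in>UNIV. ginv x $ i $ b * G x $ b $ c * ?M a c) = (\<lambda>a. \<Sum>c\<in>UNIV. (\<Sum>b\<in>UNIV. ginv x $ i $ b * G x $ b $ c) * ?M a c)"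
      by (subst sum.swap) (simp add: sum_distrib_right)
    also have "\<dots> = (\<lambda>a. ?M a i)"
      by (simp add: sum_ginv_G[OF x] if_distribR if_distrib cong: if_cong)
    finally show ?thesis .
  qed
  have NR: "(\<Sum>i\<in>UNIV. \<Sum>j\<in>UNIV. ?N i j * ?R j i) = (\<Sum>i\<in>UNIV. \<Sum>k\<in>UNIV. ?M i k * ?M k i)"
  proof (rule sum.cong[OF refl])
    fix i
    have "(\<Sum>j\<in>UNIV. ?N i j * ?R j i) = (\<Sum>j\<in>UNIV. \<Sum>k\<in>UNIV. \<Sum>a\<in>UNIV. (G x $ k $ j * ginv x $ j $ a) * (?M i k * ?M a i))"
      by (simp add: up cov_covec_lower[OF x] sum_product G_commute[OF x] mult_ac)
    also have "\<dots> = (\<Sum>k\<in>UNIV. \<Sum>j\<in>UNIV. \<Sum>a\<in>UNIV. (G x $ k $ j * ginv x $ j $ a) * (?M i k * ?M a i))"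
      by (rule sum.swap)
    also have "\<dots> = (\<Sum>k\<in>UNIV. \<Sum>a\<in>UNIV. \<Sum>j\<in>UNIV. (G x $ k $ j * ginv x $ j $ a) * (?M i k * ?M a i))"
      by (intro sum.cong refl sum.swap)
    also have "\<dots> = (\<Sum>k\<in>UNIV. \<Sum>a\<in>UNIV. (if k = a then 1 else 0) * (?M i k * ?M a i))"
      by (simp only: sum_distrib_right[symmetric] sum_G_ginv[OF x])
    also have "\<dots> = (\<Sum>k\<in>UNIV. ?M i k * ?M k i)"
      by (simp add: if_distribR if_distrib cong: if_cong)
    finally show "(\<Sum>j\<in>UNIV. ?N i j * ?R j i) = (\<Sum>k\<in>UNIV. ?M i k * ?M k i)" .
  qed
  have sw: "(\<Sum>i\<in>UNIV. \<Sum>j\<in>UNIV. ?N j i * f i j) = (\<Sum>i\<in>UNIV. \<Sum>j\<in>UNIV. ?N i j * f j i)" for f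
    by (rule sum.swap)
  have "stress_norm2 x = (\<Sum>i\<in>UNIV. \<Sum>j\<in>UNIV. ?N i j * (?R i j + ?R j i)) + (\<Sum>i\<in>UNIV. \<Sum>j\<in>UNIV. ?N j i * (?R i j + ?R j i))"
    unfolding stress_norm2_def R by (simp add: stress_def distrib_left sum.distrib mult.commute)
  also have "\<dots> = 2 * (\<Sum>i\<in>UNIV. \<Sum>j\<in>UNIV. ?N i j * (?R i j + ?R j i))"
    by (simp add: sw[of "\<lambda>i j. ?R i j + ?R j i"] add.commute)
  also have "(\<Sum>i\<in>UNIV. \<Sum>j\<in>UNIV. ?N i j * (?R i j + ?R j i)) = norm2_cov G X x + (\<Sum>i\<in>UNIV. \<Sum>k\<in>UNIV. ?M i k * ?M k i)"
    by (simp add: norm2_cov_def distrib_left sum.distrib NR)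
  finally show ?thesis by simp
qed

text \<open>In \<open>\<nabla>\<^sub>i (X\<^sup>j \<nabla>\<^sub>j X\<^sup>i)\<close> the
  derivatives on the second factor are exchanged to reach \<open>\<nabla>\<^sub>j (div X)\<close>,
  at the cost of the Ricci term. The divergence is assumed to vanish on all of \<open>V\<close>
  because its derivative is used.\<close>

lemma div_cov_along:
  assumes x: "x \<in> V" and div: "\<And>y. y \<in> V \<Longrightarrow> div_vec G X y = 0"
  shows "div_vec G (cov_along G X X) x =
     (\<Sum>i\<in>UNIV. \<Sum>k\<in>UNIV. cov_vec G X x i k * cov_vec G X x k i) + ricci_quad G X x"
proof -
  let ?M = "cov_vec G X x"
  let ?X = "\<lambda>i. X x $ i"
  let ?D = "\<lambda>i j. pd i (\<lambda>y. X y $ j) x"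
  let ?C = "chris x"
  have dif [intro]: "(\<lambda>y. cov_vec G X y i j) differentiable (at x)" "(\<lambda>y. X y $ i) differentiable (at x)"
    "(\<lambda>y. chris y k i j) differentiable (at x)" for i j k
    by (intro differentiable_smooth[OF _ x] smooth_cov_vec smooth_X_nth smooth_chris)+
  have pdV: "pd i (\<lambda>y. cov_along G X X y $ i) x = (\<Sum>j\<in>UNIV. ?D i j * ?M j i + ?X j * pd i (\<lambda>y. cov_vec G X y j i) x)" for i
    unfolding cov_along_def vec_lambda_beta
    by (subst pd_sum) (auto intro!: sum.cong pd_mult differentiable_mult)
  have pdM: "pd i (\<lambda>y. cov_vec G X y j i) x = pd i (pd j (\<lambda>y. X y $ i)) x + (\<Sum>k\<in>UNIV. pd i (\<lambda>y. chris y i j k) x * ?X k + ?C i j k * ?D i k)" for i j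
    unfolding cov_vec_def
    apply (subst pd_add)
      apply (intro differentiable_smooth[OF _ x] smooth_on_pd smooth_X_nth open_V)
     apply (intro differentiable_smooth[OF _ x] smooth_on_sum smooth_on_mult smooth_chris smooth_X_nth open_V)
    apply (subst pd_sum)
     apply (intro differentiable_smooth[OF _ x] smooth_on_sum smooth_on_mult smooth_chris smooth_X_nth open_V)
    by (simp add: pd_mult dif)
  \<comment> \<open>Differentiating \<open>div X = 0\<close> trades the only second derivatives of
    \<open>X\<close> for terms of lower order.\<close>
  have pd_div: "(\<Sum>i\<in>UNIV. pd j (pd i (\<lambda>y. X y $ i)) x) = - (\<Sum>i\<in>UNIV. \<Sum>k\<in>UNIV. pd j (\<lambda>y. chris y i i k) x * ?X k + ?C i i k * ?D j k)" for j
  proof -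
    have "pd j (\<lambda>y. div_vec G X y) x = pd j (\<lambda>y. 0) x"
      by (rule pd_cong[OF open_V x differentiable_smooth[OF smooth_div_vec x] div])
    then have "0 = pd j (\<lambda>y. \<Sum>i\<in>UNIV. cov_vec G X y i i) x"
      by (simp add: pd_const div_vec_def)
    also have "\<dots> = (\<Sum>i\<in>UNIV. pd j (\<lambda>y. cov_vec G X y i i) x)"
      by (rule pd_sum) auto
    also have "\<dots> = (\<Sum>i\<in>UNIV. pd j (pd i (\<lambda>y. X y $ i)) x + (\<Sum>k\<in>UNIV. pd j (\<lambda>y. chris y i i k) x * ?X k + ?C i i k * ?D j k))"
      unfolding cov_vec_def
      apply (intro sum.cong refl)
      apply (subst pd_add)
        apply (intro differentiable_smooth[OF _ x] smooth_on_pd smooth_X_nth open_V)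
       apply (intro differentiable_smooth[OF _ x] smooth_on_sum smooth_on_mult smooth_chris smooth_X_nth open_V)
      apply (subst pd_sum)
       apply (intro differentiable_smooth[OF _ x] smooth_on_sum smooth_on_mult smooth_chris smooth_X_nth open_V)
      by (simp add: pd_mult dif)
    finally show ?thesis by (simp add: sum.distrib)
  qed
  \<comment> \<open>\<open>A1\<close> and \<open>A4\<close> carry first derivatives of
    \<open>X\<close>; \<open>A2\<close>, \<open>A3\<close>, \<open>A6\<close>, \<open>A7\<close>
    are, up to sign, the four parts of Ricci. \<open>A5\<close> cancels between
    \<open>second\<close> and the Christoffel part of the outer divergence. \<open>A7\<close> is
    absent from the left-hand side and cancels between the trace and Ricci.\<close>
  define A1 where "A1 = (\<Sum>i\<in>UNIV. \<Sum>j\<in>UNIV. ?D i j * ?M j i)"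
  define A2 where "A2 = (\<Sum>j\<in>UNIV. \<Sum>i\<in>UNIV. \<Sum>k\<in>UNIV. ?X j * ?X k * pd i (\<lambda>y. chris y i j k) x)"
  define A3 where "A3 = (\<Sum>j\<in>UNIV. \<Sum>i\<in>UNIV. \<Sum>k\<in>UNIV. ?X j * ?X k * pd j (\<lambda>y. chris y i i k) x)"
  define A4 where "A4 = (\<Sum>i\<in>UNIV. \<Sum>j\<in>UNIV. \<Sum>k\<in>UNIV. ?X j * ?C i j k * ?D i k)"
  define A5 where "A5 = (\<Sum>j\<in>UNIV. \<Sum>i\<in>UNIV. \<Sum>k\<in>UNIV. ?X j * ?C i i k * ?D j k)"
  define A6 where "A6 = (\<Sum>i\<in>UNIV. \<Sum>k\<in>UNIV. \<Sum>j\<in>UNIV. \<Sum>l\<in>UNIV. ?X j * ?C i i k * (?C k j l * ?X l))"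
  define A7 where "A7 = (\<Sum>i\<in>UNIV. \<Sum>j\<in>UNIV. \<Sum>k\<in>UNIV. \<Sum>l\<in>UNIV. ?C j i k * ?X k * (?C i j l * ?X l))"
  have second: "(\<Sum>i\<in>UNIV. \<Sum>j\<in>UNIV. ?X j * pd i (pd j (\<lambda>y. X y $ i)) x) = - A3 - A5"
  proof -
    have "(\<Sum>i\<in>UNIV. \<Sum>j\<in>UNIV. ?X j * pd i (pd j (\<lambda>y. X y $ i)) x) = (\<Sum>j\<in>UNIV. ?X j * (\<Sum>i\<in>UNIV. pd j (pd i (\<lambda>y. X y $ i)) x))"
      by (subst sum.swap) (simp add: sum_distrib_left pd_commute[OF open_V x smooth_X_nth, of _ _ _])
    also have "\<dots> = - A3 - A5"
      unfolding pd_div A3_def A5_def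
      by (simp add: sum_distrib_left sum.distrib sum_negf sum_subtractf distrib_left right_diff_distrib mult_ac)
    finally show ?thesis .
  qed
  have "div_vec G (cov_along G X X) x =
     (\<Sum>i\<in>UNIV. pd i (\<lambda>y. cov_along G X X y $ i) x) + (\<Sum>i\<in>UNIV. \<Sum>k\<in>UNIV. ?C i i k * cov_along G X X x $ k)"
    by (simp add: div_vec_def cov_vec_def sum.distrib)
  also have "(\<Sum>i\<in>UNIV. pd i (\<lambda>y. cov_along G X X y $ i) x) = A1 + ((\<Sum>i\<in>UNIV. \<Sum>j\<in>UNIV. ?X j * pd i (pd j (\<lambda>y. X y $ i)) x) +
      (\<Sum>i\<in>UNIV. \<Sum>j\<in>UNIV. \<Sum>k\<in>UNIV. ?X j * ?X k * pd i (\<lambda>y. chris y i j k) x) + A4)"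
    unfolding pdV pdM A1_def A4_def by (simp add: sum.distrib distrib_left sum_distrib_left mult_ac)
  also have "(\<Sum>i\<in>UNIV. \<Sum>j\<in>UNIV. \<Sum>k\<in>UNIV. ?X j * ?X k * pd i (\<lambda>y. chris y i j k) x) = A2"
    unfolding A2_def by (rule sum.swap)
  also have "(\<Sum>i\<in>UNIV. \<Sum>k\<in>UNIV. ?C i i k * cov_along G X X x $ k) = (\<Sum>i\<in>UNIV. \<Sum>k\<in>UNIV. \<Sum>j\<in>UNIV. ?X j * ?C i i k * ?D j k) + A6"
    unfolding A6_def by (simp add: cov_along_def cov_vec_def sum_distrib_left distrib_left sum.distrib mult_ac)
  also have "(\<Sum>i\<in>UNIV. \<Sum>k\<in>UNIV. \<Sum>j\<in>UNIV. ?X j * ?C i i k * ?D j k) = A5"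
  proof -
    have "(\<Sum>i\<in>UNIV. \<Sum>k\<in>UNIV. \<Sum>j\<in>UNIV. ?X j * ?C i i k * ?D j k) = (\<Sum>i\<in>UNIV. \<Sum>j\<in>UNIV. \<Sum>k\<in>UNIV. ?X j * ?C i i k * ?D j k)"
      by (intro sum.cong refl sum.swap)
    also have "\<dots> = A5" unfolding A5_def by (rule sum.swap)
    finally show ?thesis .
  qed
  finally have L: "div_vec G (cov_along G X X) x = A1 + A2 - A3 + A4 + A6"
    unfolding second by simp
  have "(\<Sum>i\<in>UNIV. \<Sum>k\<in>UNIV. ?M i k * ?M k i) = A1 + (\<Sum>i\<in>UNIV. \<Sum>j\<in>UNIV. \<Sum>k\<in>UNIV. ?C j i k * ?X k * ?M j i)"
  proof -
    have "?M i k * ?M k i = ?D i k * ?M k i + (\<Sum>l\<in>UNIV. ?C k i l * ?X l * ?M k i)" for i k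
      by (subst (1) cov_vec_def) (simp add: distrib_right sum_distrib_right)
    then show ?thesis unfolding A1_def by (simp only: sum.distrib)
  qed
  also have "(\<Sum>i\<in>UNIV. \<Sum>j\<in>UNIV. \<Sum>k\<in>UNIV. ?C j i k * ?X k * ?M j i) = (\<Sum>i\<in>UNIV. \<Sum>j\<in>UNIV. \<Sum>k\<in>UNIV. ?C j i k * ?X k * ?D j i) + A7"
    unfolding A7_def by (simp add: cov_vec_def distrib_left sum.distrib sum_distrib_left)
  also have "(\<Sum>i\<in>UNIV. \<Sum>j\<in>UNIV. \<Sum>k\<in>UNIV. ?C j i k * ?X k * ?D j i) = A4"
  proof -
    have "(\<Sum>i\<in>UNIV. \<Sum>j\<in>UNIV. \<Sum>k\<in>UNIV. ?C j i k * ?X k * ?D j i) = (\<Sum>j\<in>UNIV. \<Sum>i\<in>UNIV. \<Sum>k\<in>UNIV. ?C j i k * ?X k * ?D j i)"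
      by (rule sum.swap)
    also have "\<dots> = (\<Sum>j\<in>UNIV. \<Sum>k\<in>UNIV. \<Sum>i\<in>UNIV. ?C j i k * ?X k * ?D j i)"
      by (intro sum.cong refl sum.swap)
    also have "\<dots> = A4" unfolding A4_def by (intro sum.cong refl) (simp add: chris_commute[OF x] mult_ac)
    finally show ?thesis .
  qed
  finally have M: "(\<Sum>i\<in>UNIV. \<Sum>k\<in>UNIV. ?M i k * ?M k i) = A1 + A4 + A7" by simp
  have R: "ricci_quad G X x = A2 - A3 + A6 - A7"
  proof -
    have "ricci_quad G X x = (\<Sum>j\<in>UNIV. \<Sum>k\<in>UNIV. \<Sum>i\<in>UNIV. ?X j * ?X k * pd i (\<lambda>y. chris y i j k) x)
       - (\<Sum>j\<in>UNIV. \<Sum>k\<in>UNIV. \<Sum>i\<in>UNIV. ?X j * ?X k * pd j (\<lambda>y. chris y i i k) x)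
       + (\<Sum>j\<in>UNIV. \<Sum>k\<in>UNIV. \<Sum>i\<in>UNIV. \<Sum>p\<in>UNIV. ?X j * ?C i i p * (?C p j k * ?X k))
       - (\<Sum>j\<in>UNIV. \<Sum>k\<in>UNIV. \<Sum>i\<in>UNIV. \<Sum>p\<in>UNIV. ?C p i k * ?X k * (?C i p j * ?X j))"
      by (simp add: ricci_quad_def ricci_def sum_distrib_right sum_distrib_left sum.distrib sum_subtractf distrib_left right_diff_distrib distrib_right left_diff_distrib mult_ac chris_commute[OF x])
    also have "(\<Sum>j\<in>UNIV. \<Sum>k\<in>UNIV. \<Sum>i\<in>UNIV. ?X j * ?X k * pd i (\<lambda>y. chris y i j k) x) = A2"
      unfolding A2_def by (intro sum.cong refl sum.swap)
    also have "(\<Sum>j\<in>UNIV. \<Sum>k\<in>UNIV. \<Sum>i\<in>UNIV. ?X j * ?X k * pd j (\<lambda>y. chris y i i k) x) = A3"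
      unfolding A3_def by (intro sum.cong refl sum.swap)
    also have "(\<Sum>j\<in>UNIV. \<Sum>k\<in>UNIV. \<Sum>i\<in>UNIV. \<Sum>p\<in>UNIV. ?X j * ?C i i p * (?C p j k * ?X k)) = A6"
      (is "?l = _")
    proof -
      have "?l = (\<Sum>j\<in>UNIV. \<Sum>i\<in>UNIV. \<Sum>k\<in>UNIV. \<Sum>p\<in>UNIV. ?X j * ?C i i p * (?C p j k * ?X k))"
        by (intro sum.cong refl sum.swap)
      also have "\<dots> = (\<Sum>i\<in>UNIV. \<Sum>j\<in>UNIV. \<Sum>k\<in>UNIV. \<Sum>p\<in>UNIV. ?X j * ?C i i p * (?C p j k * ?X k))"
        by (rule sum.swap)
      also have "\<dots> = (\<Sum>i\<in>UNIV. \<Sum>j\<in>UNIV. \<Sum>p\<in>UNIV. \<Sum>k\<in>UNIV. ?X j * ?C i i p * (?C p j k * ?X k))"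
        by (intro sum.cong refl sum.swap)
      also have "\<dots> = A6" unfolding A6_def by (intro sum.cong refl sum.swap)
      finally show ?thesis .
    qed
    also have "(\<Sum>j\<in>UNIV. \<Sum>k\<in>UNIV. \<Sum>i\<in>UNIV. \<Sum>p\<in>UNIV. ?C p i k * ?X k * (?C i p j * ?X j)) = A7"
      (is "?l = _")
    proof -
      have "?l = (\<Sum>k\<in>UNIV. \<Sum>j\<in>UNIV. \<Sum>i\<in>UNIV. \<Sum>p\<in>UNIV. ?C p i k * ?X k * (?C i p j * ?X j))"
        by (rule sum.swap)
      also have "\<dots> = (\<Sum>k\<in>UNIV. \<Sum>i\<in>UNIV. \<Sum>j\<in>UNIV. \<Sum>p\<in>UNIV. ?C p i k * ?X k * (?C i p j * ?X j))"
        by (intro sum.cong refl sum.swap)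
      also have "\<dots> = (\<Sum>i\<in>UNIV. \<Sum>k\<in>UNIV. \<Sum>j\<in>UNIV. \<Sum>p\<in>UNIV. ?C p i k * ?X k * (?C i p j * ?X j))"
        by (rule sum.swap)
      also have "\<dots> = (\<Sum>i\<in>UNIV. \<Sum>k\<in>UNIV. \<Sum>p\<in>UNIV. \<Sum>j\<in>UNIV. ?C p i k * ?X k * (?C i p j * ?X j))"
        by (intro sum.cong refl sum.swap)
      also have "\<dots> = A7" unfolding A7_def by (intro sum.cong refl sum.swap)
      finally show ?thesis .
    qed
    finally show ?thesis .
  qed
  show ?thesis using L M R by simp
qed

lemma energy_density_eq:
  assumes x: "x \<in> V" and div: "\<And>y. y \<in> V \<Longrightarrow> div_vec G X y = 0"
  shows "norm2_cov G X x + \<bar>div_vec G X x\<bar>\<^sup>2 - ricci_quad G X x =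
     stress_norm2 x / 2 - div_vec G (cov_along G X X) x"
proof -
  have "\<bar>div_vec G X x\<bar>\<^sup>2 = 0" using div[OF x] by simp
  then show ?thesis using norm2_cov_stress[OF x] div_cov_along[OF x div] by linarith
qed

lemma div_norm2_X:
  assumes x: "x \<in> V"
  shows "div_vec G (\<lambda>y. norm2_vec G X y *\<^sub>R X y) x = (\<Sum>i\<in>UNIV. X x $ i * pd i (norm2_vec G X) x) + norm2_vec G X x * div_vec G X x"
proof -
  have "pd i (\<lambda>y. (norm2_vec G X y *\<^sub>R X y) $ i) x = pd i (norm2_vec G X) x * X x $ i + norm2_vec G X x * pd i (\<lambda>y. X y $ i) x" for i
    by (simp add: pd_mult[OF differentiable_smooth[OF smooth_norm2_vec x] differentiable_smooth[OF smooth_X_nth x]])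
  then show ?thesis
    by (simp add: div_vec_def cov_vec_def sum.distrib distrib_left sum_distrib_left mult_ac)
qed

end

end

section \<open>Integration over open subsets of Euclidean space\<close>

text \<open>\<open>V\<close> and the complement of \<open>K\<close> form an open cover; on the first
  the extension is \<open>f\<close>, on the second it is constantly 0. The smooth version below uses
  the same cover.\<close>

lemma continuous_on_extend_zero:
  fixes f :: "'a::euclidean_space \<Rightarrow> real"
  assumes "open V" "compact K" "K \<subseteq> V" "continuous_on V f" "\<And>x. x \<in> V - K \<Longrightarrow> f x = 0"
  shows "continuous_on UNIV (\<lambda>x. if x \<in> V then f x else 0)"
proof -
  have "continuous_on (V \<union> - K) (\<lambda>x. if x \<in> V then f x else 0)"
  proof (rule continuous_on_open_Un)
    show "continuous_on V (\<lambda>x. if x \<in> V then f x else 0)"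
      using assms(4) by (rule continuous_on_eq) auto
    show "continuous_on (- K) (\<lambda>x. if x \<in> V then f x else 0)"
      by (rule continuous_on_eq[OF continuous_on_const[of _ 0]]) (use assms in auto)
  qed (use assms in \<open>auto intro: compact_imp_closed\<close>)
  moreover have "V \<union> - K = UNIV" using assms(3) by auto
  ultimately show ?thesis by simp
qed

lemma smooth_on_extend_zero:
  fixes f :: "'a::euclidean_space \<Rightarrow> real"
  assumes "open V" "compact K" "K \<subseteq> V" "smooth_on V f" "\<And>x. x \<in> V - K \<Longrightarrow> f x = 0"
  shows "smooth_on UNIV (\<lambda>x. if x \<in> V then f x else 0)"
proof (rule smooth_on_local[OF open_UNIV])
  fix x
  have op: "open (- K)" by (intro open_Compl compact_imp_closed assms(2))
  show "\<exists>U. open U \<and> x \<in> U \<and> smooth_on U (\<lambda>x. if x \<in> V then f x else 0)"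
  proof (cases "x \<in> V")
    case True
    have "smooth_on V (\<lambda>x. if x \<in> V then f x else 0)"
      by (rule smooth_on_cong[OF assms(1,4)]) simp
    then show ?thesis using True assms(1) by blast
  next
    case False
    have "smooth_on (- K) (\<lambda>x. if x \<in> V then f x else 0)"
      by (rule smooth_on_cong[OF op smooth_on_const[OF op, of 0]]) (use assms(5) in auto)
    then show ?thesis using False assms(3) op by blast
  qed
qed

lemma set_lborel_integral_extend_zero:
  "(LINT x:V|lborel. f x) = (LINT x|lborel. (if x \<in> V then f x else (0::real)))"
  unfolding set_lebesgue_integral_def
  by (intro Bochner_Integration.integral_cong refl) (auto simp: indicator_def)

lemma lborel_integral_eq_integral_cbox:
  fixes f :: "'a::euclidean_space \<Rightarrow> real"
  assumes "continuous_on (cbox a b) f" "\<And>x. x \<notin> cbox a b \<Longrightarrow> f x = 0"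
  shows "integrable lborel f" "(LINT x|lborel. f x) = integral (cbox a b) f"
proof -
  have "indicator (cbox a b) x *\<^sub>R f x = f x" for x
    using assms(2)[of x] by (cases "x \<in> cbox a b") auto
  then have eq: "(\<lambda>x. indicator (cbox a b) x *\<^sub>R f x) = f" by auto
  show int: "integrable lborel f"
    using borel_integrable_compact[OF compact_cbox assms(1)] unfolding eq .
  have z: "(\<lambda>x. if x \<in> cbox a b then f x else 0) = f" using assms(2) by auto
  have "(f has_integral (LINT x|lborel. f x)) UNIV"
    by (rule has_integral_integral_lborel[OF int])
  then have "(f has_integral (LINT x|lborel. f x)) (cbox a b)"
    using has_integral_restrict_UNIV[of "cbox a b" f] z by simp
  then show "(LINT x|lborel. f x) = integral (cbox a b) f"
    by (simp add: integral_unique)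
qed

lemma set_integrable_compact_support:
  fixes f :: "'a::euclidean_space \<Rightarrow> real"
  assumes "open V" "compact K" "K \<subseteq> V" "continuous_on V f" "\<And>x. x \<in> V - K \<Longrightarrow> f x = 0"
  shows "set_integrable lborel V f"
proof -
  have "indicator V x *\<^sub>R f x = indicator K x *\<^sub>R f x" for x
    using assms(3) assms(5)[of x] by (cases "x \<in> K"; cases "x \<in> V") auto
  then have "(\<lambda>x. indicator V x *\<^sub>R f x) = (\<lambda>x. indicator K x *\<^sub>R f x)" by auto
  then show ?thesis
    unfolding set_integrable_def
    using borel_integrable_compact[OF assms(2) continuous_on_subset[OF assms(4,3)]] by simp
qed

lemma set_integral_sum:
  fixes f :: "'i \<Rightarrow> 'a \<Rightarrow> real"
  assumes "\<And>i. i \<in> I \<Longrightarrow> set_integrable M S (f i)"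
  shows "set_integrable M S (\<lambda>x. \<Sum>i\<in>I. f i x)"
    and "(LINT x:S|M. \<Sum>i\<in>I. f i x) = (\<Sum>i\<in>I. LINT x:S|M. f i x)"
  using assms unfolding set_integrable_def set_lebesgue_integral_def
  by (simp_all add: sum_distrib_left)

text \<open>By translation invariance \<open>\<integral> f (x + t e\<^sub>i) dx\<close> does not depend on \<open>t\<close>; differentiate under the
  integral sign at \<open>t = 0\<close>.\<close>

lemma integral_pd_eq_0:
  fixes f :: "real ^ 'n::finite \<Rightarrow> real"
  assumes f: "smooth_on UNIV f" and K: "compact K" "\<And>x. x \<notin> K \<Longrightarrow> f x = 0"
  shows "(LINT x|lborel. pd i f x) = 0"
proof -
  let ?e = "axis i 1 :: real ^ 'n"
  obtain r where r: "\<And>x. x \<in> K \<Longrightarrow> norm x \<le> r" "r > 0"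
    using compact_imp_bounded[OF K(1)] bounded_pos by blast
  \<comment> \<open>The margin 1 around the ball containing \<open>K\<close> keeps the translated
    supports inside one fixed box for all \<open>\<bar>t\<bar> \<le> 1\<close>.\<close>
  obtain a b where ab: "cball (0 :: real ^ 'n) (r + 1) \<subseteq> cbox a b"
    using bounded_cball[THEN bounded_subset_cbox_symmetric] by metis
  have out: "f (x + t *\<^sub>R ?e) = 0" if "x \<notin> cbox a b" "\<bar>t\<bar> \<le> 1" for x t
  proof (rule K(2))
    have "norm x > r + 1" using that(1) ab by (force simp: not_le[symmetric])
    moreover have "norm x \<le> norm (x + t *\<^sub>R ?e) + \<bar>t\<bar>"
      using norm_triangle_ineq4[of "x + t *\<^sub>R ?e" "t *\<^sub>R ?e"] by simp
    ultimately show "x + t *\<^sub>R ?e \<notin> K" using r(1)[of "x + t *\<^sub>R ?e"] that(2) by auto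
  qed
  have cf: "continuous_on UNIV f" by (rule smooth_on_imp_continuous_on[OF open_UNIV f])
  have cp: "continuous_on UNIV (pd i f)"
    by (intro smooth_on_imp_continuous_on[OF open_UNIV] smooth_on_pd f open_UNIV)
  have df: "f differentiable (at x)" for x by (rule smooth_on_imp_differentiable[OF open_UNIV f]) simp
  define F where "F t = integral (cbox a b) (\<lambda>x. f (x + t *\<^sub>R ?e))" for t :: real
  have cft: "continuous_on S (\<lambda>x. f (x + t *\<^sub>R ?e))" for S t
    by (rule continuous_on_compose2[OF cf]) (auto intro!: continuous_intros)
  have "(F has_field_derivative integral (cbox a b) (\<lambda>x. pd i f (x + 0 *\<^sub>R ?e))) (at 0 within {-1..1})"
    unfolding F_def
  proof (rule leibniz_rule_field_derivative)
    show "((\<lambda>t. f (x + t *\<^sub>R ?e)) has_field_derivative pd i f (x + t *\<^sub>R ?e)) (at t within {-1..1})" for t x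
      unfolding pd_def by (rule has_field_derivative_at_within[OF has_field_derivative_along[OF df]])
    show "(\<lambda>x. f (x + t *\<^sub>R ?e)) integrable_on cbox a b" for t
      by (rule integrable_continuous[OF cft])
    show "continuous_on ({-1..1} \<times> cbox a b) (\<lambda>(t, x). pd i f (x + t *\<^sub>R ?e))"
      unfolding split_beta
      by (rule continuous_on_compose2[OF cp]) (auto intro!: continuous_intros)
  qed auto
  then have "(F has_field_derivative integral (cbox a b) (pd i f)) (at 0 within {-1..1})" by simp
  then have 1: "(F has_field_derivative integral (cbox a b) (pd i f)) (at 0)"
  proof -
    have "at 0 within {-1..1} = at (0::real)" by (rule at_within_interior) simp
    then show ?thesis using \<open>(F has_field_derivative integral (cbox a b) (pd i f)) (at 0 within {-1..1})\<close> by simp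
  qed
  have F: "F t = (LINT x|lborel. f x)" if "\<bar>t\<bar> \<le> 1" for t
  proof -
    have "F t = (LINT x|lborel. f (x + t *\<^sub>R ?e))"
      unfolding F_def using lborel_integral_eq_integral_cbox(2)[OF cft, of a b t] out that by simp
    also have "\<dots> = (LINT x|distr lborel borel ((+) (t *\<^sub>R ?e)). f x)"
      using cf by (subst integral_distr) (auto intro: borel_measurable_continuous_onI simp: add.commute)
    finally show ?thesis by (simp add: lborel_distr_plus)
  qed
  have "(F has_field_derivative 0) (at 0)"
    by (rule has_field_derivative_transform_within_open[where S = "{-1<..<1}", OF DERIV_const[of "LINT x|lborel. f x"]])
      (auto simp: F)
  with 1 have "integral (cbox a b) (pd i f) = 0" by (rule DERIV_unique)
  moreover have "pd i f x = 0" if "x \<notin> cbox a b" for x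
  proof -
    have "x \<notin> K" using r(1)[of x] ab that by (auto simp: subset_iff)
    then have "pd i f x = pd i (\<lambda>y. 0) x"
      by (intro pd_cong[of "- K", OF _ _ df]) (auto simp: K compact_imp_closed)
    then show ?thesis by (simp add: pd_const)
  qed
  ultimately show ?thesis
    using lborel_integral_eq_integral_cbox(2)[of a b "pd i f"] continuous_on_subset[OF cp] by simp
qed

lemma set_integral_pd_eq_0:
  fixes f :: "real ^ 'n::finite \<Rightarrow> real"
  assumes "open V" "compact K" "K \<subseteq> V" "smooth_on V f" "\<And>x. x \<in> V - K \<Longrightarrow> f x = 0"
  shows "(LINT x:V|lborel. pd i f x) = 0"
proof -
  let ?f = "\<lambda>x. if x \<in> V then f x else 0"
  have sm: "smooth_on UNIV ?f" by (rule smooth_on_extend_zero[OF assms])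
  have df: "?f differentiable (at x)" for x by (rule smooth_on_imp_differentiable[OF open_UNIV sm]) simp
  have "(if x \<in> V then pd i f x else 0) = pd i ?f x" for x
  proof (cases "x \<in> V")
    case True
    have "pd i ?f x = pd i f x" by (rule pd_cong[OF assms(1) True df]) simp
    then show ?thesis using True by simp
  next
    case False
    have "pd i ?f x = pd i (\<lambda>y. 0) x"
      by (rule pd_cong[of "- K", OF _ _ df]) (use assms False in \<open>auto simp: compact_imp_closed\<close>)
    then show ?thesis using False by (simp add: pd_const)
  qed
  then show ?thesis
    unfolding set_lborel_integral_extend_zero
    using integral_pd_eq_0[OF sm assms(2)] assms(5) by simp
qed

text \<open>Extension by zero moves the integral to a fixed box around \<open>K\<close>, where the
  Leibniz rule for a convex parameter set applies; hence the derivative within \<open>I\<close>,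
  one-sided at endpoints.\<close>

lemma set_integral_has_derivative:
  fixes F F' :: "real \<Rightarrow> real ^ 'n::finite \<Rightarrow> real"
  assumes V: "open V" "compact K" "K \<subseteq> V" and I: "convex I" "t \<in> I"
    and F: "\<And>s x. s \<in> I \<Longrightarrow> x \<in> V \<Longrightarrow> ((\<lambda>s. F s x) has_field_derivative F' s x) (at s within I)"
    and cF: "\<And>s. s \<in> I \<Longrightarrow> continuous_on V (F s)"
    and cF': "continuous_on (I \<times> V) (\<lambda>(s, x). F' s x)"
    and z: "\<And>s x. s \<in> I \<Longrightarrow> x \<in> V - K \<Longrightarrow> F s x = 0" "\<And>s x. s \<in> I \<Longrightarrow> x \<in> V - K \<Longrightarrow> F' s x = 0"
  shows "((\<lambda>s. LINT x:V|lborel. F s x) has_real_derivative (LINT x:V|lborel. F' t x)) (at t within I)"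
proof -
  let ?F = "\<lambda>s x. if x \<in> V then F s x else 0" and ?F' = "\<lambda>s x. if x \<in> V then F' s x else 0"
  obtain a b where ab: "K \<subseteq> cbox a b"
    using compact_imp_bounded[OF V(2)] bounded_subset_cbox_symmetric by metis
  have out: "?F s x = 0" "?F' s x = 0" if "s \<in> I" "x \<notin> cbox a b" for s x
    using that z(1)[of s x] z(2)[of s x] ab by auto
  have cont: "continuous_on UNIV (?F s)" if "s \<in> I" for s
    by (rule continuous_on_extend_zero[OF V cF[OF that] z(1)[OF that]])
  have cont'_s: "continuous_on V (F' s)" if "s \<in> I" for s
  proof -
    have "continuous_on V (\<lambda>x. (s, x))" by (intro continuous_intros)
    from continuous_on_compose2[OF cF' this] show ?thesis using that by auto
  qed
  have cont': "continuous_on UNIV (?F' s)" if "s \<in> I" for s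
    by (rule continuous_on_extend_zero[OF V cont'_s[OF that] z(2)[OF that]])
  have d: "((\<lambda>s. integral (cbox a b) (?F s)) has_field_derivative integral (cbox a b) (?F' t)) (at t within I)"
  proof (rule leibniz_rule_field_derivative[OF _ _ _ I(2,1)])
    show "((\<lambda>s. ?F s x) has_field_derivative ?F' s x) (at s within I)" if "s \<in> I" for s x
      using F[OF that] by (cases "x \<in> V") auto
    show "?F s integrable_on cbox a b" if "s \<in> I" for s
      by (rule integrable_continuous[OF continuous_on_subset[OF cont[OF that]]]) simp
    \<comment> \<open>The two sets cover \<open>I \<times> UNIV\<close> and are open only relative
      to it, since \<open>I\<close> need not be open.\<close>
    have "continuous_on (I \<times> V \<union> I \<times> (- K)) (\<lambda>(s, x). ?F' s x)"
    proof (rule continuous_on_Un_local_open)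
      have U: "I \<times> V \<union> I \<times> (- K) = I \<times> UNIV" using V(3) by auto
      show "openin (top_of_set (I \<times> V \<union> I \<times> (- K))) (I \<times> V)"
        unfolding U openin_open using V(1) by (intro exI[of _ "UNIV \<times> V"]) (auto intro: open_Times)
      show "openin (top_of_set (I \<times> V \<union> I \<times> (- K))) (I \<times> (- K))"
        unfolding U openin_open using V(2) by (intro exI[of _ "UNIV \<times> (- K)"]) (auto intro!: open_Times compact_imp_closed)
      show "continuous_on (I \<times> V) (\<lambda>(s, x). ?F' s x)"
        by (rule continuous_on_eq[OF cF']) auto
      show "continuous_on (I \<times> (- K)) (\<lambda>(s, x). ?F' s x)"
        by (rule continuous_on_eq[OF continuous_on_const[of _ 0]]) (use z(2) in auto)
    qed
    then show "continuous_on (I \<times> cbox a b) (\<lambda>(s, x). ?F' s x)"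
      by (rule continuous_on_subset) (use V(3) in auto)
  qed
  have e: "(LINT x:V|lborel. F s x) = integral (cbox a b) (?F s)" if "s \<in> I" for s
    unfolding set_lborel_integral_extend_zero
    using lborel_integral_eq_integral_cbox(2)[OF continuous_on_subset[OF cont[OF that]] out(1)[OF that]] by simp
  have e': "integral (cbox a b) (?F' t) = (LINT x:V|lborel. F' t x)"
    unfolding set_lborel_integral_extend_zero
    using lborel_integral_eq_integral_cbox(2)[OF continuous_on_subset[OF cont'[OF I(2)]] out(2)[OF I(2)]] by simp
  show ?thesis
    using has_derivative_transform[OF I(2) e d[unfolded has_field_derivative_def e']]
    unfolding has_field_derivative_def .
qed

subsection \<open>Change of variables\<close>

text \<open>The change of variables theorem of the library requires the index type to be well-ordered. The
  type \<open>'n idx\<close> is a well-ordered copy of \<open>'n\<close>, and the theorem is transported along a bijection.\<close>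

typedef (overloaded) ('n::finite) idx = "{..<CARD('n)}"
  by (rule exI[of _ 0]) simp

setup_lifting type_definition_idx

instantiation idx :: (finite) linorder
begin
lift_definition less_eq_idx :: "'a idx \<Rightarrow> 'a idx \<Rightarrow> bool" is "(\<le>)" .
lift_definition less_idx :: "'a idx \<Rightarrow> 'a idx \<Rightarrow> bool" is "(<)" .
instance by standard (transfer, auto)+
end

instance idx :: (finite) wellorder
proof
  fix P :: "'a idx \<Rightarrow> bool" and a
  assume step: "\<And>x. (\<And>y. y < x \<Longrightarrow> P y) \<Longrightarrow> P x"
  show "P a"
    by (induction "Rep_idx a" arbitrary: a rule: less_induct) (metis step less_idx.rep_eq)
qed

instance idx :: (finite) finite
proof
  show "finite (UNIV :: 'a idx set)"
    by (subst type_definition.univ[OF type_definition_idx]) simp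
qed

lemma ex_bij_idx: "\<exists>\<beta> :: 'n::finite idx \<Rightarrow> 'n. bij \<beta>"
proof -
  obtain h :: "nat \<Rightarrow> 'n" where h: "bij_betw h {0..<CARD('n)} UNIV"
    using ex_bij_betw_nat_finite[of "UNIV :: 'n set"] by auto
  have "bij_betw (Rep_idx :: 'n idx \<Rightarrow> nat) UNIV {0..<CARD('n)}"
    unfolding bij_betw_def atLeast0LessThan
    by (simp add: inj_def Rep_idx_inject type_definition.Rep_range[OF type_definition_idx])
  from bij_betw_trans[OF this h] show ?thesis by blast
qed

text \<open>Conjugation by \<open>\<beta>\<close> is a bijection between the permutations of the two
  index types. It preserves signs, by induction over transpositions, since it maps a transposition
  to a transposition.\<close>

lemma det_reindex:
  fixes \<beta> :: "'m::finite \<Rightarrow> 'n::finite" and M :: "real ^ 'n ^ 'n"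
  assumes \<beta>: "bij \<beta>"
  shows "det (\<chi> i j. M $ \<beta> i $ \<beta> j) = det M"
proof -
  let ?c = "\<lambda>p. \<beta> \<circ> p \<circ> inv \<beta>"
  have inv: "inv \<beta> (\<beta> i) = i" "\<beta> (inv \<beta> j) = j" for i j
    using \<beta> by (auto simp: bij_is_inj bij_is_surj surj_f_inv_f)
  have sgn: "?c p permutes UNIV \<and> sign (?c p) = sign p" if "p permutes UNIV" for p
    using that finite[of UNIV]
  proof (induction rule: permutes_induct)
    case id
    have "?c id = id" using inv by auto
    then show ?case by (simp only: permutes_id sign_id)
  next
    case (swap a b p)
    have eq: "?c (Transposition.transpose a b \<circ> p) = Transposition.transpose (\<beta> a) (\<beta> b) \<circ> ?c p"
    proof
      fix z
      show "?c (Transposition.transpose a b \<circ> p) z = (Transposition.transpose (\<beta> a) (\<beta> b) \<circ> ?c p) z"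
        using \<beta> by (auto simp: Transposition.transpose_def bij_def inj_eq)
    qed
    have pa: "permutation p" "permutation (?c p)"
      using swap permutation_permutes finite[of UNIV] by blast+
    have ne: "\<beta> a \<noteq> \<beta> b" using swap \<beta> by (auto simp: bij_def inj_eq)
    have "sign (Transposition.transpose (\<beta> a) (\<beta> b) \<circ> ?c p) = sign (Transposition.transpose a b \<circ> p)"
      using swap ne by (simp only: sign_compose[OF permutation_swap_id pa(1)] sign_compose[OF permutation_swap_id pa(2)] sign_swap_id if_False)
    moreover have "Transposition.transpose (\<beta> a) (\<beta> b) \<circ> ?c p permutes UNIV"
      using swap by (blast intro: permutes_compose permutes_swap_id)
    ultimately show ?case unfolding eq by blast
  qed
  have bij: "bij_betw ?c {p. p permutes UNIV} {p. p permutes UNIV}"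
  proof (rule bij_betw_byWitness[where f' = "\<lambda>q. inv \<beta> \<circ> q \<circ> \<beta>"])
    show "(\<lambda>q. inv \<beta> \<circ> q \<circ> \<beta>) ` {p. p permutes UNIV} \<subseteq> {p. p permutes UNIV}"
      using \<beta> by (auto simp: permutes_univ bij_is_inj intro!: bij_comp bij_imp_bij_inv simp flip: bij_iff)
  qed (use sgn inv in \<open>auto simp: fun_eq_iff\<close>)
  have "det M = (\<Sum>p\<in>{p. p permutes UNIV}. of_int (sign (?c p)) * (\<Prod>i\<in>UNIV. M $ i $ ?c p i))"
    unfolding det_def by (rule sum.reindex_bij_betw[OF bij, symmetric])
  also have "\<dots> = (\<Sum>p\<in>{p. p permutes UNIV}. of_int (sign p) * (\<Prod>i\<in>UNIV. M $ \<beta> i $ \<beta> (p i)))"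
  proof (rule sum.cong[OF refl])
    fix p :: "'m \<Rightarrow> 'm" assume "p \<in> {p. p permutes UNIV}"
    moreover have "(\<Prod>i\<in>UNIV. M $ i $ ?c p i) = (\<Prod>i\<in>UNIV. M $ \<beta> i $ ?c p (\<beta> i))"
      using prod.reindex_bij_betw[OF \<beta>, of "\<lambda>i. M $ i $ ?c p i"] by simp
    ultimately show "of_int (sign (?c p)) * (\<Prod>i\<in>UNIV. M $ i $ ?c p i) = of_int (sign p) * (\<Prod>i\<in>UNIV. M $ \<beta> i $ \<beta> (p i))"
      using sgn by (simp add: inv)
  qed
  finally show ?thesis by (simp add: det_def)
qed

lemma prod_Basis_vec:
  fixes f :: "real ^ 'n::finite \<Rightarrow> real"
  shows "(\<Prod>b\<in>Basis. f b) = (\<Prod>i\<in>UNIV. f (axis i 1))"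
proof -
  have B: "Basis = range (\<lambda>i. axis i 1 :: real ^ 'n)" by (auto simp: Basis_vec_def)
  have "inj (\<lambda>i. axis i 1 :: real ^ 'n)" by (auto simp: inj_def axis_eq_axis)
  from prod.reindex[OF this, of f] show ?thesis unfolding B o_def .
qed

text \<open>Relabelling coordinates maps boxes to boxes with the same side lengths, and Lebesgue
  measure is determined by its values on boxes.\<close>

lemma lborel_distr_reindex:
  fixes \<beta> :: "'m::finite \<Rightarrow> 'n::finite"
  assumes \<beta>: "bij \<beta>"
  shows "distr lborel borel (\<lambda>v :: real ^ 'n. \<chi> i. v $ \<beta> i) = lborel"
proof (rule lborel_eqI[symmetric])
  fix l u :: "real ^ 'm"
  assume lu: "\<And>b. b \<in> Basis \<Longrightarrow> l \<bullet> b \<le> u \<bullet> b"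
  have meas: "(\<lambda>v :: real ^ 'n. (\<chi> i. v $ \<beta> i) :: real ^ 'm) \<in> borel_measurable borel"
    by (intro borel_measurable_continuous_onI continuous_intros)
  let ?L = "\<lambda>v :: real ^ 'm. (\<chi> j. v $ inv \<beta> j) :: real ^ 'n"
  have inv: "inv \<beta> (\<beta> i) = i" "\<beta> (inv \<beta> j) = j" for i j
    using \<beta> by (auto simp: bij_is_inj bij_is_surj surj_f_inv_f)
  have le: "l $ i \<le> u $ i" for i using lu[of "axis i 1"] by (auto simp: inner_axis Basis_vec_def)
  have "(\<lambda>v :: real ^ 'n. (\<chi> i. v $ \<beta> i) :: real ^ 'm) -` box l u \<inter> space lborel = box (?L l) (?L u)"
    by (auto simp: mem_box_cart) (metis inv)+
  then have "emeasure (distr lborel borel (\<lambda>v :: real ^ 'n. (\<chi> i. v $ \<beta> i) :: real ^ 'm)) (box l u) = emeasure lborel (box (?L l) (?L u))"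
    using meas by (subst emeasure_distr) auto
  also have "\<dots> = (\<Prod>b\<in>Basis. (?L u - ?L l) \<bullet> b)"
    by (rule emeasure_lborel_box) (auto simp: Basis_vec_def inner_axis le)
  also have "(\<Prod>b\<in>Basis. (?L u - ?L l) \<bullet> b) = (\<Prod>j\<in>UNIV. u $ inv \<beta> j - l $ inv \<beta> j)"
    by (simp add: prod_Basis_vec inner_axis)
  also have "\<dots> = (\<Prod>i\<in>UNIV. u $ i - l $ i)"
    using prod.reindex_bij_betw[OF bij_imp_bij_inv[OF \<beta>], of "\<lambda>i. u $ i - l $ i"] by simp
  also have "\<dots> = (\<Prod>b\<in>Basis. (u - l) \<bullet> b)"
    by (simp add: prod_Basis_vec inner_axis)
  finally show "emeasure (distr lborel borel (\<lambda>v :: real ^ 'n. (\<chi> i. v $ \<beta> i) :: real ^ 'm)) (box l u) = ennreal (\<Prod>b\<in>Basis. (u - l) \<bullet> b)" .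
qed simp

lemma lborel_set_integral_change_of_variables_wellorder:
  fixes f :: "real ^ 'm::{finite,wellorder} \<Rightarrow> real" and g :: "real ^ 'm::_ \<Rightarrow> real ^ 'm::_"
  assumes S: "open S" "open (g ` S)" and g: "\<And>x. x \<in> S \<Longrightarrow> (g has_derivative g' x) (at x)"
    and inj: "inj_on g S" and f: "continuous_on (g ` S) f"
    and det: "continuous_on S (\<lambda>x. det (matrix (g' x)))"
  shows "(LINT x:g ` S|lborel. f x) = (LINT x:S|lborel. \<bar>det (matrix (g' x))\<bar> * f (g x))"
proof -
  let ?h = "\<lambda>x. \<bar>det (matrix (g' x))\<bar> * f (g x)"
  have leb: "(LINT x:U|lborel. k x) = (LINT x:U|lebesgue. k x)"
    if "open U" "continuous_on U k" for U and k :: "real ^ 'm::_ \<Rightarrow> real"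
    unfolding set_lebesgue_integral_def
    using borel_measurable_continuous_on_indicator[OF _ that(2)] that(1)
    by (subst integral_completion) auto
  have cg: "continuous_on S g"
    using g S(1) by (meson continuous_at_imp_continuous_on has_derivative_continuous)
  have ch: "continuous_on S ?h"
    by (intro continuous_intros det continuous_on_compose2[OF f cg]) auto
  \<comment> \<open>The change of variables theorem is for vector values, so the scalar function
    enters as a vector of length one.\<close>
  let ?v = "\<lambda>x. vec (f x) :: real ^ 1"
  have iff: "?h absolutely_integrable_on S \<and> integral S ?h = b \<longleftrightarrow>
     f absolutely_integrable_on (g ` S) \<and> integral (g ` S) f = b" for b
  proof -
    have "(\<lambda>x. \<bar>det (matrix (g' x))\<bar> *\<^sub>R ?v (g x)) absolutely_integrable_on S \<and>
        integral S (\<lambda>x. \<bar>det (matrix (g' x))\<bar> *\<^sub>R ?v (g x)) = vec b \<longleftrightarrow>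
        ?v absolutely_integrable_on (g ` S) \<and> integral (g ` S) ?v = vec b"
      by (rule has_absolute_integral_change_of_variables[OF _ has_derivative_at_withinI[OF g] inj])
        (use S(1) in auto)
    moreover have "(vec x = (vec y :: real ^ 1)) \<longleftrightarrow> x = y" for x y :: real
      by (simp add: vec_eq_iff)
    ultimately show ?thesis
      unfolding absolutely_integrable_on_1_iff integral_on_1_eq by simp
  qed
  show ?thesis
    unfolding leb[OF S(2) f] leb[OF S(1) ch]
  proof (cases "f absolutely_integrable_on (g ` S)")
    case True
    then have "?h absolutely_integrable_on S" "integral S ?h = integral (g ` S) f" using iff by blast+
    then show "(LINT x:g ` S|lebesgue. f x) = (LINT x:S|lebesgue. ?h x)"
      using True by (simp add: set_lebesgue_integral_eq_integral)
  next
    \<comment> \<open>Neither integrand is integrable, so both Bochner integrals have the default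
      value 0.\<close>
    case False
    then have "\<not> ?h absolutely_integrable_on S" using iff by blast
    then show "(LINT x:g ` S|lebesgue. f x) = (LINT x:S|lebesgue. ?h x)"
      using False unfolding set_lebesgue_integral_def set_integrable_def
      by (simp add: not_integrable_integral_eq)
  qed
qed

lemma lborel_set_integral_change_of_variables:
  fixes f :: "real ^ 'n::finite \<Rightarrow> real" and g :: "real ^ 'n \<Rightarrow> real ^ 'n"
  assumes S: "open S" "open (g ` S)" and g: "\<And>x. x \<in> S \<Longrightarrow> (g has_derivative g' x) (at x)"
    and inj: "inj_on g S" and f: "continuous_on (g ` S) f"
    and det: "continuous_on S (\<lambda>x. det (matrix (g' x)))"
  shows "(LINT x:g ` S|lborel. f x) = (LINT x:S|lborel. \<bar>det (matrix (g' x))\<bar> * f (g x))"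
proof -
  obtain \<beta> :: "'n idx \<Rightarrow> 'n" where \<beta>: "bij \<beta>" using ex_bij_idx by blast
  have inv: "inv \<beta> (\<beta> i) = i" "\<beta> (inv \<beta> j) = j" for i j
    using \<beta> by (auto simp: bij_is_inj bij_is_surj surj_f_inv_f)
  \<comment> \<open>\<open>P\<close> and \<open>Q\<close> relabel coordinates back and forth.
    Conjugating \<open>g\<close> by them changes neither the integrals nor the Jacobian
    determinant.\<close>
  define P where "P v = (\<chi> i. v $ \<beta> i)" for v :: "real ^ 'n"
  define Q where "Q v = (\<chi> j. v $ inv \<beta> j)" for v :: "real ^ 'n idx"
  have PQ: "P (Q v) = v" "Q (P w) = w" for v w by (simp_all add: P_def Q_def vec_eq_iff inv)
  have cP: "continuous_on U P" and cQ: "continuous_on U' Q" for U U'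
    unfolding P_def Q_def by (intro continuous_intros)+
  have lP: "bounded_linear P" and lQ: "bounded_linear Q"
    unfolding P_def Q_def linear_conv_bounded_linear[symmetric] by (auto simp: linear_iff vec_eq_iff)
  have PU: "P ` U = Q -` U" for U
  proof
    show "P ` U \<subseteq> Q -` U" by (auto simp: PQ)
    show "Q -` U \<subseteq> P ` U"
    proof
      fix x assume "x \<in> Q -` U"
      then have "P (Q x) \<in> P ` U" by (intro imageI) simp
      then show "x \<in> P ` U" by (simp only: PQ)
    qed
  qed
  have oP: "open (P ` U)" if "open U" for U
    unfolding PU by (rule open_vimage[OF that cQ])
  have tr: "(LINT x:P ` U|lborel. k (Q x)) = (LINT x:U|lborel. k x)"
    if "open U" "continuous_on U k" for U and k :: "real ^ 'n \<Rightarrow> real"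
  proof -
    have cont: "continuous_on (P ` U) (\<lambda>x. k (Q x))"
      by (rule continuous_on_compose2[OF that(2) cQ]) (auto simp: PQ)
    have "(LINT x:P ` U|lborel. k (Q x)) = (LINT x|distr lborel borel P. indicator (P ` U) x *\<^sub>R k (Q x))"
      unfolding set_lebesgue_integral_def P_def[abs_def] lborel_distr_reindex[OF \<beta>] ..
    also have "\<dots> = (LINT x|lborel. indicator (P ` U) (P x) *\<^sub>R k (Q (P x)))"
      using borel_measurable_continuous_on_indicator[OF _ cont] oP[OF that(1)] cP[of UNIV]
      by (subst integral_distr) (auto intro: borel_measurable_continuous_onI)
    also have "\<dots> = (LINT x:U|lborel. k x)"
      unfolding set_lebesgue_integral_def PU by (simp add: PQ indicator_def)
    finally show ?thesis .
  qed
  let ?g = "\<lambda>x. P (g (Q x))" and ?g' = "\<lambda>x v. P (g' (Q x) (Q v))"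
  have im: "?g ` (P ` S) = P ` g ` S" by (auto simp: PQ image_image)
  have m: "det (matrix (\<lambda>v. P (A (Q v)))) = det (matrix A)" for A :: "real ^ 'n \<Rightarrow> real ^ 'n"
  proof -
    have Qa: "Q (axis j 1) = axis (\<beta> j) 1" for j
      using \<beta> by (auto simp: Q_def vec_eq_iff axis_def inv)
    have "matrix (\<lambda>v. P (A (Q v))) = (\<chi> i j. matrix A $ \<beta> i $ \<beta> j)"
      unfolding matrix_def Qa by (simp add: P_def vec_eq_iff)
    then show ?thesis by (simp add: det_reindex[OF \<beta>])
  qed
  have cg: "continuous_on S g"
    using g S(1) by (meson continuous_at_imp_continuous_on has_derivative_continuous)
  have "(LINT x:g ` S|lborel. f x) = (LINT x:?g ` (P ` S)|lborel. f (Q x))"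
    unfolding im by (rule tr[OF S(2) f, symmetric])
  also have "\<dots> = (LINT x:P ` S|lborel. \<bar>det (matrix (?g' x))\<bar> * f (Q (?g x)))"
  proof (rule lborel_set_integral_change_of_variables_wellorder)
    show "open (P ` S)" "open (?g ` (P ` S))" unfolding im using S oP by auto
    show "(?g has_derivative ?g' x) (at x)" if "x \<in> P ` S" for x
    proof -
      have "Q x \<in> S" using that by (auto simp: PQ)
      from has_derivative_compose[OF bounded_linear_imp_has_derivative[OF lQ] g[OF this]]
      show ?thesis by (rule bounded_linear.has_derivative[OF lP])
    qed
    show "inj_on ?g (P ` S)"
      using inj by (auto simp: inj_on_def PQ) (metis PQ(2))
    show "continuous_on (?g ` (P ` S)) (\<lambda>x. f (Q x))"
      unfolding im by (rule continuous_on_compose2[OF f cQ]) (auto simp: PQ)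
    have "continuous_on (P ` S) (\<lambda>x. det (matrix (g' (Q x))))"
      by (rule continuous_on_compose2[OF det cQ]) (auto simp: PQ)
    then show "continuous_on (P ` S) (\<lambda>x. det (matrix (?g' x)))"
      by (rule continuous_on_eq) (auto simp: m PQ)
  qed
  also have "\<dots> = (LINT x:P ` S|lborel. \<bar>det (matrix (g' (Q x)))\<bar> * f (g (Q x)))"
    by (rule set_lebesgue_integral_cong) (use oP[OF S(1)] in \<open>auto simp: m PQ\<close>)
  also have "\<dots> = (LINT x:S|lborel. \<bar>det (matrix (g' x))\<bar> * f (g x))"
    by (rule tr[OF S(1)]) (intro continuous_intros det continuous_on_compose2[OF f cg], auto)
  finally show ?thesis .
qed

section \<open>Closed Riemannian manifolds\<close>

locale closed_riemannian =
  fixes T :: "'m topology" and A :: "('m, 'n::finite) chart set" and g :: "('m, 'n) tensor2"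
  assumes manifold: "smooth_manifold T A" and compact_T: "compact_space T" and metric: "riemannian_metric A g"
begin

section \<open>Charts as homeomorphisms\<close>

lemma Hausdorff_T: "Hausdorff_space T"
  using manifold by (simp add: smooth_manifold_def)

lemma atlas_cover: "p \<in> topspace T \<Longrightarrow> \<exists>c\<in>A. p \<in> chart_dom c"
  using manifold by (auto simp: smooth_manifold_def smooth_atlas_def)

context
  fixes c assumes c: "c \<in> A"
begin

lemma chart: "is_chart T c"
  using manifold c by (auto simp: smooth_manifold_def smooth_atlas_def)

lemma openin_dom: "openin T (chart_dom c)"
  using chart by (simp add: is_chart_def)

lemma dom_subset: "chart_dom c \<subseteq> topspace T"
  using openin_dom by (rule openin_subset)

lemma open_img: "open (chart_img c)"
  using chart by (simp add: is_chart_def)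

lemma homeo: "homeomorphic_map (subtopology T (chart_dom c)) (top_of_set (chart_img c)) (chart_map c)"
  using chart by (simp add: is_chart_def)

lemma topspace_dom: "topspace (subtopology T (chart_dom c)) = chart_dom c"
  using dom_subset by (simp add: topspace_subtopology Int_absorb1)

lemma inj_chart: "inj_on (chart_map c) (chart_dom c)"
  using homeomorphic_imp_injective_map[OF homeo] unfolding topspace_dom .

lemma chart_map_in: "p \<in> chart_dom c \<Longrightarrow> chart_map c p \<in> chart_img c"
  by (simp add: chart_img_def)

lemma chart_inv_map: "p \<in> chart_dom c \<Longrightarrow> chart_inv c (chart_map c p) = p"
  unfolding chart_inv_def by (rule inv_into_f_f[OF inj_chart])

lemma chart_map_inv: "x \<in> chart_img c \<Longrightarrow> chart_map c (chart_inv c x) = x"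
  unfolding chart_inv_def chart_img_def by (rule f_inv_into_f)

lemma chart_inv_in: "x \<in> chart_img c \<Longrightarrow> chart_inv c x \<in> chart_dom c"
  unfolding chart_inv_def chart_img_def by (rule inv_into_into)

lemma chart_inv_top: "x \<in> chart_img c \<Longrightarrow> chart_inv c x \<in> topspace T"
  using chart_inv_in dom_subset by blast

lemma overlap_iff: "x \<in> overlap c d \<longleftrightarrow> x \<in> chart_img c \<and> chart_inv c x \<in> chart_dom d"
proof
  assume "x \<in> overlap c d"
  then obtain p where "p \<in> chart_dom c" "p \<in> chart_dom d" "x = chart_map c p"
    by (auto simp: overlap_def)
  then show "x \<in> chart_img c \<and> chart_inv c x \<in> chart_dom d"
    using chart_map_in chart_inv_map by simp
next
  assume x: "x \<in> chart_img c \<and> chart_inv c x \<in> chart_dom d"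
  then show "x \<in> overlap c d"
    unfolding overlap_def using chart_inv_in chart_map_inv by (intro image_eqI[of _ _ "chart_inv c x"]) auto
qed

lemma open_image:
  assumes "openin T U"
  shows "open (chart_map c ` (chart_dom c \<inter> U))"
proof -
  have "openin (subtopology T (chart_dom c)) (chart_dom c \<inter> U)"
    using assms by (auto simp: openin_subtopology Int_commute)
  then have "openin (top_of_set (chart_img c)) (chart_map c ` (chart_dom c \<inter> U))"
    using homeomorphic_imp_open_map[OF homeo] by (auto simp: open_map_def)
  then show ?thesis
    using open_img openin_open_trans by blast
qed

lemma openin_vimage:
  assumes "open W"
  shows "openin T {p \<in> chart_dom c. chart_map c p \<in> W}"
proof -
  have "continuous_map (subtopology T (chart_dom c)) euclidean (chart_map c)"
    using homeomorphic_imp_continuous_map[OF homeo] by (simp add: continuous_map_in_subtopology)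
  from openin_continuous_map_preimage[OF this, of W] assms
  have "openin (subtopology T (chart_dom c)) {p \<in> chart_dom c. chart_map c p \<in> W}"
    unfolding topspace_dom by simp
  then show ?thesis
    using openin_dom openin_trans_full by blast
qed

lemma compact_image:
  assumes "compactin T K" "K \<subseteq> chart_dom c"
  shows "compact (chart_map c ` K)"
proof -
  have "compactin (subtopology T (chart_dom c)) K"
    using assms by (simp add: compactin_subtopology)
  from image_compactin[OF this homeomorphic_imp_continuous_map[OF homeo]]
  show ?thesis by (simp add: compactin_subtopology)
qed

lemma compactin_vimage:
  assumes "compact K" "K \<subseteq> chart_img c"
  shows "compactin T {p \<in> chart_dom c. chart_map c p \<in> K}"
proof -
  let ?K = "{p \<in> chart_dom c. chart_map c p \<in> K}"
  have "chart_map c ` ?K = K" using assms(2) by (auto simp: chart_img_def)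
  then have "compactin (top_of_set (chart_img c)) (chart_map c ` ?K)"
    using assms by (simp add: compactin_subtopology)
  then have "compactin (subtopology T (chart_dom c)) ?K"
    using homeomorphic_map_compactness[OF homeo, of ?K] unfolding topspace_dom by auto
  then show ?thesis by (simp add: compactin_subtopology)
qed

lemma metric_chart: "metric_chart (g c) (chart_img c)"
  using metric c open_img unfolding riemannian_metric_def metric_chart_def by auto

end

lemma open_overlap: "c \<in> A \<Longrightarrow> d \<in> A \<Longrightarrow> open (overlap c d)"
  unfolding overlap_def using open_image openin_dom by blast

lemma overlap_subset: "overlap c d \<subseteq> chart_img c"
  by (auto simp: overlap_def chart_img_def)

section \<open>Transition maps and the transformation of components\<close>

context
  fixes c d assumes c: "c \<in> A" and d: "d \<in> A"
begin

lemma smooth_transition: "smooth_on (overlap c d) (transition c d)"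
  using manifold c d by (auto simp: smooth_manifold_def smooth_atlas_def)

lemma transition_in: "x \<in> overlap c d \<Longrightarrow> transition c d x \<in> overlap d c"
  using chart_inv_in[OF c] overlap_iff[OF c] overlap_iff[OF d] chart_map_in[OF d] chart_inv_map[OF d]
  by (auto simp: transition_def)

lemma chart_inv_transition: "x \<in> overlap c d \<Longrightarrow> chart_inv d (transition c d x) = chart_inv c x"
  using overlap_iff[OF c] chart_inv_map[OF d] by (auto simp: transition_def)

lemma transition_transition: "x \<in> overlap c d \<Longrightarrow> transition d c (transition c d x) = x"
  using chart_inv_transition overlap_iff[OF c] chart_map_inv[OF c] by (simp add: transition_def)

abbreviation jac :: "real ^ 'n \<Rightarrow> real ^ 'n ^ 'n" where
  "jac x \<equiv> jacobian (transition c d) (at x)"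

lemma transition_derivative:
  assumes x: "x \<in> overlap c d"
  shows "(transition c d has_derivative (\<lambda>h. jac x *v h)) (at x)"
  using smooth_on_imp_differentiable[OF open_overlap[OF c d] smooth_transition x]
  by (simp add: jacobian_works)

lemma jac_nth:
  assumes x: "x \<in> overlap c d"
  shows "jac x $ m $ b = pd b (\<lambda>y. transition c d y $ m) x"
proof -
  have "((\<lambda>y. transition c d y $ m) has_derivative (\<lambda>h. (jac x *v h) $ m)) (at x)"
    by (rule bounded_linear.has_derivative[OF bounded_linear_vec_nth transition_derivative[OF x]])
  from pd_eqI[OF this] show ?thesis
    by (simp add: matrix_vector_mult_def axis_def if_distrib cong: if_cong)
qed

lemma smooth_transition_nth: "smooth_on (overlap c d) (\<lambda>y. transition c d y $ m)"
  by (intro smooth_on_vec_nth open_overlap c d smooth_transition)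

lemma smooth_jac_nth: "smooth_on (overlap c d) (\<lambda>x. jac x $ m $ b)"
  by (rule smooth_on_cong[OF open_overlap[OF c d] smooth_on_pd[OF open_overlap[OF c d] smooth_transition_nth[of m], of b]])
    (simp add: jac_nth)

text \<open>The entries of the Jacobian are first derivatives of the transition map, so this is
  symmetry of its second derivatives. It makes \<open>curl_form\<close> transform as a
  one-form.\<close>

lemma pd_jac_commute:
  assumes x: "x \<in> overlap c d"
  shows "pd a (\<lambda>y. jac y $ m $ b) x = pd b (\<lambda>y. jac y $ m $ a) x"
proof -
  have "pd a (\<lambda>y. jac y $ m $ b) x = pd a (pd b (\<lambda>y. transition c d y $ m)) x" for a b
    using x by (intro pd_cong[OF open_overlap[OF c d]] smooth_on_imp_differentiable[OF open_overlap[OF c d] smooth_jac_nth])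
      (auto simp: jac_nth)
  then show ?thesis
    using pd_commute[OF open_overlap[OF c d] x smooth_transition_nth] by simp
qed

lemma pd_transition:
  assumes x: "x \<in> overlap c d" and u: "u differentiable (at (transition c d x))"
  shows "pd i (\<lambda>y. u (transition c d y)) x = (\<Sum>j\<in>UNIV. pd j u (transition c d x) * jac x $ j $ i)"
proof -
  have lin: "linear (frechet_derivative u (at (transition c d x)))" by (rule linear_frechet_derivative[OF u])
  have "pd i (\<lambda>y. u (transition c d y)) x = frechet_derivative u (at (transition c d x)) (jac x *v axis i 1)"
    by (rule pd_eqI[OF has_derivative_compose[OF transition_derivative[OF x] has_derivative_frechet[OF u]]])
  also have "jac x *v axis i 1 = (\<Sum>j\<in>UNIV. (jac x $ j $ i) *\<^sub>R axis j 1)"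
    by (subst vec_eq_sum_scaleR_axis) (simp add: matrix_vector_mult_def axis_def if_distrib cong: if_cong)
  also have "frechet_derivative u (at (transition c d x)) \<dots> = (\<Sum>j\<in>UNIV. pd j u (transition c d x) * jac x $ j $ i)"
    by (simp add: linear_sum[OF lin] linear_scale[OF lin] pd_def mult.commute)
  finally show ?thesis .
qed

lemma g_transform:
  "x \<in> overlap c d \<Longrightarrow> g c x = transpose (jac x) ** g d (transition c d x) ** jac x"
  using metric c d unfolding riemannian_metric_def by blast

lemma det_g_transform:
  assumes x: "x \<in> overlap c d"
  shows "sqrt (det (g c x)) = \<bar>det (jac x)\<bar> * sqrt (det (g d (transition c d x)))" and "det (jac x) \<noteq> 0"
proof -
  have eq: "det (g c x) = (det (jac x))\<^sup>2 * det (g d (transition c d x))"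
    by (simp add: g_transform[OF x] det_mul power2_eq_square)
  then show "sqrt (det (g c x)) = \<bar>det (jac x)\<bar> * sqrt (det (g d (transition c d x)))"
    by (simp add: real_sqrt_mult)
  have "x \<in> chart_img c" using x overlap_subset by blast
  then show "det (jac x) \<noteq> 0"
    using metric_chart.det_G_pos[OF metric_chart[OF c]] eq by force
qed

text \<open>Raising an index solves a linear system with the metric as matrix. If \<open>u\<close>
  solves it in chart \<open>d\<close> and \<open>J v = u\<close>, the transformation law of the
  metric shows that \<open>v\<close> solves it in chart \<open>c\<close>.\<close>

lemma raise_transform:
  assumes x: "x \<in> overlap c d" and w: "w = transpose (jac x) *v w'"
  shows "matrix_inv (g d (transition c d x)) *v w' = jac x *v (matrix_inv (g c x) *v w)"
proof -
  let ?y = "transition c d x"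
  have xc: "x \<in> chart_img c" and yd: "?y \<in> chart_img d"
    using x transition_in[OF x] overlap_subset by blast+
  have "invertible (jac x)" using det_g_transform(2)[OF x] invertible_det_nz by blast
  then obtain B where B: "jac x ** B = mat 1" unfolding invertible_def by blast
  define u where "u = matrix_inv (g d ?y) *v w'"
  define v where "v = B *v u"
  have Jv: "jac x *v v = u" by (simp add: v_def matrix_vector_mul_assoc B)
  have gu: "g d ?y *v u = w'"
    by (simp add: u_def matrix_vector_mul_assoc metric_chart.ginv_mult[OF metric_chart[OF d] yd])
  have "g c x *v v = transpose (jac x) *v (g d ?y *v (jac x *v v))"
    by (simp add: g_transform[OF x] matrix_vector_mul_assoc matrix_mul_assoc)
  also have "\<dots> = w" by (simp add: Jv gu w)
  finally have "matrix_inv (g c x) *v w = v"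
    using metric_chart.ginv_mult(1)[OF metric_chart[OF c] xc] by (metis matrix_vector_mul_assoc matrix_vector_mul_lid)
  then show ?thesis by (simp add: Jv u_def)
qed

text \<open>The factor \<open>\<bar>det J\<bar>\<close> from the change of variables is exactly what
  converts the density of \<open>d\<close> into that of \<open>c\<close>.\<close>

lemma set_integral_transition:
  assumes h: "continuous_on (overlap d c) h"
  shows "(LINT y:overlap d c|lborel. h y * sqrt (det (g d y))) =
     (LINT x:overlap c d|lborel. h (transition c d x) * sqrt (det (g c x)))"
proof -
  have im: "transition c d ` overlap c d = overlap d c"
  proof
    show "transition c d ` overlap c d \<subseteq> overlap d c" using transition_in by blast
  next
    show "overlap d c \<subseteq> transition c d ` overlap c d"
    proof
      fix y assume y: "y \<in> overlap d c"
      have "y \<in> chart_img d" "chart_inv d y \<in> chart_dom c" using y overlap_iff[OF d] by auto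
      then have "transition d c y \<in> overlap c d \<and> transition c d (transition d c y) = y"
        using chart_inv_in[OF d] overlap_iff[OF c] chart_map_in[OF c] chart_inv_map[OF c] chart_map_inv[OF d]
        by (auto simp: transition_def)
      then show "y \<in> transition c d ` overlap c d" by force
    qed
  qed
  have mj: "matrix (\<lambda>h. jac x *v h) = jac x" for x by (rule matrix_of_matrix_vector_mul)
  have "continuous_on (chart_img d) (\<lambda>y. sqrt (det (g d y)))"
    by (rule smooth_on_imp_continuous_on[OF open_img[OF d] metric_chart.smooth_sqrt_det[OF metric_chart[OF d]]])
  then have s: "continuous_on (overlap d c) (\<lambda>y. sqrt (det (g d y)))"
    by (rule continuous_on_subset) (rule overlap_subset)
  have "(LINT y:transition c d ` overlap c d|lborel. h y * sqrt (det (g d y))) =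
     (LINT x:overlap c d|lborel. \<bar>det (matrix (\<lambda>v. jac x *v v))\<bar> * (h (transition c d x) * sqrt (det (g d (transition c d x)))))"
  proof (rule lborel_set_integral_change_of_variables)
    show "open (overlap c d)" "open (transition c d ` overlap c d)"
      unfolding im by (intro open_overlap c d)+
    show "inj_on (transition c d) (overlap c d)"
      by (rule inj_on_inverseI[of _ "transition d c"]) (rule transition_transition)
    show "continuous_on (transition c d ` overlap c d) (\<lambda>y. h y * sqrt (det (g d y)))"
      unfolding im by (intro continuous_intros h s)
    show "continuous_on (overlap c d) (\<lambda>x. det (matrix (\<lambda>v. jac x *v v)))"
      unfolding mj
      by (intro smooth_on_imp_continuous_on smooth_on_det open_overlap c d smooth_jac_nth)
  qed (rule transition_derivative)
  also have "\<dots> = (LINT x:overlap c d|lborel. h (transition c d x) * sqrt (det (g c x)))"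
    unfolding mj
    by (rule set_lebesgue_integral_cong)
      (use open_overlap[OF c d] in \<open>auto simp: det_g_transform(1)\<close>)
  finally show ?thesis unfolding im .
qed

end

subsection \<open>Partitions of unity\<close>

text \<open>A Euclidean bump is pulled back by a chart and extended by zero. Smoothness of the
  extension in the other charts rests on the Hausdorff property: the compact \<open>K\<close> is
  closed, so any point outside the chart domain has a neighbourhood on which \<open>f\<close>
  vanishes.\<close>

lemma exists_local_bump:
  assumes p: "p \<in> topspace T"
  shows "\<exists>c\<in>A. \<exists>f K. compactin T K \<and> K \<subseteq> chart_dom c \<and> (\<forall>q. 0 \<le> f q) \<and> (\<forall>q. q \<notin> K \<longrightarrow> f q = 0) \<and>
    (\<forall>d\<in>A. smooth_on (chart_img d) (\<lambda>x. f (chart_inv d x))) \<and>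
    (\<exists>U. openin T U \<and> p \<in> U \<and> (\<forall>q\<in>U. f q > (0::real)))"
proof -
  obtain c where c: "c \<in> A" "p \<in> chart_dom c" using atlas_cover[OF p] by blast
  obtain r where r: "r > 0" "cball (chart_map c p) r \<subseteq> chart_img c"
    using open_img[OF c(1)] chart_map_in[OF c] open_contains_cball by blast
  obtain b where b: "smooth_on UNIV b" "\<And>x. 0 \<le> b x" "\<And>x. b x \<noteq> (0::real) \<longleftrightarrow> x \<in> ball (chart_map c p) r"
    using exists_smooth_bump[OF r(1)] by metis
  define K where "K = {q \<in> chart_dom c. chart_map c q \<in> cball (chart_map c p) r}"
  define f where "f q = (if q \<in> chart_dom c then b (chart_map c q) else 0)" for q
  have K: "compactin T K" unfolding K_def by (rule compactin_vimage[OF c(1) compact_cball r(2)])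
  have closed: "closedin T K" by (rule compactin_imp_closedin[OF Hausdorff_T K])
  have f0: "f q = 0" if "q \<notin> K" for q
    using that b(3)[of "chart_map c q"] by (auto simp: f_def K_def)
  have sm: "smooth_on (chart_img d) (\<lambda>x. f (chart_inv d x))" if d: "d \<in> A" for d
  proof (rule smooth_on_local[OF open_img[OF d]])
    fix x assume x: "x \<in> chart_img d"
    show "\<exists>U. open U \<and> x \<in> U \<and> smooth_on U (\<lambda>x. f (chart_inv d x))"
    proof (cases "chart_inv d x \<in> chart_dom c")
      case True
      have o: "open (overlap d c)" by (rule open_overlap[OF d c(1)])
      have "smooth_on (overlap d c) (\<lambda>x. b (transition d c x))"
        by (rule smooth_on_compose[OF o open_UNIV UNIV_I smooth_transition[OF d c(1)] b(1)])
      then have "smooth_on (overlap d c) (\<lambda>x. f (chart_inv d x))"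
        by (rule smooth_on_cong[OF o]) (simp add: f_def transition_def overlap_iff[OF d])
      then show ?thesis using o True x overlap_iff[OF d] by blast
    next
      case False
      define N where "N = chart_map d ` (chart_dom d \<inter> (topspace T - K))"
      have N: "open N" unfolding N_def by (rule open_image[OF d]) (use closed in auto)
      have "smooth_on N (\<lambda>x. f (chart_inv d x))"
        by (rule smooth_on_cong[OF N smooth_on_const[OF N, of 0]]) (auto simp: N_def chart_inv_map[OF d] f0)
      moreover have "x \<in> N"
        unfolding N_def using x False chart_inv_in[OF d x] chart_inv_top[OF d x] chart_map_inv[OF d x]
        by (intro image_eqI[of _ _ "chart_inv d x"]) (auto simp: K_def)
      ultimately show ?thesis using N by blast
    qed
  qed
  define U where "U = {q \<in> chart_dom c. chart_map c q \<in> ball (chart_map c p) r}"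
  have U: "openin T U" "p \<in> U" "\<forall>q\<in>U. f q > 0"
    unfolding U_def using openin_vimage[OF c(1) open_ball] c r b(2,3)
    by (auto simp: f_def less_le)
  have "K \<subseteq> chart_dom c" "\<forall>q. 0 \<le> f q" using b(2) by (auto simp: K_def f_def)
  then show ?thesis using c(1) K f0 sm U by blast
qed

lemma exists_partition_of_unity: "\<exists>C \<rho>. partition_of_unity T A C \<rho>"
proof -
  obtain ch f K U where B: "\<And>p. p \<in> topspace T \<Longrightarrow> ch p \<in> A \<and> compactin T (K p) \<and> K p \<subseteq> chart_dom (ch p) \<and>
      (\<forall>q. 0 \<le> f p q) \<and> (\<forall>q. q \<notin> K p \<longrightarrow> f p q = 0) \<and>
      (\<forall>d\<in>A. smooth_on (chart_img d) (\<lambda>x. f p (chart_inv d x))) \<and>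
      openin T (U p) \<and> p \<in> U p \<and> (\<forall>q\<in>U p. f p q > (0::real))"
    using exists_local_bump by metis
  have "\<exists>\<F>. finite \<F> \<and> \<F> \<subseteq> U ` topspace T \<and> topspace T \<subseteq> \<Union>\<F>"
    using compact_T B unfolding compact_space_def compactin_def by (auto dest!: spec[of _ "U ` topspace T"])
  then obtain F where F: "finite F" "F \<subseteq> topspace T" "topspace T \<subseteq> (\<Union>p\<in>F. U p)"
    by (metis finite_subset_image)
  define \<sigma> where "\<sigma> q = (\<Sum>p\<in>F. f p q)" for q
  have pos: "\<sigma> q > 0" if q: "q \<in> topspace T" for q
  proof -
    obtain p where p: "p \<in> F" "q \<in> U p" using F(3) q by blast
    have "0 < f p q" using B p F(2) by blast
    also have "\<dots> \<le> \<sigma> q"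
      unfolding \<sigma>_def using F B by (intro member_le_sum p) auto
    finally show ?thesis .
  qed
  \<comment> \<open>The partition is indexed by charts, so bumps that use the same chart are added
    up before normalising by the total.\<close>
  define \<rho> where "\<rho> c q = (\<Sum>p\<in>{p \<in> F. ch p = c}. f p q) / \<sigma> q" for c q
  have "partition_of_unity T A (ch ` F) \<rho>"
    unfolding partition_of_unity_def
  proof (intro conjI ballI)
    show "finite (ch ` F)" using F by simp
    show "ch ` F \<subseteq> A" using F B by blast
  next
    fix c d assume "c \<in> ch ` F" and d: "d \<in> A"
    show "smooth_on (chart_img d) (\<lambda>x. \<rho> c (chart_inv d x))"
      unfolding \<rho>_def \<sigma>_def
    proof (intro smooth_on_divide smooth_on_sum open_img d)
      show "(\<Sum>p\<in>F. f p (chart_inv d x)) \<noteq> 0" if "x \<in> chart_img d" for x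
        using pos[OF chart_inv_top[OF d that]] unfolding \<sigma>_def by simp
    qed (use F B d in auto)
  next
    fix c q assume q: "q \<in> topspace T"
    show "0 \<le> \<rho> c q"
      unfolding \<rho>_def using pos[OF q] F B by (intro divide_nonneg_pos sum_nonneg) auto
  next
    fix c
    let ?L = "\<Union>p\<in>{p \<in> F. ch p = c}. K p"
    have "closedin T ?L"
      using F B by (intro closedin_Union) (auto intro: compactin_imp_closedin[OF Hausdorff_T])
    moreover have "{p \<in> topspace T. \<rho> c p \<noteq> 0} \<subseteq> ?L"
    proof
      fix q assume "q \<in> {p \<in> topspace T. \<rho> c p \<noteq> 0}"
      then have "(\<Sum>p\<in>{p \<in> F. ch p = c}. f p q) \<noteq> 0" by (auto simp: \<rho>_def)
      then obtain p where "p \<in> {p \<in> F. ch p = c}" "f p q \<noteq> 0" by (rule sum.not_neutral_contains_not_neutral)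
      then have p: "p \<in> F" "ch p = c" "f p q \<noteq> 0" by auto
      then have "q \<in> K p" using B[of p] F(2) by blast
      then show "q \<in> ?L" using p by blast
    qed
    ultimately have "T closure_of {p \<in> topspace T. \<rho> c p \<noteq> 0} \<subseteq> ?L" by (rule closure_of_minimal[rotated])
    also have "?L \<subseteq> chart_dom c" using F B by blast
    finally show "T closure_of {p \<in> topspace T. \<rho> c p \<noteq> 0} \<subseteq> chart_dom c" .
  next
    fix q assume q: "q \<in> topspace T"
    have "(\<Sum>c\<in>ch ` F. \<rho> c q) = (\<Sum>c\<in>ch ` F. \<Sum>p\<in>{p \<in> F. ch p = c}. f p q) / \<sigma> q"
      by (simp add: \<rho>_def sum_divide_distrib)
    also have "(\<Sum>c\<in>ch ` F. \<Sum>p\<in>{p \<in> F. ch p = c}. f p q) = \<sigma> q"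
      unfolding \<sigma>_def by (rule sum.image_gen[OF F(1), symmetric])
    finally show "(\<Sum>c\<in>ch ` F. \<rho> c q) = 1" using pos[OF q] by simp
  qed
  then show ?thesis by blast
qed

text \<open>The chosen partition does not depend on the integrand: one pair \<open>C\<close>,
  \<open>\<rho>\<close> serves all \<open>f\<close>.\<close>

lemma manifold_integral_partition:
  "\<exists>C \<rho>. partition_of_unity T A C \<rho> \<and> (\<forall>f. manifold_integral T A g f =
     (\<Sum>c\<in>C. LINT x:chart_img c|lborel. \<rho> c (chart_inv c x) * f c x * sqrt (det (g c x))))"
proof -
  obtain C \<rho> where eq: "(SOME (C, \<rho>). partition_of_unity T A C \<rho>) = (C, \<rho>)"
    by (cases "(SOME (C, \<rho>). partition_of_unity T A C \<rho>)") blast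
  have "case (SOME (C, \<rho>). partition_of_unity T A C \<rho>) of (C, \<rho>) \<Rightarrow> partition_of_unity T A C \<rho>"
    by (rule someI_ex) (use exists_partition_of_unity in auto)
  then have "partition_of_unity T A C \<rho>" unfolding eq by simp
  then show ?thesis by (intro exI[of _ C] exI[of _ \<rho>]) (simp add: manifold_integral_def eq)
qed

end

section \<open>Integration against a fixed partition of unity\<close>

locale partitioned_riemannian = closed_riemannian T A g
  for T :: "'m topology" and A :: "('m, 'n::finite) chart set" and g :: "('m, 'n) tensor2" +
  fixes C :: "('m, 'n) chart set" and \<rho> :: "('m, 'n) chart \<Rightarrow> 'm \<Rightarrow> real"
  assumes partition: "partition_of_unity T A C \<rho>"
begin

lemma finite_C: "finite C" and C_subset: "c \<in> C \<Longrightarrow> c \<in> A"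
  using partition by (auto simp: partition_of_unity_def)

lemma smooth_rho: "c \<in> C \<Longrightarrow> d \<in> A \<Longrightarrow> smooth_on (chart_img d) (\<lambda>x. \<rho> c (chart_inv d x))"
  using partition by (auto simp: partition_of_unity_def)

lemma rho_nonneg: "c \<in> C \<Longrightarrow> p \<in> topspace T \<Longrightarrow> 0 \<le> \<rho> c p"
  using partition by (auto simp: partition_of_unity_def)

lemma sum_rho: "p \<in> topspace T \<Longrightarrow> (\<Sum>c\<in>C. \<rho> c p) = 1"
  using partition by (auto simp: partition_of_unity_def)

definition supp :: "('m, 'n) chart \<Rightarrow> 'm set" where
  "supp c = T closure_of {p \<in> topspace T. \<rho> c p \<noteq> 0}"

lemma supp_subset: "c \<in> C \<Longrightarrow> supp c \<subseteq> chart_dom c"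
  using partition by (auto simp: partition_of_unity_def supp_def)

lemma closedin_supp: "closedin T (supp c)"
  by (simp add: supp_def)

lemma rho_eq_0: "p \<in> topspace T \<Longrightarrow> p \<notin> supp c \<Longrightarrow> \<rho> c p = 0"
  using closure_of_subset[of "{p \<in> topspace T. \<rho> c p \<noteq> 0}" T] by (auto simp: supp_def)

definition chart_supp :: "('m, 'n) chart \<Rightarrow> (real ^ 'n) set" where
  "chart_supp c = chart_map c ` supp c"

abbreviation wt :: "('m, 'n) chart \<Rightarrow> real ^ 'n \<Rightarrow> real" where
  "wt c x \<equiv> \<rho> c (chart_inv c x)"

abbreviation vol :: "('m, 'n) chart \<Rightarrow> real ^ 'n \<Rightarrow> real" where
  "vol c x \<equiv> sqrt (det (g c x))"

lemma compact_chart_supp: "c \<in> C \<Longrightarrow> compact (chart_supp c)"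
  unfolding chart_supp_def
  using compact_image[OF C_subset _ supp_subset] closedin_compact_space[OF compact_T closedin_supp] by blast

lemma chart_supp_subset: "c \<in> C \<Longrightarrow> chart_supp c \<subseteq> chart_img c"
  unfolding chart_supp_def chart_img_def by (intro image_mono supp_subset)

lemma notin_supp:
  assumes "c \<in> C" "x \<in> chart_img c - chart_supp c" shows "chart_inv c x \<notin> supp c"
proof
  assume "chart_inv c x \<in> supp c"
  then have "chart_map c (chart_inv c x) \<in> chart_supp c" by (simp add: chart_supp_def)
  then show False using assms chart_map_inv[OF C_subset] by auto
qed

lemma wt_eq_0: "c \<in> C \<Longrightarrow> x \<in> chart_img c - chart_supp c \<Longrightarrow> wt c x = 0"
  using rho_eq_0 notin_supp chart_inv_top[OF C_subset] by blast

lemma continuous_rho: "c \<in> C \<Longrightarrow> d \<in> A \<Longrightarrow> continuous_on (chart_img d) (\<lambda>x. \<rho> c (chart_inv d x))"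
  by (rule smooth_on_imp_continuous_on[OF open_img smooth_rho])

lemma smooth_vol: "c \<in> A \<Longrightarrow> smooth_on (chart_img c) (vol c)"
  by (rule metric_chart.smooth_sqrt_det[OF metric_chart])

lemma continuous_vol: "c \<in> A \<Longrightarrow> continuous_on (chart_img c) (vol c)"
  by (rule smooth_on_imp_continuous_on[OF open_img smooth_vol])

lemma vol_pos: "c \<in> A \<Longrightarrow> x \<in> chart_img c \<Longrightarrow> vol c x > 0"
  using metric_chart.det_G_pos[OF metric_chart] by simp

definition integ :: "(('m, 'n) chart \<Rightarrow> real ^ 'n \<Rightarrow> real) \<Rightarrow> real" where
  "integ f = (\<Sum>c\<in>C. LINT x:chart_img c|lborel. wt c x * f c x * vol c x)"

lemma integrable_wt:
  assumes "c \<in> C" "continuous_on (chart_img c) h"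
  shows "set_integrable lborel (chart_img c) (\<lambda>x. wt c x * h x * vol c x)"
  by (rule set_integrable_compact_support[OF open_img[OF C_subset] compact_chart_supp chart_supp_subset])
    (use assms in \<open>auto intro!: continuous_intros continuous_rho continuous_vol C_subset simp: wt_eq_0\<close>)

lemma integ_cong:
  assumes "\<And>c x. c \<in> C \<Longrightarrow> x \<in> chart_img c \<Longrightarrow> f c x = h c x"
  shows "integ f = integ h"
  unfolding integ_def
proof (rule sum.cong[OF refl])
  fix c assume c: "c \<in> C"
  show "(LINT x:chart_img c|lborel. wt c x * f c x * vol c x) = (LINT x:chart_img c|lborel. wt c x * h c x * vol c x)"
    by (rule set_lebesgue_integral_cong) (use open_img[OF C_subset[OF c]] assms[OF c] in auto)
qed

lemma integ_linear:
  assumes "\<And>c. c \<in> C \<Longrightarrow> continuous_on (chart_img c) (f c)" "\<And>c. c \<in> C \<Longrightarrow> continuous_on (chart_img c) (h c)"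
  shows "integ (\<lambda>c x. a * f c x + b * h c x) = a * integ f + b * integ h"
proof -
  have "(LINT x:chart_img c|lborel. wt c x * (a * f c x + b * h c x) * vol c x) =
      a * (LINT x:chart_img c|lborel. wt c x * f c x * vol c x) + b * (LINT x:chart_img c|lborel. wt c x * h c x * vol c x)"
    if c: "c \<in> C" for c
  proof -
    have "(LINT x:chart_img c|lborel. wt c x * (a * f c x + b * h c x) * vol c x) =
       (LINT x:chart_img c|lborel. a * (wt c x * f c x * vol c x) + b * (wt c x * h c x * vol c x))"
      by (simp add: algebra_simps)
    then show ?thesis
      using integrable_wt[OF c assms(1)[OF c]] integrable_wt[OF c assms(2)[OF c]]
      by (simp add: set_integral_add)
  qed
  then show ?thesis
    by (simp add: integ_def sum.distrib sum_distrib_left)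
qed

lemma integ_nonneg:
  assumes "\<And>c x. c \<in> C \<Longrightarrow> x \<in> chart_img c \<Longrightarrow> 0 \<le> f c x"
  shows "0 \<le> integ f"
  unfolding integ_def set_lebesgue_integral_def
proof (intro sum_nonneg Bochner_Integration.integral_nonneg)
  fix c x assume c: "c \<in> C"
  show "0 \<le> indicator (chart_img c) x *\<^sub>R (wt c x * f c x * vol c x)"
    using assms[OF c, of x] rho_nonneg[OF c chart_inv_top[OF C_subset[OF c]], of x] vol_pos[OF C_subset[OF c], of x]
    by (cases "x \<in> chart_img c") auto
qed

text \<open>The function \<open>Y(\<rho>\<^sub>c)\<close> seen in chart \<open>d\<close>. The two
  charts are separate arguments because the divergence theorem moves the derivative of one partition
  function between charts.\<close>

definition rho_deriv :: "('m, 'n) vfield \<Rightarrow> ('m, 'n) chart \<Rightarrow> ('m, 'n) chart \<Rightarrow> real ^ 'n \<Rightarrow> real" where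
  "rho_deriv Y c d x = (\<Sum>i\<in>UNIV. pd i (\<lambda>y. \<rho> c (chart_inv d y)) x * Y d x $ i)"

section \<open>The divergence theorem\<close>

context
  fixes Y :: "('m, 'n) vfield"
  assumes Y: "vector_field A Y"
begin

lemma smooth_Y: "c \<in> A \<Longrightarrow> smooth_on (chart_img c) (Y c)"
  using Y by (auto simp: vector_field_def)

lemma continuous_rho_deriv:
  assumes "c \<in> C" "d \<in> A"
  shows "continuous_on (chart_img d) (rho_deriv Y c d)"
  unfolding rho_deriv_def[abs_def]
  by (intro smooth_on_imp_continuous_on open_img assms smooth_on_sum smooth_on_mult smooth_on_pd smooth_rho
      smooth_on_vec_nth smooth_Y)

lemma rho_deriv_eq_0:
  assumes c: "c \<in> C" and d: "d \<in> A" and x: "x \<in> chart_img d" "chart_inv d x \<notin> supp c"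
  shows "rho_deriv Y c d x = 0"
proof -
  define N where "N = chart_map d ` (chart_dom d \<inter> (topspace T - supp c))"
  have N: "open N" unfolding N_def by (rule open_image[OF d]) (intro openin_diff openin_topspace closedin_supp)
  have xN: "x \<in> N"
    unfolding N_def using x chart_inv_in[OF d x(1)] chart_inv_top[OF d x(1)] chart_map_inv[OF d x(1)]
    by (intro image_eqI[of _ _ "chart_inv d x"]) auto
  have "pd i (\<lambda>y. \<rho> c (chart_inv d y)) x = pd i (\<lambda>y. 0) x" for i
    by (rule pd_cong[OF N xN smooth_on_imp_differentiable[OF open_img[OF d] smooth_rho[OF c d] x(1)]])
      (auto simp: N_def chart_inv_map[OF d] rho_eq_0)
  then show ?thesis by (simp add: rho_deriv_def pd_const)
qed

text \<open>The Jacobian produced by the chain rule is absorbed by the transformation law of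
  \<open>Y\<close>.\<close>

lemma rho_deriv_transition:
  assumes e: "e \<in> C" and c: "c \<in> A" and d: "d \<in> A" and x: "x \<in> overlap c d"
  shows "rho_deriv Y e d (transition c d x) = rho_deriv Y e c x"
proof -
  let ?y = "transition c d x" and ?u = "\<lambda>y. \<rho> e (chart_inv d y)"
  have xc: "x \<in> chart_img c" and yd: "?y \<in> chart_img d"
    using x transition_in[OF c d x] overlap_subset by blast+
  have u: "?u differentiable (at ?y)"
    by (rule smooth_on_imp_differentiable[OF open_img[OF d] smooth_rho[OF e d] yd])
  have "pd i (\<lambda>y. \<rho> e (chart_inv c y)) x = pd i (\<lambda>y. ?u (transition c d y)) x" for i
    by (rule pd_cong[OF open_overlap[OF c d] x smooth_on_imp_differentiable[OF open_img[OF c] smooth_rho[OF e c] xc]])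
      (simp add: chart_inv_transition[OF c d])
  then have pdx: "pd i (\<lambda>y. \<rho> e (chart_inv c y)) x = (\<Sum>j\<in>UNIV. pd j ?u ?y * jac c d x $ j $ i)" for i
    using pd_transition[OF c d x u] by simp
  have Yt: "Y d ?y = jac c d x *v Y c x"
    using Y c d x by (auto simp: vector_field_def)
  have "rho_deriv Y e c x = (\<Sum>i\<in>UNIV. \<Sum>j\<in>UNIV. pd j ?u ?y * (jac c d x $ j $ i * Y c x $ i))"
    by (simp add: rho_deriv_def pdx sum_distrib_right mult.assoc)
  also have "\<dots> = (\<Sum>j\<in>UNIV. pd j ?u ?y * (jac c d x *v Y c x) $ j)"
    by (subst sum.swap) (simp add: matrix_vector_mult_def sum_distrib_left)
  finally show ?thesis by (simp add: rho_deriv_def Yt)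
qed

lemma set_integral_eq_overlap:
  assumes "c \<in> A" "d \<in> A" "\<And>x. x \<in> chart_img c \<Longrightarrow> x \<notin> overlap c d \<Longrightarrow> f x = 0"
  shows "(LINT x:chart_img c|lborel. f x) = (LINT x:overlap c d|lborel. (f x :: real))"
  unfolding set_lebesgue_integral_def
proof (rule Bochner_Integration.integral_cong[OF refl])
  fix x
  show "indicator (chart_img c) x *\<^sub>R f x = indicator (overlap c d) x *\<^sub>R f x"
    using assms(3)[of x] overlap_subset[of c d] by (cases "x \<in> chart_img c"; cases "x \<in> overlap c d") auto
qed

text \<open>In chart \<open>c\<close> the factor \<open>\<rho>\<^sub>d\<close>, and in chart
  \<open>d\<close> the derivative of \<open>\<rho>\<^sub>c\<close>, vanishes off the overlap. There
  both integrands represent the same function, so the change of variables identifies the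
  integrals.\<close>

lemma integral_rho_deriv_swap:
  assumes c: "c \<in> C" and d: "d \<in> C"
  shows "(LINT x:chart_img c|lborel. \<rho> d (chart_inv c x) * rho_deriv Y c c x * vol c x) =
     (LINT x:chart_img d|lborel. wt d x * rho_deriv Y c d x * vol d x)"
proof -
  have cA: "c \<in> A" and dA: "d \<in> A" using c d C_subset by auto
  have "(LINT x:chart_img d|lborel. wt d x * rho_deriv Y c d x * vol d x) =
    (LINT x:overlap d c|lborel. wt d x * rho_deriv Y c d x * vol d x)"
  proof (rule set_integral_eq_overlap[OF dA cA])
    fix x assume "x \<in> chart_img d" "x \<notin> overlap d c"
    then have "rho_deriv Y c d x = 0"
      using overlap_iff[OF dA] supp_subset[OF c] by (intro rho_deriv_eq_0[OF c dA]) auto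
    then show "wt d x * rho_deriv Y c d x * vol d x = 0" by simp
  qed
  also have "\<dots> = (LINT x:overlap c d|lborel. wt d (transition c d x) * rho_deriv Y c d (transition c d x) * vol c x)"
    by (rule set_integral_transition[OF cA dA])
      (intro continuous_intros continuous_on_subset[OF continuous_rho[OF d dA] overlap_subset]
        continuous_on_subset[OF continuous_rho_deriv[OF c dA] overlap_subset])
  also have "\<dots> = (LINT x:overlap c d|lborel. \<rho> d (chart_inv c x) * rho_deriv Y c c x * vol c x)"
    by (rule set_lebesgue_integral_cong)
      (use open_overlap[OF cA dA] in \<open>auto simp: chart_inv_transition[OF cA dA] rho_deriv_transition[OF c cA dA]\<close>)
  also have "\<dots> = (LINT x:chart_img c|lborel. \<rho> d (chart_inv c x) * rho_deriv Y c c x * vol c x)"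
  proof (rule set_integral_eq_overlap[OF cA dA, symmetric])
    fix x assume "x \<in> chart_img c" "x \<notin> overlap c d"
    then have "\<rho> d (chart_inv c x) = 0"
      using overlap_iff[OF cA] supp_subset[OF d] chart_inv_top[OF cA] by (intro rho_eq_0) auto
    then show "\<rho> d (chart_inv c x) * rho_deriv Y c c x * vol c x = 0" by simp
  qed
  finally show ?thesis ..
qed

text \<open>The field \<open>wt c * vol c * Y\<close> vanishes outside a compact part of the chart
  image, so its coordinate divergence integrates to 0; the product rule splits it into the two
  integrands.\<close>

lemma integral_wt_div:
  assumes c: "c \<in> C"
  shows "(LINT x:chart_img c|lborel. wt c x * div_vec (g c) (Y c) x * vol c x) =
     - (LINT x:chart_img c|lborel. rho_deriv Y c c x * vol c x)"
proof -
  have cA: "c \<in> A" using c C_subset by auto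
  let ?V = "chart_img c"
  let ?F = "\<lambda>i x. wt c x * (vol c x * Y c x $ i)"
  have sF: "smooth_on ?V (?F i)" for i
    by (intro smooth_on_mult open_img cA smooth_rho c smooth_vol smooth_on_vec_nth smooth_Y)
  have z: "?F i x = 0" if "x \<in> ?V - chart_supp c" for i x using wt_eq_0[OF c that] by simp
  have rd0: "rho_deriv Y c c x = 0" if "x \<in> ?V - chart_supp c" for x
    using rho_deriv_eq_0[OF c cA] notin_supp[OF c that] that by auto
  have eq: "wt c x * div_vec (g c) (Y c) x * vol c x = (\<Sum>i\<in>UNIV. pd i (?F i) x) - rho_deriv Y c c x * vol c x"
    if x: "x \<in> ?V" for x
  proof -
    have "pd i (?F i) x = pd i (wt c) x * (vol c x * Y c x $ i) + wt c x * pd i (\<lambda>y. vol c y * Y c y $ i) x" for i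
      by (rule pd_mult) (intro smooth_on_imp_differentiable[OF open_img[OF cA] _ x] smooth_on_mult open_img cA
          smooth_rho c smooth_vol smooth_on_vec_nth smooth_Y)+
    then have "(\<Sum>i\<in>UNIV. pd i (?F i) x) = rho_deriv Y c c x * vol c x + wt c x * (\<Sum>i\<in>UNIV. pd i (\<lambda>y. vol c y * Y c y $ i) x)"
      by (simp add: rho_deriv_def sum.distrib sum_distrib_left sum_distrib_right mult_ac)
    then show ?thesis
      using metric_chart.div_vec_sqrt_det[OF metric_chart[OF cA] smooth_Y[OF cA] x] by (simp add: mult.assoc)
  qed
  have pd0: "pd i (?F i) x = 0" if x: "x \<in> ?V - chart_supp c" for i x
  proof -
    have "pd i (?F i) x = pd i (\<lambda>y. 0) x"
      by (rule pd_cong[of "?V - chart_supp c", OF _ x smooth_on_imp_differentiable[OF open_img[OF cA] sF]])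
        (use x z compact_chart_supp[OF c] open_img[OF cA] in \<open>auto intro: open_Diff compact_imp_closed\<close>)
    then show ?thesis by (simp add: pd_const)
  qed
  have int1: "set_integrable lborel ?V (\<lambda>x. pd i (?F i) x)" for i
    by (rule set_integrable_compact_support[OF open_img[OF cA] compact_chart_supp[OF c] chart_supp_subset[OF c] _ pd0])
      (intro smooth_on_imp_continuous_on open_img cA smooth_on_pd sF)
  have int2: "set_integrable lborel ?V (\<lambda>x. rho_deriv Y c c x * vol c x)"
    by (rule set_integrable_compact_support[OF open_img[OF cA] compact_chart_supp[OF c] chart_supp_subset[OF c]])
      (auto intro!: continuous_intros continuous_rho_deriv c cA continuous_vol simp: rd0)
  have "(LINT x:?V|lborel. wt c x * div_vec (g c) (Y c) x * vol c x) =
     (LINT x:?V|lborel. (\<Sum>i\<in>UNIV. pd i (?F i) x) - rho_deriv Y c c x * vol c x)"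
    by (rule set_lebesgue_integral_cong) (use open_img[OF cA] eq in auto)
  also have "\<dots> = (LINT x:?V|lborel. (\<Sum>i\<in>UNIV. pd i (?F i) x)) - (LINT x:?V|lborel. rho_deriv Y c c x * vol c x)"
    by (rule set_integral_diff(2)[OF set_integral_sum(1)[OF int1] int2])
  also have "(LINT x:?V|lborel. (\<Sum>i\<in>UNIV. pd i (?F i) x)) = (\<Sum>i\<in>UNIV. LINT x:?V|lborel. pd i (?F i) x)"
    by (rule set_integral_sum(2)[OF int1])
  also have "\<dots> = 0"
    by (intro sum.neutral ballI set_integral_pd_eq_0[OF open_img[OF cA] compact_chart_supp[OF c] chart_supp_subset[OF c] sF z])
  finally show ?thesis by simp
qed

text \<open>On a single chart \<open>\<integral> \<rho>\<^sub>c div Y = - \<integral> Y(\<rho>\<^sub>c)\<close>. Inserting \<open>1 = \<Sum>\<^sub>d \<rho>\<^sub>d\<close> and moving the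
  \<open>\<rho>\<^sub>d\<close>-part to the chart \<open>d\<close>, the sum over \<open>c\<close> becomes the derivative of \<open>\<Sum>\<^sub>c \<rho>\<^sub>c = 1\<close>.\<close>

theorem divergence_theorem: "integ (\<lambda>c. div_vec (g c) (Y c)) = 0"
proof -
  let ?B = "\<lambda>c d. LINT x:chart_img c|lborel. \<rho> d (chart_inv c x) * rho_deriv Y c c x * vol c x"
  have 1: "(LINT x:chart_img c|lborel. rho_deriv Y c c x * vol c x) = (\<Sum>d\<in>C. ?B c d)" if c: "c \<in> C" for c
  proof -
    have cA: "c \<in> A" using c C_subset by auto
    have rd0: "rho_deriv Y c c x = 0" if "x \<in> chart_img c - chart_supp c" for x
      using rho_deriv_eq_0[OF c cA] notin_supp[OF c that] that by auto
    have int: "set_integrable lborel (chart_img c) (\<lambda>x. \<rho> d (chart_inv c x) * rho_deriv Y c c x * vol c x)" if "d \<in> C" for d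
      by (rule set_integrable_compact_support[OF open_img[OF cA] compact_chart_supp[OF c] chart_supp_subset[OF c]])
        (auto intro!: continuous_intros continuous_rho_deriv continuous_rho c cA that continuous_vol simp: rd0)
    have "(LINT x:chart_img c|lborel. rho_deriv Y c c x * vol c x) =
      (LINT x:chart_img c|lborel. \<Sum>d\<in>C. \<rho> d (chart_inv c x) * rho_deriv Y c c x * vol c x)"
    proof (rule set_lebesgue_integral_cong)
      show "\<forall>x. x \<in> chart_img c \<longrightarrow> rho_deriv Y c c x * vol c x = (\<Sum>d\<in>C. \<rho> d (chart_inv c x) * rho_deriv Y c c x * vol c x)"
        using sum_rho[OF chart_inv_top[OF cA]] by (simp flip: sum_distrib_right)
    qed (use open_img[OF cA] in auto)
    also have "\<dots> = (\<Sum>d\<in>C. ?B c d)"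
      by (rule set_integral_sum(2)[OF int])
    finally show ?thesis .
  qed
  have 2: "(\<Sum>c\<in>C. LINT x:chart_img d|lborel. wt d x * rho_deriv Y c d x * vol d x) = 0" if d: "d \<in> C" for d
  proof -
    have dA: "d \<in> A" using d C_subset by auto
    have sum0: "(\<Sum>c\<in>C. rho_deriv Y c d x) = 0" if x: "x \<in> chart_img d" for x
    proof -
      have dif: "(\<lambda>y. \<rho> c (chart_inv d y)) differentiable (at x)" if "c \<in> C" for c
        by (rule smooth_on_imp_differentiable[OF open_img[OF dA] smooth_rho[OF that dA] x])
      have "(\<Sum>c\<in>C. pd i (\<lambda>y. \<rho> c (chart_inv d y)) x) = 0" for i
      proof -
        have "(\<Sum>c\<in>C. pd i (\<lambda>y. \<rho> c (chart_inv d y)) x) = pd i (\<lambda>y. \<Sum>c\<in>C. \<rho> c (chart_inv d y)) x"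
          by (rule pd_sum[OF dif, symmetric])
        also have "\<dots> = pd i (\<lambda>y. 1) x"
          by (rule pd_cong[OF open_img[OF dA] x]) (auto intro!: differentiable_sum finite_C dif sum_rho chart_inv_top[OF dA])
        finally show ?thesis by (simp add: pd_const)
      qed
      then have "(\<Sum>i\<in>UNIV. (\<Sum>c\<in>C. pd i (\<lambda>y. \<rho> c (chart_inv d y)) x) * Y d x $ i) = 0" by simp
      then show ?thesis
        unfolding rho_deriv_def by (subst sum.swap) (simp add: sum_distrib_right)
    qed
    have "(\<Sum>c\<in>C. LINT x:chart_img d|lborel. wt d x * rho_deriv Y c d x * vol d x) =
       (LINT x:chart_img d|lborel. \<Sum>c\<in>C. wt d x * rho_deriv Y c d x * vol d x)"
      by (rule set_integral_sum(2)[OF integrable_wt[OF d continuous_rho_deriv[OF _ dA]], symmetric])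
    also have "\<dots> = (LINT x:chart_img d|lborel. 0)"
      by (rule set_lebesgue_integral_cong)
        (use open_img[OF dA] sum0 in \<open>auto simp flip: sum_distrib_right sum_distrib_left\<close>)
    finally show ?thesis by (simp add: set_lebesgue_integral_def)
  qed
  have "integ (\<lambda>c. div_vec (g c) (Y c)) = - (\<Sum>c\<in>C. \<Sum>d\<in>C. ?B c d)"
    unfolding integ_def by (simp add: integral_wt_div 1 sum_negf)
  also have "(\<Sum>c\<in>C. \<Sum>d\<in>C. ?B c d) = (\<Sum>c\<in>C. \<Sum>d\<in>C. LINT x:chart_img d|lborel. wt d x * rho_deriv Y c d x * vol d x)"
    by (intro sum.cong refl integral_rho_deriv_swap)
  also have "\<dots> = (\<Sum>d\<in>C. \<Sum>c\<in>C. LINT x:chart_img d|lborel. wt d x * rho_deriv Y c d x * vol d x)"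
    by (rule sum.swap)
  also have "\<dots> = 0" by (simp add: 2)
  finally show ?thesis by simp
qed

end

end

subsection \<open>Change of coordinates for \<open>\<nabla>\<^sub>X X\<close> and \<open>S(X, \<cdot>)\<close>\<close>

context closed_riemannian
begin

context
  fixes X :: "('m, 'n) vfield"
  assumes X: "vector_field A X"
begin

lemma smooth_X: "c \<in> A \<Longrightarrow> smooth_on (chart_img c) (X c)"
  using X by (auto simp: vector_field_def)

lemmas grad_form_def = metric_chart.grad_form_def[OF metric_chart smooth_X]
  and curl_form_def = metric_chart.curl_form_def[OF metric_chart smooth_X]

abbreviation grad :: "('m, 'n) vfield" where "grad c \<equiv> metric_chart.grad_form (g c) (X c)"
abbreviation curl :: "('m, 'n) vfield" where "curl c \<equiv> metric_chart.curl_form (g c) (X c)"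

context
  fixes c d assumes c: "c \<in> A" and d: "d \<in> A"
begin

abbreviation tr :: "real ^ 'n \<Rightarrow> real ^ 'n" where "tr \<equiv> transition c d"
abbreviation J :: "real ^ 'n \<Rightarrow> real ^ 'n ^ 'n" where "J x \<equiv> jac c d x"

lemma X_transition: "x \<in> overlap c d \<Longrightarrow> X d (tr x) = J x *v X c x"
  using X c d by (auto simp: vector_field_def)

lemma tr_img: "x \<in> overlap c d \<Longrightarrow> tr x \<in> chart_img d" "x \<in> overlap c d \<Longrightarrow> x \<in> chart_img c"
  using transition_in[OF c d] overlap_subset by blast+

lemma lower_transition:
  assumes x: "x \<in> overlap c d"
  shows "lower (g c) (X c) x = transpose (J x) *v lower (g d) (X d) (tr x)"
  by (simp add: lower_def X_transition[OF x] g_transform[OF c d x] matrix_vector_mul_assoc matrix_mul_assoc)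

lemma norm2_transition:
  assumes x: "x \<in> overlap c d"
  shows "norm2_vec (g d) (X d) (tr x) = norm2_vec (g c) (X c) x"
proof -
  have "norm2_vec (g c) (X c) x = X c x \<bullet> (transpose (J x) *v lower (g d) (X d) (tr x))"
    using lower_transition[OF x] by (simp add: norm2_vec_def lower_def)
  also have "\<dots> = (J x *v X c x) \<bullet> lower (g d) (X d) (tr x)"
    by (metis dot_lmul_matrix inner_commute transpose_matrix_vector)
  finally show ?thesis
    by (simp add: norm2_vec_def lower_def X_transition[OF x])
qed

lemma grad_transition:
  assumes x: "x \<in> overlap c d"
  shows "grad c x = transpose (J x) *v grad d (tr x)"
proof (rule vec_eq_iff[THEN iffD2], rule allI)
  fix i
  have sm: "smooth_on (chart_img e) (norm2_vec (g e) (X e))" if "e \<in> A" for e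
    by (rule metric_chart.smooth_norm2_vec[OF metric_chart smooth_X]) (rule that)+
  have "pd i (norm2_vec (g c) (X c)) x = pd i (\<lambda>y. norm2_vec (g d) (X d) (tr y)) x"
    by (rule pd_cong[OF open_overlap[OF c d] x smooth_on_imp_differentiable[OF open_img[OF c] sm[OF c]]])
      (simp_all add: norm2_transition tr_img x)
  also have "\<dots> = (\<Sum>j\<in>UNIV. pd j (norm2_vec (g d) (X d)) (tr x) * J x $ j $ i)"
    by (rule pd_transition[OF c d x smooth_on_imp_differentiable[OF open_img[OF d] sm[OF d]]])
      (rule tr_img[OF x])
  finally show "grad c x $ i = (transpose (J x) *v grad d (tr x)) $ i"
    by (simp add: grad_form_def[OF c c] grad_form_def[OF d d] matrix_vector_mult_def transpose_def mult.commute)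
qed

text \<open>Differentiating the transformation law of the lowered field produces second derivatives
  of the transition map. They are symmetric in the two lower indices and drop out of the
  antisymmetric difference.\<close>

lemma curl_transition:
  assumes x: "x \<in> overlap c d"
  shows "curl c x = transpose (J x) *v curl d (tr x)"
proof (rule vec_eq_iff[THEN iffD2], rule allI)
  fix b
  let ?l = "\<lambda>m y. lower (g d) (X d) y $ m"
  let ?D = "\<lambda>k m. pd k (?l m) (tr x)"
  have sm: "smooth_on (chart_img e) (\<lambda>y. lower (g e) (X e) y $ m)" if "e \<in> A" for e m
    by (rule metric_chart.smooth_lower_nth[OF metric_chart smooth_X]) (rule that)+
  have dl: "(?l m) differentiable (at (tr x))" for m
    by (rule smooth_on_imp_differentiable[OF open_img[OF d] sm[OF d] tr_img(1)[OF x]])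
  have dlt: "(\<lambda>y. ?l m (tr y)) differentiable (at x)" for m
    using differentiable_chain_at[of tr x "?l m", OF _ dl] transition_derivative[OF c d x]
    by (auto simp: o_def differentiable_def)
  have dJ: "(\<lambda>y. J y $ m $ a) differentiable (at x)" for m a
    by (rule smooth_on_imp_differentiable[OF open_overlap[OF c d] smooth_jac_nth[OF c d] x])
  have pdl: "pd a (\<lambda>y. lower (g c) (X c) y $ b) x =
      (\<Sum>m\<in>UNIV. pd a (\<lambda>y. J y $ m $ b) x * ?l m (tr x)) + (\<Sum>m\<in>UNIV. \<Sum>k\<in>UNIV. J x $ m $ b * J x $ k $ a * ?D k m)" for a b
  proof -
    have "pd a (\<lambda>y. lower (g c) (X c) y $ b) x = pd a (\<lambda>y. \<Sum>m\<in>UNIV. J y $ m $ b * ?l m (tr y)) x"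
      by (rule pd_cong[OF open_overlap[OF c d] x smooth_on_imp_differentiable[OF open_img[OF c] sm[OF c]]])
        (simp_all add: tr_img x lower_transition matrix_vector_mult_def transpose_def)
    also have "\<dots> = (\<Sum>m\<in>UNIV. pd a (\<lambda>y. J y $ m $ b * ?l m (tr y)) x)"
      by (rule pd_sum) (intro differentiable_mult dJ dlt)
    also have "\<dots> = (\<Sum>m\<in>UNIV. pd a (\<lambda>y. J y $ m $ b) x * ?l m (tr x) + J x $ m $ b * (\<Sum>k\<in>UNIV. ?D k m * J x $ k $ a))"
      by (simp add: pd_mult dJ dlt pd_transition[OF c d x dl])
    finally show ?thesis by (simp add: sum.distrib sum_distrib_left mult_ac)
  qed
  have anti: "pd a (\<lambda>y. lower (g c) (X c) y $ b) x - pd b (\<lambda>y. lower (g c) (X c) y $ a) x =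
      (\<Sum>m\<in>UNIV. \<Sum>k\<in>UNIV. J x $ m $ b * J x $ k $ a * (?D k m - ?D m k))" for a
  proof -
    have "(\<Sum>m\<in>UNIV. \<Sum>k\<in>UNIV. J x $ m $ a * J x $ k $ b * ?D k m) = (\<Sum>m\<in>UNIV. \<Sum>k\<in>UNIV. J x $ m $ b * J x $ k $ a * ?D m k)"
      by (subst sum.swap) (simp add: mult_ac)
    then show ?thesis
      by (simp add: pdl pd_jac_commute[OF c d x, of a] right_diff_distrib sum_subtractf)
  qed
  have "curl c x $ b = (\<Sum>a\<in>UNIV. \<Sum>m\<in>UNIV. \<Sum>k\<in>UNIV. J x $ m $ b * ((J x $ k $ a * X c x $ a) * (?D k m - ?D m k)))"
    by (simp add: curl_form_def[OF c c] anti sum_distrib_left mult_ac)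
  also have "\<dots> = (\<Sum>m\<in>UNIV. \<Sum>a\<in>UNIV. \<Sum>k\<in>UNIV. J x $ m $ b * ((J x $ k $ a * X c x $ a) * (?D k m - ?D m k)))"
    by (rule sum.swap)
  also have "\<dots> = (\<Sum>m\<in>UNIV. \<Sum>k\<in>UNIV. \<Sum>a\<in>UNIV. J x $ m $ b * ((J x $ k $ a * X c x $ a) * (?D k m - ?D m k)))"
    by (intro sum.cong refl sum.swap)
  also have "\<dots> = (\<Sum>m\<in>UNIV. J x $ m $ b * (\<Sum>k\<in>UNIV. (\<Sum>a\<in>UNIV. J x $ k $ a * X c x $ a) * (?D k m - ?D m k)))"
    by (simp add: sum_distrib_left sum_distrib_right)
  also have "\<dots> = (\<Sum>m\<in>UNIV. J x $ m $ b * curl d (tr x) $ m)"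
    by (simp add: curl_form_def[OF d d] X_transition[OF x] matrix_vector_mult_def)
  finally show "curl c x $ b = (transpose (J x) *v curl d (tr x)) $ b"
    by (simp add: matrix_vector_mult_def transpose_def)
qed

text \<open>The factor \<open>a\<close> covers two fields at once: \<open>1/2\<close> gives
  \<open>\<nabla>\<^sub>X X\<close>, and 1 gives the stress flux.\<close>

lemma raise_form_transition:
  assumes x: "x \<in> overlap c d"
  shows "matrix_inv (g d (tr x)) *v (a *\<^sub>R grad d (tr x) + curl d (tr x)) =
    J x *v (matrix_inv (g c x) *v (a *\<^sub>R grad c x + curl c x))"
  by (rule raise_transform[OF c d x])
    (simp add: grad_transition[OF x] curl_transition[OF x] matrix_vector_right_distrib matrix_vector_mult_scaleR)

end

lemma vector_field_cov_along: "vector_field A (\<lambda>c. cov_along (g c) (X c) (X c))"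
  unfolding vector_field_def
proof (intro conjI ballI)
  fix c assume c: "c \<in> A"
  show "smooth_on (chart_img c) (cov_along (g c) (X c) (X c))"
    by (rule metric_chart.smooth_cov_along[OF metric_chart[OF c] smooth_X[OF c]])
next
  fix c d x assume cd: "c \<in> A" "d \<in> A" and x: "x \<in> overlap c d"
  show "cov_along (g d) (X d) (X d) (transition c d x) = jac c d x *v cov_along (g c) (X c) (X c) x"
    using raise_form_transition[OF cd x, of "1/2"] tr_img[OF cd x]
    by (simp add: metric_chart.cov_along_eq[OF metric_chart smooth_X] cd)
qed

lemma vector_field_stress_flux: "vector_field A (\<lambda>c. metric_chart.stress_flux (g c) (X c))"
  unfolding vector_field_def
proof (intro conjI ballI)
  fix c assume c: "c \<in> A"
  show "smooth_on (chart_img c) (metric_chart.stress_flux (g c) (X c))"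
    by (rule metric_chart.smooth_stress_flux[OF metric_chart[OF c] smooth_X[OF c]])
next
  fix c d x assume cd: "c \<in> A" "d \<in> A" and x: "x \<in> overlap c d"
  show "metric_chart.stress_flux (g d) (X d) (transition c d x) = jac c d x *v metric_chart.stress_flux (g c) (X c) x"
    using raise_form_transition[OF cd x, of 1] tr_img[OF cd x]
    by (simp add: metric_chart.stress_flux_eq[OF metric_chart smooth_X] cd)
qed

lemma vector_field_norm2_X: "vector_field A (\<lambda>c y. norm2_vec (g c) (X c) y *\<^sub>R X c y)"
  unfolding vector_field_def
proof (intro conjI ballI)
  fix c assume c: "c \<in> A"
  show "smooth_on (chart_img c) (\<lambda>y. norm2_vec (g c) (X c) y *\<^sub>R X c y)"
    by (intro smooth_on_scaleR open_img c smooth_X metric_chart.smooth_norm2_vec[OF metric_chart[OF c] smooth_X[OF c]])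
next
  fix c d x assume cd: "c \<in> A" "d \<in> A" and x: "x \<in> overlap c d"
  show "norm2_vec (g d) (X d) (transition c d x) *\<^sub>R X d (transition c d x) = jac c d x *v (norm2_vec (g c) (X c) x *\<^sub>R X c x)"
    by (simp add: norm2_transition[OF cd x] X_transition[OF cd x] matrix_vector_mult_scaleR)
qed

end

end

section \<open>Decay of the kinetic energy\<close>

lemma smooth_on_imp_differentiable_on: "smooth_on S f \<Longrightarrow> f differentiable_on S"
  unfolding smooth_on_def by (drule spec[of _ "[]"]) simp

lemma smooth_on_imp_frechet_derivative_differentiable_on:
  "smooth_on S f \<Longrightarrow> b \<in> Basis \<Longrightarrow> (\<lambda>x. frechet_derivative f (at x within S) b) differentiable_on S"
  unfolding smooth_on_def by (drule spec[of _ "[b]"]) simp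

context partitioned_riemannian
begin

text \<open>The divergence separating the energy density from the square integrates to zero, because
  \<open>\<nabla>\<^sub>X X\<close> is a global vector field.\<close>

lemma integ_energy_density:
  assumes X: "vector_field A X" and div: "\<And>c x. c \<in> A \<Longrightarrow> x \<in> chart_img c \<Longrightarrow> div_vec (g c) (X c) x = 0"
  shows "integ (\<lambda>c x. norm2_cov (g c) (X c) x + \<bar>div_vec (g c) (X c) x\<bar>\<^sup>2 - ricci_quad (g c) (X c) x) =
    integ (\<lambda>c. metric_chart.stress_norm2 (g c) (X c)) / 2"
proof -
  have "integ (\<lambda>c x. norm2_cov (g c) (X c) x + \<bar>div_vec (g c) (X c) x\<bar>\<^sup>2 - ricci_quad (g c) (X c) x) =
     integ (\<lambda>c x. (1/2) * metric_chart.stress_norm2 (g c) (X c) x + (-1) * div_vec (g c) (cov_along (g c) (X c) (X c)) x)"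
    using metric_chart.energy_density_eq[OF metric_chart smooth_X[OF X]] div C_subset
    by (intro integ_cong) simp
  also have "\<dots> = (1/2) * integ (\<lambda>c. metric_chart.stress_norm2 (g c) (X c)) +
     (-1) * integ (\<lambda>c. div_vec (g c) (cov_along (g c) (X c) (X c)))"
    using C_subset
    by (intro integ_linear smooth_on_imp_continuous_on open_img metric_chart.smooth_stress_norm2[OF metric_chart smooth_X[OF X]]
        metric_chart.smooth_div_vec[OF metric_chart] metric_chart.smooth_cov_along[OF metric_chart smooth_X[OF X]]) auto
  finally show ?thesis
    using divergence_theorem[OF vector_field_cov_along[OF X]] by simp
qed

lemma integ_stress_norm2_nonneg:
  assumes X: "vector_field A X"
  shows "0 \<le> integ (\<lambda>c. metric_chart.stress_norm2 (g c) (X c))"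
  by (intro integ_nonneg metric_chart.stress_norm2_nonneg[OF metric_chart smooth_X[OF X]] C_subset)

context
  fixes I :: "real set" and X :: "real \<Rightarrow> ('m, 'n) vfield"
  assumes I: "is_interval I" "interior I \<noteq> {}" and NS: "navier_stokes_solution A g I X"
begin

lemma vector_field_X: "t \<in> I \<Longrightarrow> vector_field A (X t)"
  using NS by (auto simp: navier_stokes_solution_def time_dependent_vector_field_def)

lemma smooth_jointly: "c \<in> A \<Longrightarrow> smooth_on (I \<times> chart_img c) (\<lambda>(t, x). X t c x)"
  using NS by (auto simp: navier_stokes_solution_def time_dependent_vector_field_def)

lemma div_X: "t \<in> I \<Longrightarrow> c \<in> A \<Longrightarrow> x \<in> chart_img c \<Longrightarrow> div_vec (g c) (X t c) x = 0"
  using NS by (auto simp: navier_stokes_solution_def)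

text \<open>The time derivative is read off the derivative within the joint domain, since joint
  smoothness then yields its continuity in time and space, as differentiation under the integral
  requires.\<close>

definition X_dot :: "('m, 'n) chart \<Rightarrow> real \<Rightarrow> real ^ 'n \<Rightarrow> real ^ 'n" where
  "X_dot c t x = frechet_derivative (\<lambda>(t, x). X t c x) (at (t, x) within I \<times> chart_img c) (1, 0)"

lemma X_has_derivative:
  assumes c: "c \<in> A" and t: "t \<in> I" and x: "x \<in> chart_img c"
  shows "((\<lambda>s. X s c x) has_vector_derivative X_dot c t x) (at t within I)"
proof -
  let ?S = "I \<times> chart_img c" and ?f = "\<lambda>(t, x). X t c x"
  let ?D = "frechet_derivative ?f (at (t, x) within ?S)"
  have "?f differentiable (at (t, x) within ?S)"
    using smooth_on_imp_differentiable_on[OF smooth_jointly[OF c]] t x by (auto simp: differentiable_on_def)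
  then have D: "(?f has_derivative ?D) (at (t, x) within ?S)" by (simp add: frechet_derivative_works)
  have p: "((\<lambda>s. (s, x)) has_derivative (\<lambda>h. (h, 0))) (at t within I)"
    by (auto intro!: derivative_eq_intros)
  have "(?f has_derivative ?D) (at ((\<lambda>s. (s, x)) t) within (\<lambda>s. (s, x)) ` I)"
    by (rule has_derivative_subset[OF D]) (use x in auto)
  from has_derivative_in_compose[OF p this]
  have "((\<lambda>s. X s c x) has_derivative (\<lambda>h. ?D (h, 0))) (at t within I)" by simp
  moreover have "?D (h, 0) = h *\<^sub>R X_dot c t x" for h
    using linear_scale[OF has_derivative_linear[OF D], of h "(1, 0)"] by (simp add: X_dot_def)
  ultimately show ?thesis by (simp add: has_vector_derivative_def)
qed

lemma momentum_equation:
  assumes c: "c \<in> A" and t: "t \<in> I" and x: "x \<in> chart_img c"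
  shows "X_dot c t x = div_tensor (g c) (stress (g c) (X t c)) x - cov_along (g c) (X t c) (X t c) x"
proof -
  \<comment> \<open>A second point makes the connected set \<open>I\<close> perfect. Only at a limit
    point is the derivative within \<open>I\<close> unique, so that \<open>vector_derivative\<close>
    returns \<open>X_dot\<close>.\<close>
  obtain u where "u \<in> I" "u \<noteq> t"
  proof -
    obtain y e where "e > 0" "ball y e \<subseteq> I" using I(2) by (auto simp: mem_interior)
    then have "y \<in> I" "y + e / 2 \<in> I" "y \<noteq> y + e / 2" by (auto simp: subset_iff dist_real_def)
    then show ?thesis using that by metis
  qed
  then have "t islimpt I"
    using connected_imp_perfect[of I t] I(1) t by (auto simp: is_interval_connected)
  then have "at t within I \<noteq> bot" by (simp add: trivial_limit_within)
  then have vd: "vector_derivative (\<lambda>s. X s c x) (at t within I) = X_dot c t x"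
    by (rule vector_derivative_within[OF _ X_has_derivative[OF c t x]])
  have "vector_derivative (\<lambda>s. X s c x) (at t within I) + cov_along (g c) (X t c) (X t c) x =
      div_tensor (g c) (stress (g c) (X t c)) x"
    using NS c t x unfolding navier_stokes_solution_def by blast
  then show ?thesis unfolding vd by (simp only: eq_diff_eq)
qed

lemma kinetic_energy_has_derivative:
  assumes t: "t \<in> I"
  shows "((\<lambda>s. integ (\<lambda>c. norm2_vec (g c) (X s c))) has_real_derivative
     integ (\<lambda>c x. 2 * (X t c x \<bullet> (g c x *v X_dot c t x)))) (at t within I)"
  unfolding integ_def
proof (rule DERIV_sum)
  fix c assume c: "c \<in> C"
  have cA: "c \<in> A" using c C_subset by auto
  have conv: "convex I" using I(1) by (simp add: is_interval_convex_1)
  have ct: "continuous_on (I \<times> chart_img c) (\<lambda>z. f (snd z))" if "continuous_on (chart_img c) f" for f :: "real ^ 'n \<Rightarrow> real"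
    by (rule continuous_on_compose2[OF that]) (auto intro!: continuous_intros)
  have cX: "continuous_on (I \<times> chart_img c) (\<lambda>z. X (fst z) c (snd z) $ i)" for i
    using differentiable_imp_continuous_on[OF smooth_on_imp_differentiable_on[OF smooth_jointly[OF cA]]]
    by (intro continuous_on_component) (simp add: split_beta)
  have cXd: "continuous_on (I \<times> chart_img c) (\<lambda>z. X_dot c (fst z) (snd z) $ i)" for i
  proof -
    have "(1, 0) \<in> (Basis :: (real \<times> (real ^ 'n)) set)" by (simp add: Basis_prod_def)
    from differentiable_imp_continuous_on[OF smooth_on_imp_frechet_derivative_differentiable_on[OF smooth_jointly[OF cA] this]]
    show ?thesis by (intro continuous_on_component) (simp add: X_dot_def)
  qed
  have cg: "continuous_on (I \<times> chart_img c) (\<lambda>z. g c (snd z) $ i $ j)" for i j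
    by (rule ct[OF smooth_on_imp_continuous_on[OF open_img[OF cA] metric_chart.smooth_G_nth[OF metric_chart[OF cA]]]])
  show "((\<lambda>s. LINT x:chart_img c|lborel. wt c x * norm2_vec (g c) (X s c) x * vol c x) has_real_derivative
     (LINT x:chart_img c|lborel. wt c x * (2 * (X t c x \<bullet> (g c x *v X_dot c t x))) * vol c x)) (at t within I)"
  proof (rule set_integral_has_derivative[OF open_img[OF cA] compact_chart_supp[OF c] chart_supp_subset[OF c] conv t])
    fix s x assume s: "s \<in> I" and x: "x \<in> chart_img c"
    have dX: "((\<lambda>s. X s c x) has_derivative (\<lambda>h. h *\<^sub>R X_dot c s x)) (at s within I)"
      using X_has_derivative[OF cA s x] by (simp add: has_vector_derivative_def)
    have dgX: "((\<lambda>s. g c x *v X s c x) has_derivative (\<lambda>h. g c x *v (h *\<^sub>R X_dot c s x))) (at s within I)"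
      by (rule bounded_linear.has_derivative[OF matrix_vector_mul_bounded_linear dX])
    \<comment> \<open>The metric does not depend on time, and its symmetry makes the two
      product-rule terms equal.\<close>
    have "X s c x \<bullet> (g c x *v (h *\<^sub>R X_dot c s x)) + (h *\<^sub>R X_dot c s x) \<bullet> (g c x *v X s c x)
        = 2 * (X s c x \<bullet> (g c x *v X_dot c s x)) * h" for h
      using metric_chart.inner_G_commute[OF metric_chart[OF cA] x, of "X_dot c s x" "X s c x"]
      by (simp add: matrix_vector_mult_scaleR)
    then have "((\<lambda>s. norm2_vec (g c) (X s c) x) has_derivative (*) (2 * (X s c x \<bullet> (g c x *v X_dot c s x)))) (at s within I)"
      unfolding norm2_vec_def using has_derivative_inner[OF dX dgX] by simp
    then have "((\<lambda>s. norm2_vec (g c) (X s c) x) has_field_derivative 2 * (X s c x \<bullet> (g c x *v X_dot c s x))) (at s within I)"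
      by (simp add: has_field_derivative_def)
    then show "((\<lambda>s. wt c x * norm2_vec (g c) (X s c) x * vol c x) has_field_derivative
       wt c x * (2 * (X s c x \<bullet> (g c x *v X_dot c s x))) * vol c x) (at s within I)"
      by (intro DERIV_cmult DERIV_cmult_right)
  next
    fix s assume s: "s \<in> I"
    show "continuous_on (chart_img c) (\<lambda>x. wt c x * norm2_vec (g c) (X s c) x * vol c x)"
      by (intro continuous_on_mult continuous_rho c cA continuous_vol
          smooth_on_imp_continuous_on[OF open_img[OF cA] metric_chart.smooth_norm2_vec[OF metric_chart[OF cA] smooth_X[OF vector_field_X[OF s] cA]]])
  next
    show "continuous_on (I \<times> chart_img c) (\<lambda>(s, x). wt c x * (2 * (X s c x \<bullet> (g c x *v X_dot c s x))) * vol c x)"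
      unfolding split_beta inner_vec_def matrix_vector_mult_def vec_lambda_beta inner_real_def
      by (intro continuous_on_mult continuous_on_sum continuous_on_const cX cXd cg
          ct[OF continuous_rho[OF c cA]] ct[OF continuous_vol[OF cA]])
  qed (auto simp: wt_eq_0[OF c])
qed

lemma kinetic_energy_derivative_eq:
  assumes t: "t \<in> I"
  shows "integ (\<lambda>c x. 2 * (X t c x \<bullet> (g c x *v X_dot c t x))) =
    - integ (\<lambda>c. metric_chart.stress_norm2 (g c) (X t c))"
proof -
  note V = vector_field_X[OF t]
  let ?W = "\<lambda>c. metric_chart.stress_flux (g c) (X t c)" and ?N = "\<lambda>c y. norm2_vec (g c) (X t c) y *\<^sub>R X t c y"
  let ?S = "\<lambda>c. metric_chart.stress_norm2 (g c) (X t c)"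
  \<comment> \<open>The term of \<open>div_norm2_X\<close> in which \<open>|X|\<^sup>2\<close>
    multiplies \<open>div X\<close> vanishes. The factors \<open>1\<close> and \<open>-1\<close> are
    written out to fit the two nested uses of \<open>integ_linear\<close>.\<close>
  have "2 * (X t c x \<bullet> (g c x *v X_dot c t x)) = 2 * div_vec (g c) (?W c) x + 1 * ((-1) * ?S c x + (-1) * div_vec (g c) (?N c) x)"
    if c: "c \<in> A" and x: "x \<in> chart_img c" for c x
  proof -
    note mc = metric_chart[OF c] smooth_X[OF V c]
    have "X t c x \<bullet> (g c x *v X_dot c t x) =
       X t c x \<bullet> (g c x *v div_tensor (g c) (stress (g c) (X t c)) x) - X t c x \<bullet> (g c x *v cov_along (g c) (X t c) (X t c) x)"
      by (simp add: momentum_equation[OF c t x] matrix_vector_mult_diff_distrib inner_diff_right)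
    then show ?thesis
      using metric_chart.div_stress_flux[OF mc x] metric_chart.X_inner_G_cov_along[OF mc x]
        metric_chart.div_norm2_X[OF mc x] div_X[OF t c x] by simp
  qed
  then have "integ (\<lambda>c x. 2 * (X t c x \<bullet> (g c x *v X_dot c t x))) =
     integ (\<lambda>c x. 2 * div_vec (g c) (?W c) x + 1 * ((-1) * ?S c x + (-1) * div_vec (g c) (?N c) x))"
    using C_subset by (intro integ_cong) auto
  also have "\<dots> = 2 * integ (\<lambda>c. div_vec (g c) (?W c)) + 1 * integ (\<lambda>c x. (-1) * ?S c x + (-1) * div_vec (g c) (?N c) x)"
  proof (rule integ_linear)
    fix c assume "c \<in> C"
    then have c: "c \<in> A" by (rule C_subset)
    note mc = metric_chart[OF c] smooth_X[OF V c]
    have sN: "smooth_on (chart_img c) (div_vec (g c) (?N c))"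
      by (rule metric_chart.smooth_div_vec[OF metric_chart[OF c] smooth_X[OF vector_field_norm2_X[OF V] c]])
    show "continuous_on (chart_img c) (div_vec (g c) (?W c))"
      by (rule smooth_on_imp_continuous_on[OF open_img[OF c] metric_chart.smooth_div_vec[OF metric_chart[OF c] metric_chart.smooth_stress_flux[OF mc]]])
    show "continuous_on (chart_img c) (\<lambda>x. (-1) * ?S c x + (-1) * div_vec (g c) (?N c) x)"
      by (intro continuous_intros smooth_on_imp_continuous_on[OF open_img[OF c] sN]
          smooth_on_imp_continuous_on[OF open_img[OF c] metric_chart.smooth_stress_norm2[OF mc]])
  qed
  also have "integ (\<lambda>c x. (-1) * ?S c x + (-1) * div_vec (g c) (?N c) x) = (-1) * integ ?S + (-1) * integ (\<lambda>c. div_vec (g c) (?N c))"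
  proof (rule integ_linear)
    fix c assume "c \<in> C"
    then have c: "c \<in> A" by (rule C_subset)
    note mc = metric_chart[OF c] smooth_X[OF V c]
    show "continuous_on (chart_img c) (div_vec (g c) (?N c))"
      by (rule smooth_on_imp_continuous_on[OF open_img[OF c]
          metric_chart.smooth_div_vec[OF metric_chart[OF c] smooth_X[OF vector_field_norm2_X[OF V] c]]])
    show "continuous_on (chart_img c) (?S c)"
      by (rule smooth_on_imp_continuous_on[OF open_img[OF c] metric_chart.smooth_stress_norm2[OF mc]])
  qed
  finally show ?thesis
    using divergence_theorem[OF vector_field_stress_flux[OF V]] divergence_theorem[OF vector_field_norm2_X[OF V]] by simp
qed

end

end

theorem theorem1p12:
  fixes T :: "'m topology"
    and A :: "('m, 'n::finite) chart set"
    and g :: "('m, 'n) tensor2"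
    and I :: "real set"
    and X :: "real \<Rightarrow> ('m, 'n) vfield"
  assumes "smooth_manifold T A"
    and "compact_space T"
    and "orientable T A"
    and "riemannian_metric A g"
    and "is_interval I" and "interior I \<noteq> {}" and "0 \<in> I"
    and "navier_stokes_solution A g I X"
  shows "(\<forall>t\<in>I.
            ((\<lambda>s. manifold_integral T A g (\<lambda>c. norm2_vec (g c) (X s c)))
               has_real_derivative - 2 * energy T A g (X t)) (at t within I) \<and>
            - 2 * energy T A g (X t) \<le> 0) \<and>
         (\<forall>t\<in>I. 0 \<le> t \<longrightarrow>
            manifold_integral T A g (\<lambda>c. norm2_vec (g c) (X t c))
              \<le> manifold_integral T A g (\<lambda>c. norm2_vec (g c) (X 0 c)))"
proof -
  interpret closed_riemannian T A g
    using assms(1,2,4) by unfold_locales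
  obtain C \<rho> where P: "partition_of_unity T A C \<rho>" and
    mi: "\<forall>f. manifold_integral T A g f =
       (\<Sum>c\<in>C. LINT x:chart_img c|lborel. \<rho> c (chart_inv c x) * f c x * sqrt (det (g c x)))"
    using manifold_integral_partition by blast
  interpret partitioned_riemannian T A g C \<rho>
    using P by unfold_locales
  have mi': "manifold_integral T A g f = integ f" for f by (simp add: mi integ_def)
  let ?N = "\<lambda>s. integ (\<lambda>c. norm2_vec (g c) (X s c))"
  note NS = assms(5,6,8)
  have E: "energy T A g (X t) = integ (\<lambda>c. metric_chart.stress_norm2 (g c) (X t c)) / 2" if t: "t \<in> I" for t
    unfolding energy_def mi' by (rule integ_energy_density[OF vector_field_X[OF NS t] div_X[OF NS t]])
  have D: "(?N has_real_derivative - 2 * energy T A g (X t)) (at t within I)" if t: "t \<in> I" for t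
  proof -
    have half: "- 2 * (a / 2) = - a" for a :: real by simp
    show ?thesis
      using kinetic_energy_has_derivative[OF NS t]
      unfolding kinetic_energy_derivative_eq[OF NS t] E[OF t] half .
  qed
  have nonpos: "- 2 * energy T A g (X t) \<le> 0" if t: "t \<in> I" for t
  proof -
    have "- 2 * (a / 2) \<le> 0" if "0 \<le> a" for a :: real using that by simp
    from this[OF integ_stress_norm2_nonneg[OF vector_field_X[OF NS t]]] show ?thesis
      unfolding E[OF t] .
  qed
  have "?N t \<le> ?N 0" if t: "t \<in> I" "0 \<le> t" for t
  proof -
    have sub: "{0..t} \<subseteq> I"
      by (auto intro: mem_is_interval_1_I[OF assms(5,7) t(1)])
    \<comment> \<open>This mean value theorem accepts one-sided derivatives at the ends of the
      interval and the degenerate case \<open>t = 0\<close>.\<close>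
    have "\<exists>s\<in>{0..t}. ?N t - ?N 0 = (- 2 * energy T A g (X s)) * (t - 0)"
    proof (rule mvt_very_simple[OF t(2)])
      fix s assume s: "0 \<le> s" "s \<le> t"
      then have "s \<in> I" using sub by auto
      from has_field_derivative_subset[OF D[OF this] sub]
      show "(?N has_derivative (*) (- 2 * energy T A g (X s))) (at s within {0..t})"
        by (simp only: has_field_derivative_def)
    qed
    then obtain s where s: "s \<in> {0..t}" "?N t - ?N 0 = (- 2 * energy T A g (X s)) * (t - 0)" by blast
    have "(- 2 * energy T A g (X s)) * (t - 0) \<le> 0"
      using nonpos[of s] s(1) sub t(2) by (intro mult_nonpos_nonneg) auto
    then have "?N t - ?N 0 \<le> 0" by (simp only: s(2))
    then show ?thesis by simp
  qed
  then show ?thesis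
    unfolding mi' using D nonpos by simp
qed

end
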